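(* Suppose that $\theta$ is a random variable defined on a state space $\Theta$, with probability density $p(\theta)$. For any given $\theta\in\Theta$, let $y$ and $y'$ be two random variables that are independent conditional on $\theta$, and both follow the same distribution $p(y|\theta)$. Define $z=y-y'$, and let $p(z|\theta)$ denote the distribution of $z$ conditional on $\theta$. Then $$E_\theta[H(p(y|\theta))]\;\leq\; H\big(E_{\theta}[p(z|\theta)]\big)-\frac{\dim(y)}{2}\log 2,$$ where $\dim(y)$ is the dimensionality of $y$.
   Context: For a distribution with density $p(\cdot)$, $H$ denotes its entropy, $H[p(y)]=-\int \log[p(y)]\,p(y)\,dy$. $H(p(y|\theta))$ is, for fixed $\theta$, the entropy of the distribution $y\mapsto p(y|\theta)$. $E_\theta[\cdot]$ denotes expectation over $\theta\sim p(\theta)$: $E_\theta[H(p(y|\theta))]=\int_\Theta p(\theta)H(p(y|\theta))\,d\theta$, and $E_\theta[p(z|\theta)]$ is the mixture $z\mapsto\int_\Theta p(\theta)p(z|\theta)\,d\theta$. *)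

theory Defs
  imports "HOL-Probability.Probability"
begin

text \<open>
  Lebesgue integral with values in the extended reals, so that infinite entropies are covered.
  It is meaningful under \<open>ext_integrable\<close>, which only excludes the case \<open>\<infinity> - \<infinity>\<close>.
  The function \<open>e2ennreal\<close> sends negative numbers to \<open>0\<close>, so the two terms are
  the integrals of the positive and of the negative part.
\<close>

definition ext_integrable :: "'a measure \<Rightarrow> ('a \<Rightarrow> ereal) \<Rightarrow> bool" where
  "ext_integrable M f \<longleftrightarrow>
     f \<in> borel_measurable M \<and>
     ((\<integral>\<^sup>+x. e2ennreal (f x) \<partial>M) < \<infinity> \<or> (\<integral>\<^sup>+x. e2ennreal (- f x) \<partial>M) < \<infinity>)"

definition ext_integral :: "'a measure \<Rightarrow> ('a \<Rightarrow> ereal) \<Rightarrow> ereal" where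
  "ext_integral M f =
     enn2ereal (\<integral>\<^sup>+x. e2ennreal (f x) \<partial>M) - enn2ereal (\<integral>\<^sup>+x. e2ennreal (- f x) \<partial>M)"

lemma ext_integrable_ereal:
  fixes f :: "'a \<Rightarrow> real"
  assumes "integrable M f"
  shows "ext_integrable M (\<lambda>x. ereal (f x))"
  using assms by (auto simp: ext_integrable_def real_integrable_def less_top)

lemma ext_integral_ereal:
  fixes f :: "'a \<Rightarrow> real"
  assumes "integrable M f"
  shows "ext_integral M (\<lambda>x. ereal (f x)) = ereal (\<integral>x. f x \<partial>M)"
proof -
  have "(\<integral>\<^sup>+x. ennreal (f x) \<partial>M) \<noteq> \<infinity>" "(\<integral>\<^sup>+x. ennreal (- f x) \<partial>M) \<noteq> \<infinity>"
    using assms by (auto simp: real_integrable_def)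
  then show ?thesis
    unfolding ext_integral_def real_lebesgue_integral_def[OF assms]
    by (cases "\<integral>\<^sup>+x. ennreal (f x) \<partial>M"; cases "\<integral>\<^sup>+x. ennreal (- f x) \<partial>M")
      (auto simp: enn2ereal_ennreal)
qed

text \<open>
  Differential entropy (in nats) of a density with respect to Lebesgue measure. Where the density
  vanishes the integrand is \<open>0\<close>, the usual convention for \<open>0 log 0\<close>.
\<close>

definition diff_entropy_exists :: "('a::euclidean_space \<Rightarrow> real) \<Rightarrow> bool" where
  "diff_entropy_exists f \<longleftrightarrow> ext_integrable lborel (\<lambda>y. ereal (ln (f y) * f y))"

definition diff_entropy :: "('a::euclidean_space \<Rightarrow> real) \<Rightarrow> ereal" where
  "diff_entropy f = - ext_integral lborel (\<lambda>y. ereal (ln (f y) * f y))"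

text \<open>
  Conditional expectation given a random variable \<open>T\<close> with values in the measurable space \<open>N\<close>,
  i.e. given the sigma-algebra that \<open>T\<close> generates.
\<close>

definition cond_exp_given ::
  "'w measure \<Rightarrow> 't measure \<Rightarrow> ('w \<Rightarrow> 't) \<Rightarrow> ('w \<Rightarrow> real) \<Rightarrow> 'w \<Rightarrow> real" where
  "cond_exp_given M N T f = real_cond_exp M (vimage_algebra (space M) T N) f"

text \<open>
  \<open>q t\<close> is a probability density for every \<open>t\<close>, and \<open>q t y dy\<close> is a regular conditional
  distribution of \<open>Y\<close> given \<open>T = t\<close>.
\<close>

definition has_cond_density ::
  "'w measure \<Rightarrow> 't measure \<Rightarrow> ('w \<Rightarrow> 't) \<Rightarrow> ('w \<Rightarrow> 'a::euclidean_space)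
    \<Rightarrow> ('t \<Rightarrow> 'a \<Rightarrow> real) \<Rightarrow> bool" where
  "has_cond_density M N T Y q \<longleftrightarrow>
     T \<in> measurable M N \<and>
     Y \<in> borel_measurable M \<and>
     (\<lambda>(t, y). q t y) \<in> borel_measurable (N \<Otimes>\<^sub>M lborel) \<and>
     (\<forall>t\<in>space N. (\<forall>y. 0 \<le> q t y) \<and> (\<integral>\<^sup>+y. ennreal (q t y) \<partial>lborel) = 1) \<and>
     (\<forall>A\<in>sets borel. AE \<omega> in M.
        cond_exp_given M N T (\<lambda>\<omega>. indicator A (Y \<omega>)) \<omega> = (LINT y:A|lborel. q (T \<omega>) y))"

definition cond_indep_given ::
  "'w measure \<Rightarrow> 't measure \<Rightarrow> ('w \<Rightarrow> 't) \<Rightarrow> ('w \<Rightarrow> 'a::euclidean_space)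
    \<Rightarrow> ('w \<Rightarrow> 'a) \<Rightarrow> bool" where
  "cond_indep_given M N T X Y \<longleftrightarrow>
     (\<forall>A\<in>sets borel. \<forall>B\<in>sets borel. AE \<omega> in M.
        cond_exp_given M N T (\<lambda>\<omega>. indicator A (X \<omega>) * indicator B (Y \<omega>)) \<omega> =
        cond_exp_given M N T (\<lambda>\<omega>. indicator A (X \<omega>)) \<omega> *
        cond_exp_given M N T (\<lambda>\<omega>. indicator B (Y \<omega>)) \<omega>)"

text \<open>The mixture \<open>E\<^sub>\<theta>[r(z|\<theta>)]\<close>, for \<open>\<theta>\<close> with density \<open>p\<close> with respect to \<open>N\<close>.\<close>

definition mixture_density ::
  "'t measure \<Rightarrow> ('t \<Rightarrow> real) \<Rightarrow> ('t \<Rightarrow> 'a::euclidean_space \<Rightarrow> real) \<Rightarrow> 'a \<Rightarrow> real" where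
  "mixture_density N p r z = (\<integral>t. p t * r t z \<partial>N)"

end

theory Submission
  imports Defs "HOL-Real_Asymp.Real_Asymp"
begin

text \<open>
  For densities \<open>f\<close> and \<open>g\<close> one shows the dual form of the entropy power inequality,
  \<open>- E (ln (g (X - X'))) \<ge> h f + n / 2 * ln 2\<close> for independent \<open>X\<close>, \<open>X'\<close> with density \<open>f\<close>.
  In dimension one this is Rioul's argument: write \<open>X = T1 G\<close> and \<open>X' = T2 G'\<close> with monotone maps
  \<open>T1\<close>, \<open>T2\<close> and independent standard Gaussians, rotate \<open>(G, G')\<close> by 45 degrees, change variables
  along one rotated coordinate, and use Jensen's inequality and the concavity of the logarithm.
  Conditioning on the first coordinates extends the inequality to products, truncation to arbitrary
  densities. Taking \<open>f = q t\<close> and for \<open>g\<close> the density of \<open>Z\<close>, which is the mixture, and averaging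
  over \<open>t\<close> gives the theorem: since \<open>g\<close> does not depend on \<open>t\<close>, the averaged cross entropy is
  the entropy of the mixture.
\<close>

section \<open>The entropy power inequality in dual form and its tensorization\<close>

text \<open>The constant comes from the linear form of the entropy power inequality with equal
  weights: the entropy of (X - X') / sqrt 2 is at least the mean of the entropies of X and X', and
  undoing the scaling by sqrt 2 in n dimensions adds n / 2 * ln 2. Two densities are carried along,
  although both variables have the same one in the end, because conditioning on distinct first
  coordinates produces distinct conditional densities. The mass of g is left free and enters through
  the logarithm of its integral, so marginals, floors and restrictions of g need no renormalization.
  The obstacle is integrability, since entropies and cross entropies may be infinite. The core
  inequality is therefore proved on cubes, for functions bounded above and away from zero, where
  every logarithm is bounded and Fubini and limits are harmless. The passage to the whole space
  takes place in the extended nonnegative reals, with positive and negative parts kept on opposite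
  sides, and the subtraction of possibly infinite quantities is deferred to the end.\<close>

definition bounded_measurable :: "'a measure \<Rightarrow> ('a \<Rightarrow> real) \<Rightarrow> bool" where
  "bounded_measurable M f \<longleftrightarrow> f \<in> borel_measurable M \<and> (\<exists>C. \<forall>x\<in>space M. \<bar>f x\<bar> \<le> C)"

text \<open>The positive lower bound keeps \<open>ln (f x)\<close> bounded. The bounds hold at every
  point of the space and not merely almost everywhere, so every section of a pinched function of two
  variables is pinched again and conditional densities exist at every point.\<close>

definition pinched :: "'a measure \<Rightarrow> ('a \<Rightarrow> real) \<Rightarrow> bool" where
  "pinched M f \<longleftrightarrow> f \<in> borel_measurable M \<and> (\<exists>c>0. \<exists>C. \<forall>x\<in>space M. c \<le> f x \<and> f x \<le> C)"

section \<open>Closure properties of bounded and pinched functions\<close>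

lemma bounded_measurableD [measurable_dest]:
  "bounded_measurable M f \<Longrightarrow> f \<in> borel_measurable M"
  by (simp add: bounded_measurable_def)

lemma pinchedD [measurable_dest]: "pinched M f \<Longrightarrow> f \<in> borel_measurable M"
  by (simp add: pinched_def)

lemma pinched_pos: "pinched M f \<Longrightarrow> x \<in> space M \<Longrightarrow> 0 < f x"
  unfolding pinched_def by force

lemma pinched_imp_bounded: "pinched M f \<Longrightarrow> bounded_measurable M f"
  unfolding pinched_def bounded_measurable_def by fastforce

lemma pinched_ln_bounded:
  assumes "pinched M f" shows "bounded_measurable M (\<lambda>x. ln (f x))"
proof -
  note assms[measurable]
  from assms obtain c C where c: "0 < c" "\<And>x. x \<in> space M \<Longrightarrow> c \<le> f x \<and> f x \<le> C"
    unfolding pinched_def by blast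
  have "\<bar>ln (f x)\<bar> \<le> \<bar>ln c\<bar> + \<bar>ln C\<bar>" if "x \<in> space M" for x
  proof -
    from c(2)[OF that] c(1) have "ln c \<le> ln (f x)" "ln (f x) \<le> ln C"
      by (auto intro!: ln_mono)
    then show ?thesis by linarith
  qed
  then show ?thesis unfolding bounded_measurable_def by auto
qed

lemma bounded_measurable_const: "bounded_measurable M (\<lambda>_. c)"
  unfolding bounded_measurable_def by auto

lemma bounded_measurable_add:
  assumes "bounded_measurable M f" "bounded_measurable M g"
  shows "bounded_measurable M (\<lambda>x. f x + g x)"
proof -
  note assms[measurable]
  from assms obtain C D where "\<And>x. x \<in> space M \<Longrightarrow> \<bar>f x\<bar> \<le> C" "\<And>x. x \<in> space M \<Longrightarrow> \<bar>g x\<bar> \<le> D"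
    unfolding bounded_measurable_def by blast
  then have "\<forall>x\<in>space M. \<bar>f x + g x\<bar> \<le> C + D" by (meson abs_triangle_ineq add_mono order_trans)
  then show ?thesis unfolding bounded_measurable_def by auto
qed

lemma bounded_measurable_mult:
  assumes "bounded_measurable M f" "bounded_measurable M g"
  shows "bounded_measurable M (\<lambda>x. f x * g x)"
proof -
  note assms[measurable]
  from assms obtain C D where CD: "\<And>x. x \<in> space M \<Longrightarrow> \<bar>f x\<bar> \<le> C" "\<And>x. x \<in> space M \<Longrightarrow> \<bar>g x\<bar> \<le> D"
    unfolding bounded_measurable_def by blast
  have "\<bar>f x * g x\<bar> \<le> C * D" if "x \<in> space M" for x
  proof -
    have "0 \<le> C" using CD(1)[OF that] abs_ge_zero[of "f x"] by linarith
    then show ?thesis unfolding abs_mult using CD[OF that] by (intro mult_mono) auto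
  qed
  then show ?thesis unfolding bounded_measurable_def by auto
qed

lemma bounded_measurable_diff:
  assumes "bounded_measurable M f" "bounded_measurable M g"
  shows "bounded_measurable M (\<lambda>x. f x - g x)"
  using bounded_measurable_add[OF assms(1) bounded_measurable_mult[OF bounded_measurable_const[of M "-1"] assms(2)]]
  by simp

lemma bounded_measurable_compose:
  assumes "bounded_measurable N f" "h \<in> measurable M N"
  shows "bounded_measurable M (\<lambda>x. f (h x))"
proof -
  have m: "(\<lambda>x. f (h x)) \<in> borel_measurable M"
    by (rule measurable_compose[OF assms(2) bounded_measurableD[OF assms(1)]])
  show ?thesis using assms(1) m measurable_space[OF assms(2)] unfolding bounded_measurable_def by auto
qed

lemma pinched_compose:
  assumes "pinched N f" "h \<in> measurable M N"
  shows "pinched M (\<lambda>x. f (h x))"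
proof -
  have m: "(\<lambda>x. f (h x)) \<in> borel_measurable M"
    by (rule measurable_compose[OF assms(2) pinchedD[OF assms(1)]])
  show ?thesis using assms(1) m measurable_space[OF assms(2)] unfolding pinched_def by meson
qed

lemma pinched_divide:
  assumes "pinched M f" "pinched M g"
  shows "pinched M (\<lambda>x. f x / g x)"
proof -
  note assms[measurable]
  obtain c C where c: "0 < c" "\<And>x. x \<in> space M \<Longrightarrow> c \<le> f x \<and> f x \<le> C"
    using assms(1) unfolding pinched_def by blast
  obtain d D where d: "0 < d" "\<And>x. x \<in> space M \<Longrightarrow> d \<le> g x \<and> g x \<le> D"
    using assms(2) unfolding pinched_def by blast
  \<comment> \<open>On an empty space the bound \<open>D\<close> could be zero or negative;
    \<open>max D 1\<close> keeps the lower constant positive in that case too.\<close>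
  have "\<forall>x\<in>space M. c / max D 1 \<le> f x / g x \<and> f x / g x \<le> C / d"
  proof
    fix x assume "x \<in> space M"
    then show "c / max D 1 \<le> f x / g x \<and> f x / g x \<le> C / d"
      using c(1) d(1) c(2)[of x] d(2)[of x] by (auto intro!: frac_le)
  qed
  moreover have "c / max D 1 > 0" using c(1) by simp
  ultimately show ?thesis unfolding pinched_def by (intro conjI exI) auto
qed

lemma (in finite_measure) integrable_bounded_measurable:
  assumes "bounded_measurable M f" shows "integrable M f"
proof -
  from assms obtain C where "\<And>x. x \<in> space M \<Longrightarrow> \<bar>f x\<bar> \<le> C" "f \<in> borel_measurable M"
    unfolding bounded_measurable_def by blast
  then show ?thesis by (intro integrable_const_bound[of _ C]) auto
qed

lemma bounded_measurable_integral:
  assumes "finite_measure M" "bounded_measurable (N \<Otimes>\<^sub>M M) (\<lambda>(x, y). f x y)"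
  shows "bounded_measurable N (\<lambda>x. \<integral>y. f x y \<partial>M)"
proof -
  interpret finite_measure M by fact
  note assms(2)[measurable]
  obtain C where C: "\<And>x y. x \<in> space N \<Longrightarrow> y \<in> space M \<Longrightarrow> \<bar>f x y\<bar> \<le> C"
    using assms(2) unfolding bounded_measurable_def by (auto simp: space_pair_measure)
  have "(\<lambda>(x, y). f x y) \<in> borel_measurable (N \<Otimes>\<^sub>M M)" by measurable
  then have m: "(\<lambda>x. \<integral>y. f x y \<partial>M) \<in> borel_measurable N"
    by (rule borel_measurable_lebesgue_integral)
  have "\<bar>\<integral>y. f x y \<partial>M\<bar> \<le> C * measure M (space M)" if x: "x \<in> space N" for x
  proof -
    have "(\<lambda>y. f x y) \<in> borel_measurable M"
      using measurable_compose[OF measurable_Pair1'[OF x] \<open>(\<lambda>(x, y). f x y) \<in> _\<close>] by simp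
    then have "bounded_measurable M (f x)"
      using C[OF x] unfolding bounded_measurable_def by auto
    note i = integrable_bounded_measurable[OF this]
    have "\<bar>\<integral>y. f x y \<partial>M\<bar> \<le> (\<integral>y. \<bar>f x y\<bar> \<partial>M)" by (rule integral_abs_bound)
    also have "\<dots> \<le> (\<integral>y. C \<partial>M)"
      using i C[OF x] by (intro integral_mono) auto
    also have "\<dots> = C * measure M (space M)" by simp
    finally show ?thesis .
  qed
  then show ?thesis using m unfolding bounded_measurable_def by blast
qed

text \<open>For marginals. The bounds are multiplied by the total mass, so the lower one survives
  because the mass is not zero.\<close>

lemma pinched_integral:
  assumes "finite_measure M" "emeasure M (space M) \<noteq> 0" "pinched (N \<Otimes>\<^sub>M M) (\<lambda>(x, y). f x y)"
  shows "pinched N (\<lambda>x. \<integral>y. f x y \<partial>M)"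
proof -
  interpret finite_measure M by fact
  note assms(3)[measurable]
  obtain c C where C: "0 < c" "\<And>x y. x \<in> space N \<Longrightarrow> y \<in> space M \<Longrightarrow> c \<le> f x y \<and> f x y \<le> C"
    using assms(3) unfolding pinched_def by (auto simp: space_pair_measure)
  have "(\<lambda>(x, y). f x y) \<in> borel_measurable (N \<Otimes>\<^sub>M M)" by measurable
  then have m: "(\<lambda>x. \<integral>y. f x y \<partial>M) \<in> borel_measurable N"
    by (rule borel_measurable_lebesgue_integral)
  have "c * measure M (space M) \<le> (\<integral>y. f x y \<partial>M) \<and> (\<integral>y. f x y \<partial>M) \<le> C * measure M (space M)"
    if x: "x \<in> space N" for x
  proof -
    have "(\<lambda>y. f x y) \<in> borel_measurable M"
      using measurable_compose[OF measurable_Pair1'[OF x] \<open>(\<lambda>(x, y). f x y) \<in> _\<close>] by simp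
    then have "pinched M (f x)"
      using C(1) C(2)[OF x] unfolding pinched_def by blast
    note i = integrable_bounded_measurable[OF pinched_imp_bounded[OF this]]
    have "(\<integral>y. c \<partial>M) \<le> (\<integral>y. f x y \<partial>M)"
      using i C(2)[OF x] by (intro integral_mono) auto
    moreover have "(\<integral>y. f x y \<partial>M) \<le> (\<integral>y. C \<partial>M)"
      using i C(2)[OF x] by (intro integral_mono) auto
    ultimately show ?thesis by (simp add: mult.commute)
  qed
  moreover have "c * measure M (space M) > 0"
    using C(1) assms(2) by (simp add: emeasure_eq_measure measure_le_0_iff zero_less_measure_iff)
  ultimately show ?thesis using m unfolding pinched_def by blast
qed

lemma pinched_integral_pos:
  assumes "finite_measure M" "emeasure M (space M) \<noteq> 0" "pinched M f"
  shows "0 < (\<integral>x. f x \<partial>M)"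
proof -
  interpret finite_measure M by fact
  obtain c where c: "0 < c" "\<And>x. x \<in> space M \<Longrightarrow> c \<le> f x"
    using assms(3) unfolding pinched_def by blast
  have "0 < c * measure M (space M)"
    using c(1) assms(2) by (simp add: emeasure_eq_measure measure_le_0_iff zero_less_measure_iff)
  also have "\<dots> = (\<integral>x. c \<partial>M)" by simp
  also have "\<dots> \<le> (\<integral>x. f x \<partial>M)"
    using c(2) integrable_bounded_measurable[OF pinched_imp_bounded[OF assms(3)]]
    by (intro integral_mono) auto
  finally show ?thesis .
qed

text \<open>
  The entropy power inequality for two distributions on \<open>A\<close> in its dual form: by Gibbs' inequality
  the entropy of \<open>s X Y\<close> is the least cross entropy \<open>- E (ln (g (s X Y)))\<close> over densities \<open>g\<close> on \<open>B\<close>.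
  Keeping \<open>g\<close> arbitrary avoids the density of \<open>s X Y\<close>, and this form passes to products and to limits.
\<close>

definition gibbs_epi ::
  "'a measure \<Rightarrow> 'b measure \<Rightarrow> ('a \<Rightarrow> 'a \<Rightarrow> 'b) \<Rightarrow> real \<Rightarrow> bool" where
  "gibbs_epi A B s k \<longleftrightarrow>
     finite_measure A \<and> finite_measure B \<and> emeasure A (space A) \<noteq> 0 \<and> emeasure B (space B) \<noteq> 0 \<and>
     (\<lambda>(x, y). s x y) \<in> measurable (A \<Otimes>\<^sub>M A) B \<and>
     (\<forall>f1 f2 g. pinched A f1 \<longrightarrow> pinched A f2 \<longrightarrow> pinched B g \<longrightarrow>
        (\<integral>x. f1 x \<partial>A) = 1 \<longrightarrow> (\<integral>x. f2 x \<partial>A) = 1 \<longrightarrow>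
        (\<integral>x. \<integral>y. f1 x * f2 y * ln (g (s x y)) \<partial>A \<partial>A) \<le>
          ln (\<integral>z. g z \<partial>B) + (\<integral>x. f1 x * ln (f1 x) \<partial>A) / 2 + (\<integral>x. f2 x * ln (f2 x) \<partial>A) / 2 - k)"

lemma gibbs_epiD:
  assumes "gibbs_epi A B s k" "pinched A f1" "pinched A f2" "pinched B g"
    and "(\<integral>x. f1 x \<partial>A) = 1" "(\<integral>x. f2 x \<partial>A) = 1"
  shows "(\<integral>x. \<integral>y. f1 x * f2 y * ln (g (s x y)) \<partial>A \<partial>A) \<le>
    ln (\<integral>z. g z \<partial>B) + (\<integral>x. f1 x * ln (f1 x) \<partial>A) / 2 + (\<integral>x. f2 x * ln (f2 x) \<partial>A) / 2 - k"
  using assms unfolding gibbs_epi_def by blast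

text \<open>
  The second inequality is applied to the conditional densities of the second coordinate given the
  first, the first one to the marginals; the entropies add up by the chain rule.
\<close>

lemma gibbs_epi_pair:
  fixes A1 :: "'a measure" and A2 :: "'c measure" and B1 :: "'b measure" and B2 :: "'d measure"
  assumes e1: "gibbs_epi A1 B1 s1 k1" and e2: "gibbs_epi A2 B2 s2 k2"
  shows "gibbs_epi (A1 \<Otimes>\<^sub>M A2) (B1 \<Otimes>\<^sub>M B2) (\<lambda>x y. (s1 (fst x) (fst y), s2 (snd x) (snd y))) (k1 + k2)"
proof -
  have fin: "finite_measure A1" "finite_measure A2" "finite_measure B1" "finite_measure B2"
    and ne: "emeasure A1 (space A1) \<noteq> 0" "emeasure A2 (space A2) \<noteq> 0"
      "emeasure B1 (space B1) \<noteq> 0" "emeasure B2 (space B2) \<noteq> 0"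
    and s1': "(\<lambda>(x, y). s1 x y) \<in> measurable (A1 \<Otimes>\<^sub>M A1) B1"
    and s2': "(\<lambda>(x, y). s2 x y) \<in> measurable (A2 \<Otimes>\<^sub>M A2) B2"
    using e1 e2 unfolding gibbs_epi_def by auto
  interpret A1: finite_measure A1 by fact
  interpret A2: finite_measure A2 by fact
  interpret B1: finite_measure B1 by fact
  interpret B2: finite_measure B2 by fact
  interpret AA: finite_measure "A1 \<Otimes>\<^sub>M A2" by (rule finite_measure_pair_measure) fact+
  interpret BB: finite_measure "B1 \<Otimes>\<^sub>M B2" by (rule finite_measure_pair_measure) fact+
  interpret P12: pair_sigma_finite A1 A2 ..
  interpret P21: pair_sigma_finite A2 A1 ..
  interpret P11: pair_sigma_finite A1 A1 ..
  interpret PB: pair_sigma_finite B1 B2 ..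
  have F11: "finite_measure (A1 \<Otimes>\<^sub>M A1)" by (rule finite_measure_pair_measure) fact+
  have F21: "finite_measure (A2 \<Otimes>\<^sub>M A1)" by (rule finite_measure_pair_measure) fact+
  note s1'[measurable] s2'[measurable]
  have s1m[measurable]: "(\<lambda>w. s1 (h w) (h' w)) \<in> measurable W B1"
    if [measurable]: "h \<in> measurable W A1" "h' \<in> measurable W A1" for h h' and W :: "'w measure"
  proof -
    have "(\<lambda>w. (case (h w, h' w) of (x, y) \<Rightarrow> s1 x y)) \<in> measurable W B1" by measurable
    then show ?thesis by simp
  qed
  have s2m[measurable]: "(\<lambda>w. s2 (h w) (h' w)) \<in> measurable W B2"
    if [measurable]: "h \<in> measurable W A2" "h' \<in> measurable W A2" for h h' and W :: "'w measure"
  proof -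
    have "(\<lambda>w. (case (h w, h' w) of (x, y) \<Rightarrow> s2 x y)) \<in> measurable W B2" by measurable
    then show ?thesis by simp
  qed
  let ?A = "A1 \<Otimes>\<^sub>M A2" and ?B = "B1 \<Otimes>\<^sub>M B2"
  let ?s = "\<lambda>x y. (s1 (fst x) (fst y), s2 (snd x) (snd y))"
  have sm: "(\<lambda>(x, y). ?s x y) \<in> measurable (?A \<Otimes>\<^sub>M ?A) ?B" by measurable
  have ne': "emeasure ?A (space ?A) \<noteq> 0" "emeasure ?B (space ?B) \<noteq> 0"
    using ne by (simp_all add: space_pair_measure A2.emeasure_pair_measure_Times B2.emeasure_pair_measure_Times)
  have main: "(\<integral>x. \<integral>y. f1 x * f2 y * ln (g (?s x y)) \<partial>?A \<partial>?A) \<le>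
          ln (\<integral>z. g z \<partial>?B) + (\<integral>x. f1 x * ln (f1 x) \<partial>?A) / 2 + (\<integral>x. f2 x * ln (f2 x) \<partial>?A) / 2 - (k1 + k2)"
    if f1: "pinched ?A f1" and f2: "pinched ?A f2" and g: "pinched ?B g"
      and i1: "(\<integral>x. f1 x \<partial>?A) = 1" and i2: "(\<integral>x. f2 x \<partial>?A) = 1" for f1 f2 g
  proof -
    define F1 where "F1 x = (\<integral>y. f1 (x, y) \<partial>A2)" for x
    define F2 where "F2 x = (\<integral>y. f2 (x, y) \<partial>A2)" for x
    define G where "G x = (\<integral>y. g (x, y) \<partial>B2)" for x
    note bi = pinched_ln_bounded bounded_measurable_mult bounded_measurable_add
      bounded_measurable_const bounded_measurable_diff
    have F1: "pinched A1 F1" unfolding F1_def using f1 fin ne by (intro pinched_integral) auto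
    have F2: "pinched A1 F2" unfolding F2_def using f2 fin ne by (intro pinched_integral) auto
    have G: "pinched B1 G" unfolding G_def using g fin ne by (intro pinched_integral) auto
    note [measurable] = f1[THEN pinchedD] f2[THEN pinchedD] g[THEN pinchedD]
      F1[THEN pinchedD] F2[THEN pinchedD] G[THEN pinchedD]
    note fb = f1[THEN pinched_imp_bounded] f2[THEN pinched_imp_bounded]
      F1[THEN pinched_imp_bounded] F2[THEN pinched_imp_bounded]
    have f1b: "bounded_measurable ?A (\<lambda>x. f1 x * ln (f1 x))"
      and f2b: "bounded_measurable ?A (\<lambda>x. f2 x * ln (f2 x))" using f1 f2 fb by (auto intro!: bi)
    \<comment> \<open>\<open>J f F x\<close> is \<open>F x\<close> times the negative entropy of the
      conditional density \<open>f (x, _) / F x\<close>. Its integral over \<open>x\<close> is the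
      joint term minus the marginal term, which is the chain rule for entropy.\<close>
    define J where "J f F x = (\<integral>y. f (x, y) * ln (f (x, y)) \<partial>A2) - F x * ln (F x)"
      for f :: "'a \<times> 'c \<Rightarrow> real" and F :: "'a \<Rightarrow> real" and x
    have J1: "bounded_measurable A1 (J f1 F1)" and J2: "bounded_measurable A1 (J f2 F2)"
      unfolding J_def using fin f1b f2b F1 F2 fb
      by (auto intro!: bi bounded_measurable_integral simp: split_beta')
    have iJ1: "(\<integral>x. J f1 F1 x \<partial>A1) = (\<integral>x. f1 x * ln (f1 x) \<partial>?A) - (\<integral>x. F1 x * ln (F1 x) \<partial>A1)"
      unfolding J_def
    proof (subst Bochner_Integration.integral_diff)
      show "integrable A1 (\<lambda>x. \<integral>y. f1 (x, y) * ln (f1 (x, y)) \<partial>A2)"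
        using f1b fin by (intro A1.integrable_bounded_measurable bounded_measurable_integral) (auto simp: split_beta')
      show "integrable A1 (\<lambda>x. F1 x * ln (F1 x))"
        using F1 fb by (intro A1.integrable_bounded_measurable) (auto intro!: bi)
      show "(\<integral>x. \<integral>y. f1 (x, y) * ln (f1 (x, y)) \<partial>A2 \<partial>A1) - (\<integral>x. F1 x * ln (F1 x) \<partial>A1) =
          (\<integral>x. f1 x * ln (f1 x) \<partial>?A) - (\<integral>x. F1 x * ln (F1 x) \<partial>A1)"
        using P12.integral_fst'[OF AA.integrable_bounded_measurable[OF f1b]] by simp
    qed
    have iJ2: "(\<integral>x. J f2 F2 x \<partial>A1) = (\<integral>x. f2 x * ln (f2 x) \<partial>?A) - (\<integral>x. F2 x * ln (F2 x) \<partial>A1)"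
      unfolding J_def
    proof (subst Bochner_Integration.integral_diff)
      show "integrable A1 (\<lambda>x. \<integral>y. f2 (x, y) * ln (f2 (x, y)) \<partial>A2)"
        using f2b fin by (intro A1.integrable_bounded_measurable bounded_measurable_integral) (auto simp: split_beta')
      show "integrable A1 (\<lambda>x. F2 x * ln (F2 x))"
        using F2 fb by (intro A1.integrable_bounded_measurable) (auto intro!: bi)
      show "(\<integral>x. \<integral>y. f2 (x, y) * ln (f2 (x, y)) \<partial>A2 \<partial>A1) - (\<integral>x. F2 x * ln (F2 x) \<partial>A1) =
          (\<integral>x. f2 x * ln (f2 x) \<partial>?A) - (\<integral>x. F2 x * ln (F2 x) \<partial>A1)"
        using P12.integral_fst'[OF AA.integrable_bounded_measurable[OF f2b]] by simp
    qed
    have iF1: "(\<integral>x. F1 x \<partial>A1) = 1"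
      using P12.integral_fst'[OF AA.integrable_bounded_measurable[OF pinched_imp_bounded[OF f1]]] i1
      by (simp add: F1_def)
    have iF2: "(\<integral>x. F2 x \<partial>A1) = 1"
      using P12.integral_fst'[OF AA.integrable_bounded_measurable[OF pinched_imp_bounded[OF f2]]] i2
      by (simp add: F2_def)
    have iG: "(\<integral>x. G x \<partial>B1) = (\<integral>z. g z \<partial>?B)"
      using PB.integral_fst'[OF BB.integrable_bounded_measurable[OF pinched_imp_bounded[OF g]]]
      by (simp add: G_def)
    have cond: "(\<integral>y. f (x, y) / F x * ln (f (x, y) / F x) \<partial>A2) = J f F x / F x"
      if f: "pinched ?A f" and FF: "F x > 0" "F x = (\<integral>y. f (x, y) \<partial>A2)" and x: "x \<in> space A1" for f F x
    proof -
      have fx: "pinched A2 (\<lambda>y. f (x, y))" using f by (rule pinched_compose) (use x in measurable)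
      have "(\<integral>y. f (x, y) / F x * ln (f (x, y) / F x) \<partial>A2)
          = (\<integral>y. (f (x, y) * ln (f (x, y))) / F x - f (x, y) * (ln (F x) / F x) \<partial>A2)"
        using pinched_pos[OF fx] FF(1)
        by (intro Bochner_Integration.integral_cong refl) (auto simp: ln_div field_simps)
      also have "\<dots> = (\<integral>y. f (x, y) * ln (f (x, y)) \<partial>A2) / F x - F x * (ln (F x) / F x)"
        using fx fx[THEN pinched_imp_bounded] unfolding divide_inverse by (subst Bochner_Integration.integral_diff)
          (auto intro!: A2.integrable_bounded_measurable bi simp: FF(2))
      finally show ?thesis using FF(1) by (simp add: J_def field_simps)
    qed
    \<comment> \<open>The second inequality at fixed first coordinates, multiplied by the weight
      \<open>F1 x1 * F2 y1\<close>. The section of \<open>g\<close> has mass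
      \<open>G (s1 x1 y1)\<close>, so the marginal \<open>G\<close> becomes the test function for
      the first inequality.\<close>
    have inner: "(\<integral>x2. \<integral>y2. f1 (x1, x2) * f2 (y1, y2) * ln (g (s1 x1 y1, s2 x2 y2)) \<partial>A2 \<partial>A2)
       \<le> F1 x1 * F2 y1 * ln (G (s1 x1 y1)) + F2 y1 * J f1 F1 x1 / 2 + F1 x1 * J f2 F2 y1 / 2 - k2 * (F1 x1 * F2 y1)"
      if x: "x1 \<in> space A1" and y: "y1 \<in> space A1" for x1 y1
    proof -
      have p: "F1 x1 > 0" "F2 y1 > 0" using pinched_pos[OF F1 x] pinched_pos[OF F2 y] by auto
      have f1x: "pinched A2 (\<lambda>x2. f1 (x1, x2))" using f1 by (rule pinched_compose) (use x in measurable)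
      have f2y: "pinched A2 (\<lambda>x2. f2 (y1, x2))" using f2 by (rule pinched_compose) (use y in measurable)
      have "s1 x1 y1 \<in> space B1" using measurable_space[OF s1', of "(x1,y1)"] x y by (auto simp: space_pair_measure)
      then have gs: "pinched B2 (\<lambda>z. g (s1 x1 y1, z))" using g by (auto intro!: pinched_compose[OF g])
      have pc: "pinched A2 (\<lambda>x. c)" if "0 < c" for c using that unfolding pinched_def by auto
      have "(\<integral>x2. \<integral>y2. (f1 (x1, x2) / F1 x1) * (f2 (y1, y2) / F2 y1) * ln (g (s1 x1 y1, s2 x2 y2)) \<partial>A2 \<partial>A2)
        \<le> ln (\<integral>z. g (s1 x1 y1, z) \<partial>B2) + (\<integral>x2. (f1 (x1, x2) / F1 x1) * ln (f1 (x1, x2) / F1 x1) \<partial>A2) / 2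
          + (\<integral>x2. (f2 (y1, x2) / F2 y1) * ln (f2 (y1, x2) / F2 y1) \<partial>A2) / 2 - k2"
        using p by (intro gibbs_epiD[OF e2 pinched_divide[OF f1x pc] pinched_divide[OF f2y pc] gs])
          (auto simp: F1_def[symmetric] F2_def[symmetric])
      also have "(\<integral>x2. (f1 (x1, x2) / F1 x1) * ln (f1 (x1, x2) / F1 x1) \<partial>A2) = J f1 F1 x1 / F1 x1"
        using p x f1 by (intro cond) (auto simp: F1_def)
      also have "(\<integral>x2. (f2 (y1, x2) / F2 y1) * ln (f2 (y1, x2) / F2 y1) \<partial>A2) = J f2 F2 y1 / F2 y1"
        using p y f2 by (intro cond) (auto simp: F2_def)
      also have "(\<integral>x2. \<integral>y2. (f1 (x1, x2) / F1 x1) * (f2 (y1, y2) / F2 y1) * ln (g (s1 x1 y1, s2 x2 y2)) \<partial>A2 \<partial>A2)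
        = (\<integral>x2. \<integral>y2. f1 (x1, x2) * f2 (y1, y2) * ln (g (s1 x1 y1, s2 x2 y2)) / (F1 x1 * F2 y1) \<partial>A2 \<partial>A2)"
        by (intro Bochner_Integration.integral_cong refl) simp
      also have "\<dots> = (\<integral>x2. \<integral>y2. f1 (x1, x2) * f2 (y1, y2) * ln (g (s1 x1 y1, s2 x2 y2)) \<partial>A2 \<partial>A2) / (F1 x1 * F2 y1)"
        by simp
      finally have "(\<integral>x2. \<integral>y2. f1 (x1, x2) * f2 (y1, y2) * ln (g (s1 x1 y1, s2 x2 y2)) \<partial>A2 \<partial>A2)
        \<le> (ln (G (s1 x1 y1)) + J f1 F1 x1 / F1 x1 / 2 + J f2 F2 y1 / F2 y1 / 2 - k2) * (F1 x1 * F2 y1)"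
        using p by (simp add: pos_divide_le_eq G_def[symmetric])
      also have "\<dots> = F1 x1 * F2 y1 * ln (G (s1 x1 y1)) + F2 y1 * J f1 F1 x1 / 2 + F1 x1 * J f2 F2 y1 / 2 - k2 * (F1 x1 * F2 y1)"
        using p by (simp add: field_simps)
      finally show ?thesis .
    qed
    define K where "K x1 x2 y1 y2 = f1 (x1, x2) * f2 (y1, y2) * ln (g (s1 x1 y1, s2 x2 y2))" for x1 x2 y1 y2
    have Kb: "bounded_measurable W (\<lambda>w. K (a w) (b w) (c w) (d w))"
      if [measurable]: "a \<in> measurable W A1" "b \<in> measurable W A2" "c \<in> measurable W A1" "d \<in> measurable W A2"
      for a b c d and W :: "'w measure"
      unfolding K_def
      by (intro bi bounded_measurable_compose[OF fb(1)] bounded_measurable_compose[OF fb(2)] pinched_compose[OF g]; measurable)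
    have "(\<integral>x. \<integral>y. f1 x * f2 y * ln (g (?s x y)) \<partial>?A \<partial>?A) = (\<integral>x. \<integral>y. K (fst x) (snd x) (fst y) (snd y) \<partial>?A \<partial>?A)"
      by (simp add: K_def)
    also have "\<dots> = (\<integral>x1. \<integral>x2. (\<integral>y. K x1 x2 (fst y) (snd y) \<partial>?A) \<partial>A2 \<partial>A1)"
    proof -
      have "bounded_measurable ?A (\<lambda>x. \<integral>y. K (fst x) (snd x) (fst y) (snd y) \<partial>?A)"
        unfolding split_beta' by (intro bounded_measurable_integral AA.finite_measure_axioms) (simp add: split_beta', intro Kb, measurable)
      from P12.integral_fst'[OF AA.integrable_bounded_measurable[OF this]]
      show ?thesis by simp
    qed
    also have "\<dots> = (\<integral>x1. \<integral>x2. \<integral>y1. \<integral>y2. K x1 x2 y1 y2 \<partial>A2 \<partial>A1 \<partial>A2 \<partial>A1)"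
    proof (intro Bochner_Integration.integral_cong refl)
      fix x1 x2 assume x: "x1 \<in> space A1" "x2 \<in> space A2"
      have "bounded_measurable ?A (\<lambda>y. K x1 x2 (fst y) (snd y))"
        using x by (intro Kb) auto
      from P12.integral_fst'[OF AA.integrable_bounded_measurable[OF this]]
      show "(\<integral>y. K x1 x2 (fst y) (snd y) \<partial>?A) = (\<integral>y1. \<integral>y2. K x1 x2 y1 y2 \<partial>A2 \<partial>A1)" by simp
    qed
    \<comment> \<open>The integrations are reordered from \<open>x1, x2, y1, y2\<close> to
      \<open>x1, y1, x2, y2\<close>, so that both second coordinates are innermost and
      \<open>inner\<close> applies pointwise.\<close>
    also have "\<dots> = (\<integral>x1. \<integral>y1. \<integral>x2. \<integral>y2. K x1 x2 y1 y2 \<partial>A2 \<partial>A2 \<partial>A1 \<partial>A1)"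
    proof (intro Bochner_Integration.integral_cong refl)
      fix x1 assume x: "x1 \<in> space A1"
      have "bounded_measurable (A2 \<Otimes>\<^sub>M A1) (\<lambda>w. \<integral>y2. K x1 (fst w) (snd w) y2 \<partial>A2)"
        using x by (intro bounded_measurable_integral fin) (simp add: split_beta', intro Kb, auto)
      from P21.Fubini_integral[of "\<lambda>x2 y1. \<integral>y2. K x1 x2 y1 y2 \<partial>A2"]
        finite_measure.integrable_bounded_measurable[OF F21 this]
      show "(\<integral>x2. \<integral>y1. \<integral>y2. K x1 x2 y1 y2 \<partial>A2 \<partial>A1 \<partial>A2) = (\<integral>y1. \<integral>x2. \<integral>y2. K x1 x2 y1 y2 \<partial>A2 \<partial>A2 \<partial>A1)"
        by (simp add: split_beta')
    qed
    also have "\<dots> \<le> (\<integral>x1. \<integral>y1. F1 x1 * F2 y1 * ln (G (s1 x1 y1)) + F2 y1 * J f1 F1 x1 / 2 + F1 x1 * J f2 F2 y1 / 2 - k2 * (F1 x1 * F2 y1) \<partial>A1 \<partial>A1)"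
      (is "?L \<le> (\<integral>x1. \<integral>y1. ?R x1 y1 \<partial>A1 \<partial>A1)")
    proof (rule integral_mono)
      have LL: "bounded_measurable (A1 \<Otimes>\<^sub>M A1) (\<lambda>w. \<integral>x2. \<integral>y2. K (fst w) x2 (snd w) y2 \<partial>A2 \<partial>A2)"
        by (intro bounded_measurable_integral fin, simp add: split_beta', intro bounded_measurable_integral fin,
          simp add: split_beta', intro Kb, auto)
      have RR: "bounded_measurable (A1 \<Otimes>\<^sub>M A1) (\<lambda>w. ?R (fst w) (snd w))"
        unfolding divide_inverse
        by (intro bi bounded_measurable_compose[OF J1] bounded_measurable_compose[OF J2]
          bounded_measurable_compose[OF fb(3)] bounded_measurable_compose[OF fb(4)] pinched_compose[OF G]; measurable)
      show "integrable A1 (\<lambda>x1. \<integral>y1. \<integral>x2. \<integral>y2. K x1 x2 y1 y2 \<partial>A2 \<partial>A2 \<partial>A1)"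
        using LL by (intro A1.integrable_bounded_measurable bounded_measurable_integral fin) (simp add: split_beta')
      show "integrable A1 (\<lambda>x1. \<integral>y1. ?R x1 y1 \<partial>A1)"
        using RR by (intro A1.integrable_bounded_measurable bounded_measurable_integral fin) (simp add: split_beta')
      fix x1 assume x1: "x1 \<in> space A1"
      show "(\<integral>y1. \<integral>x2. \<integral>y2. K x1 x2 y1 y2 \<partial>A2 \<partial>A2 \<partial>A1) \<le> (\<integral>y1. ?R x1 y1 \<partial>A1)"
      proof (rule integral_mono)
        show "integrable A1 (\<lambda>y1. \<integral>x2. \<integral>y2. K x1 x2 y1 y2 \<partial>A2 \<partial>A2)"
          using bounded_measurable_compose[OF LL measurable_Pair1'[OF x1]]
          by (intro A1.integrable_bounded_measurable) simp
        show "integrable A1 (\<lambda>y1. ?R x1 y1)"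
          using bounded_measurable_compose[OF RR measurable_Pair1'[OF x1]]
          by (intro A1.integrable_bounded_measurable) simp
        fix y1 assume "y1 \<in> space A1"
        from inner[OF x1 this] show "(\<integral>x2. \<integral>y2. K x1 x2 y1 y2 \<partial>A2 \<partial>A2) \<le> ?R x1 y1" by (simp add: K_def)
      qed
    qed
    also have "(\<integral>x1. \<integral>y1. ?R x1 y1 \<partial>A1 \<partial>A1) =
       (\<integral>x1. (\<integral>y1. F1 x1 * F2 y1 * ln (G (s1 x1 y1)) \<partial>A1) + J f1 F1 x1 / 2
          + F1 x1 * (\<integral>y. J f2 F2 y \<partial>A1) / 2 - k2 * F1 x1 \<partial>A1)"
    proof (intro Bochner_Integration.integral_cong refl)
      fix x1 assume x1: "x1 \<in> space A1"
      have a: "integrable A1 (\<lambda>y1. F1 x1 * F2 y1 * ln (G (s1 x1 y1)))"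
        by (intro A1.integrable_bounded_measurable bi fb pinched_compose[OF G]) (use x1 in measurable)
      have b: "integrable A1 F2" "integrable A1 (J f2 F2)"
        using F2 J2 fb by (auto intro!: A1.integrable_bounded_measurable bi)
      show "(\<integral>y1. ?R x1 y1 \<partial>A1) = (\<integral>y1. F1 x1 * F2 y1 * ln (G (s1 x1 y1)) \<partial>A1) + J f1 F1 x1 / 2
          + F1 x1 * (\<integral>y. J f2 F2 y \<partial>A1) / 2 - k2 * F1 x1"
        using a b by (simp add: iF2)
    qed
    also have "\<dots> = (\<integral>x1. \<integral>y1. F1 x1 * F2 y1 * ln (G (s1 x1 y1)) \<partial>A1 \<partial>A1) + (\<integral>x. J f1 F1 x \<partial>A1) / 2
          + (\<integral>y. J f2 F2 y \<partial>A1) / 2 - k2"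
    proof -
      have a: "integrable A1 (\<lambda>x1. \<integral>y1. F1 x1 * F2 y1 * ln (G (s1 x1 y1)) \<partial>A1)"
        by (intro A1.integrable_bounded_measurable bounded_measurable_integral fin, simp add: split_beta',
          intro bi bounded_measurable_compose[OF fb(3)] bounded_measurable_compose[OF fb(4)] pinched_compose[OF G]) measurable
      have b: "integrable A1 F1" "integrable A1 (J f1 F1)"
        using F1 J1 fb by (auto intro!: A1.integrable_bounded_measurable bi)
      show ?thesis using a b by (simp add: iF1)
    qed
    also have "(\<integral>x1. \<integral>y1. F1 x1 * F2 y1 * ln (G (s1 x1 y1)) \<partial>A1 \<partial>A1)
      \<le> ln (\<integral>z. G z \<partial>B1) + (\<integral>x. F1 x * ln (F1 x) \<partial>A1) / 2 + (\<integral>x. F2 x * ln (F2 x) \<partial>A1) / 2 - k1"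
      by (rule gibbs_epiD[OF e1 F1 F2 G iF1 iF2])
    finally show ?thesis unfolding iJ1 iJ2 iG by (simp add: field_simps)
  qed
  show ?thesis unfolding gibbs_epi_def
    using sm ne' main AA.finite_measure_axioms BB.finite_measure_axioms by blast
qed

lemma pinched_distr_iff:
  assumes "h \<in> measurable A A'" "pinched (distr A A' h) f"
  shows "pinched A (\<lambda>x. f (h x))"
  using pinched_compose[OF assms(2), of h A] assms(1) by simp

text \<open>Densities and test functions on the targets are pulled back; this preserves pinching and
  turns every integral into one over the source, and \<open>hom\<close> matches the two operations.
  It carries the inequality from pairs to function spaces, and from there to vectors.\<close>

lemma gibbs_epi_distr:
  assumes e: "gibbs_epi A B s k"
    and h[measurable]: "h \<in> measurable A A'" and h'[measurable]: "h' \<in> measurable B B'"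
    and s'[measurable]: "(\<lambda>(x, y). s' x y) \<in> measurable (A' \<Otimes>\<^sub>M A') B'"
    and hom: "\<And>x y. x \<in> space A \<Longrightarrow> y \<in> space A \<Longrightarrow> s' (h x) (h y) = h' (s x y)"
  shows "gibbs_epi (distr A A' h) (distr B B' h') s' k"
proof -
  have fin: "finite_measure A" "finite_measure B"
    and ne: "emeasure A (space A) \<noteq> 0" "emeasure B (space B) \<noteq> 0"
    using e unfolding gibbs_epi_def by auto
  interpret A: finite_measure A by fact
  interpret B: finite_measure B by fact
  have fin': "finite_measure (distr A A' h)" "finite_measure (distr B B' h')"
    by (rule A.finite_measure_distr[OF h]) (rule B.finite_measure_distr[OF h'])
  have ne': "emeasure (distr A A' h) (space (distr A A' h)) \<noteq> 0" "emeasure (distr B B' h') (space (distr B B' h')) \<noteq> 0"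
    using ne by (simp_all add: emeasure_distr measurable_space[OF h] measurable_space[OF h']
        vimage_Int measurable_space Int_absorb1 subset_eq)
  have sm: "(\<lambda>(x, y). s' x y) \<in> measurable (distr A A' h \<Otimes>\<^sub>M distr A A' h) (distr B B' h')"
    using s' by (simp cong: measurable_cong_sets sets_pair_measure_cong)
  have main: "(\<integral>x. \<integral>y. f1 x * f2 y * ln (g (s' x y)) \<partial>distr A A' h \<partial>distr A A' h) \<le>
          ln (\<integral>z. g z \<partial>distr B B' h') + (\<integral>x. f1 x * ln (f1 x) \<partial>distr A A' h) / 2 + (\<integral>x. f2 x * ln (f2 x) \<partial>distr A A' h) / 2 - k"
    if f1: "pinched (distr A A' h) f1" and f2: "pinched (distr A A' h) f2" and g: "pinched (distr B B' h') g"
      and i1: "(\<integral>x. f1 x \<partial>distr A A' h) = 1" and i2: "(\<integral>x. f2 x \<partial>distr A A' h) = 1" for f1 f2 g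
  proof -
    note p = pinched_distr_iff[OF h f1] pinched_distr_iff[OF h f2] pinched_distr_iff[OF h' g]
    have [measurable]: "f1 \<in> borel_measurable A'" "f2 \<in> borel_measurable A'" "g \<in> borel_measurable B'"
      using f1 f2 g unfolding pinched_def by auto
    have [measurable]: "(\<lambda>x. g (s' (fst x) (snd x))) \<in> borel_measurable (A' \<Otimes>\<^sub>M A')"
      using measurable_compose[OF s' \<open>g \<in> _\<close>] by (simp add: split_beta')
    have sm2: "(\<lambda>(x, y). f1 x * f2 y * ln (g (s' x y))) \<in> borel_measurable (A' \<Otimes>\<^sub>M A')"
      unfolding split_beta' by measurable
    have "(\<lambda>(x, y). f1 x * f2 y * ln (g (s' x y))) \<in> borel_measurable (A' \<Otimes>\<^sub>M distr A A' h)"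
      using sm2 by (simp cong: measurable_cong_sets sets_pair_measure_cong)
    then have m1: "(\<lambda>x. \<integral>y. f1 x * f2 y * ln (g (s' x y)) \<partial>distr A A' h) \<in> borel_measurable A'"
      using fin'(1) by (intro sigma_finite_measure.borel_measurable_lebesgue_integral)
        (auto simp: finite_measure_def)
    have "(\<integral>x. \<integral>y. f1 x * f2 y * ln (g (s' x y)) \<partial>distr A A' h \<partial>distr A A' h)
      = (\<integral>x. \<integral>y. f1 (h x) * f2 y * ln (g (s' (h x) y)) \<partial>distr A A' h \<partial>A)"
      by (rule integral_distr[OF h m1])
    also have "\<dots> = (\<integral>x. \<integral>y. f1 (h x) * f2 (h y) * ln (g (s' (h x) (h y))) \<partial>A \<partial>A)"
    proof (intro Bochner_Integration.integral_cong refl integral_distr[OF h])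
      fix x assume "x \<in> space A"
      then have "h x \<in> space A'" by (rule measurable_space[OF h])
      from measurable_compose[OF measurable_Pair1'[OF this] sm2]
      show "(\<lambda>y. f1 (h x) * f2 y * ln (g (s' (h x) y))) \<in> borel_measurable A'" by simp
    qed
    also have "\<dots> = (\<integral>x. \<integral>y. f1 (h x) * f2 (h y) * ln (g (h' (s x y))) \<partial>A \<partial>A)"
      by (intro Bochner_Integration.integral_cong refl) (simp add: hom)
    also have "\<dots> \<le> ln (\<integral>z. g (h' z) \<partial>B) + (\<integral>x. f1 (h x) * ln (f1 (h x)) \<partial>A) / 2 + (\<integral>x. f2 (h x) * ln (f2 (h x)) \<partial>A) / 2 - k"
    proof -
      have "(\<integral>x. f1 (h x) \<partial>A) = 1" "(\<integral>x. f2 (h x) \<partial>A) = 1"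
        using i1 i2 by (simp_all add: integral_distr)
      with e p show ?thesis unfolding gibbs_epi_def by blast
    qed
    finally show ?thesis by (simp add: integral_distr)
  qed
  show ?thesis unfolding gibbs_epi_def using fin' ne' sm main by blast
qed

section \<open>Boxes in Euclidean space\<close>

text \<open>Induction on \<open>I\<close>: the map \<open>X(i := x)\<close> identifies the product
  over \<open>insert i I\<close> with a pair, and the constants of the factors add up. That
  identification of measures is \<open>ins\<close>, checked on boxes, whose preimages are
  rectangles.\<close>

lemma gibbs_epi_PiM:
  fixes A B :: "real measure"
  assumes e: "gibbs_epi A B (-) k" and sA[measurable_cong]: "sets A = sets borel" and sB[measurable_cong]: "sets B = sets borel"
    and "finite I"
  shows "gibbs_epi (PiM I (\<lambda>_. A)) (PiM I (\<lambda>_. B)) (\<lambda>x y. \<lambda>i\<in>I. x i - y i) (real (card I) * k)"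
proof -
  have fin: "finite_measure A" "finite_measure B" using e unfolding gibbs_epi_def by auto
  interpret A: product_sigma_finite "\<lambda>_::'a. A" using fin by (simp add: product_sigma_finite_def finite_measure_def)
  interpret B: product_sigma_finite "\<lambda>_::'a. B" using fin by (simp add: product_sigma_finite_def finite_measure_def)
  have ins: "distr (M \<Otimes>\<^sub>M PiM I (\<lambda>_. M)) (PiM (insert i I) (\<lambda>_. M)) (\<lambda>(x, X). X(i := x)) = PiM (insert i I) (\<lambda>_. M)"
    if "product_sigma_finite (\<lambda>_::'a. M)" "finite I" "i \<notin> I" for M :: "real measure" and I :: "'a set" and i
  proof -
    interpret product_sigma_finite "\<lambda>_::'a. M" by fact
    interpret I: finite_product_sigma_finite "\<lambda>_::'a. M" I by standard fact
    show ?thesis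
    proof (rule PiM_eqI)
      fix A assume A: "\<And>j. j \<in> insert i I \<Longrightarrow> A j \<in> sets M"
      have *: "(\<lambda>(x, X). X(i := x)) -` (Pi\<^sub>E (insert i I) A) \<inter> space (M \<Otimes>\<^sub>M PiM I (\<lambda>_. M)) = A i \<times> Pi\<^sub>E I A"
        using A[THEN sets.sets_into_space] \<open>i \<notin> I\<close>
        by (auto simp: space_pair_measure space_PiM PiE_iff extensional_def split: if_splits)
      show "emeasure (distr (M \<Otimes>\<^sub>M PiM I (\<lambda>_. M)) (PiM (insert i I) (\<lambda>_. M)) (\<lambda>(x, X). X(i := x))) (Pi\<^sub>E (insert i I) A)
         = (\<Prod>i\<in>insert i I. emeasure M (A i))"
        using A that by (subst emeasure_distr)
          (auto simp: * I.emeasure_pair_measure_Times I.measure_times intro!: sets_PiM_I_finite)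
    qed (use that in auto)
  qed
  from \<open>finite I\<close> show ?thesis
  proof (induction I)
    \<comment> \<open>Both products are a single point of mass one, so the densities have value one
      there and both sides reduce to the logarithm of the one value of \<open>g\<close>.\<close>
    case empty
    have 1: "PiM {} (\<lambda>_. M) = count_space {\<lambda>_::'a. undefined::real}" for M by (rule PiM_empty)
    have 2: "(\<lambda>(x, y). \<lambda>i\<in>{}. x i - y i) = (\<lambda>_::('a \<Rightarrow> real) \<times> ('a \<Rightarrow> real). \<lambda>_::'a. undefined :: real)"
      by (auto simp: fun_eq_iff)
    show ?case unfolding gibbs_epi_def 1 2
      by (auto simp: lebesgue_integral_count_space_finite intro!: finite_measureI)
  next
    case (insert i I)
    note pr = gibbs_epi_pair[OF e insert.IH]
    have "gibbs_epi (distr (A \<Otimes>\<^sub>M PiM I (\<lambda>_. A)) (PiM (insert i I) (\<lambda>_. A)) (\<lambda>(x, X). X(i := x)))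
        (distr (B \<Otimes>\<^sub>M PiM I (\<lambda>_. B)) (PiM (insert i I) (\<lambda>_. B)) (\<lambda>(x, X). X(i := x)))
       (\<lambda>x y. \<lambda>i\<in>insert i I. x i - y i) (k + real (card I) * k)"
    proof (rule gibbs_epi_distr[OF pr])
      have [measurable_cong]: "sets (PiM (insert i I) (\<lambda>_. B)) = sets (PiM (insert i I) (\<lambda>_. borel))"
        "sets (PiM (insert i I) (\<lambda>_. A)) = sets (PiM (insert i I) (\<lambda>_. borel))"
        by (auto intro!: sets_PiM_cong sA sB)
      show "(\<lambda>(x, y). \<lambda>i\<in>insert i I. x i - y i)
        \<in> PiM (insert i I) (\<lambda>_. A) \<Otimes>\<^sub>M PiM (insert i I) (\<lambda>_. A) \<rightarrow>\<^sub>M PiM (insert i I) (\<lambda>_. B)"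
        unfolding split_beta' by measurable
      fix x y assume "x \<in> space (A \<Otimes>\<^sub>M PiM I (\<lambda>_. A))" "y \<in> space (A \<Otimes>\<^sub>M PiM I (\<lambda>_. A))"
      show "(\<lambda>j\<in>insert i I. (case x of (x, X) \<Rightarrow> X(i := x)) j - (case y of (x, X) \<Rightarrow> X(i := x)) j) =
          (case (fst x - fst y, \<lambda>i\<in>I. snd x i - snd y i) of (x, X) \<Rightarrow> X(i := x))"
        using insert.hyps by (auto simp: fun_eq_iff split_beta')
    qed measurable
    moreover have "k + real (card I) * k = real (card (insert i I)) * k"
      using insert.hyps by (simp add: algebra_simps)
    ultimately show ?case
      by (simp only: ins[OF A.product_sigma_finite_axioms insert.hyps] ins[OF B.product_sigma_finite_axioms insert.hyps])
  qed
qed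

text \<open>Described by coordinates, so that its indicator is visibly a product of one-dimensional
  indicators; this is what makes Lebesgue measure on the cube a product measure.\<close>

definition centered_box :: "real \<Rightarrow> 'a::euclidean_space set" where
  "centered_box R = {x. \<forall>b\<in>Basis. \<bar>x \<bullet> b\<bar> \<le> R}"

lemma centered_box_eq_cbox: "centered_box R = cbox (- (R *\<^sub>R One)) (R *\<^sub>R One)"
proof -
  have "\<bar>t\<bar> \<le> R \<longleftrightarrow> - R \<le> t \<and> t \<le> R" for t :: real by auto
  then show ?thesis unfolding centered_box_def by (simp add: cbox_def)
qed

lemma centered_box_borel [measurable]: "centered_box R \<in> sets borel"
  unfolding centered_box_eq_cbox by simp

text \<open>A weighted \<open>lborel\<close> and not a restricted space: the space stays
  \<open>UNIV\<close> and the sigma-algebra stays \<open>borel\<close>, so differences and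
  translates of points need no domain conditions. As a consequence, pinching with respect to
  \<open>box_measure R\<close> asks for bounds on the whole space.\<close>

definition box_measure :: "real \<Rightarrow> 'a::euclidean_space measure" where
  "box_measure R = density lborel (\<lambda>x. indicator (centered_box R) x)"

lemma sets_box_measure [measurable_cong, simp]: "sets (box_measure R) = sets borel"
  by (simp add: box_measure_def)

lemma space_box_measure [simp]: "space (box_measure R) = UNIV"
  by (simp add: box_measure_def)

lemma integral_box_measure:
  fixes f :: "'a::euclidean_space \<Rightarrow> real"
  assumes [measurable]: "f \<in> borel_measurable borel"
  shows "(\<integral>x. f x \<partial>box_measure R) = (\<integral>x. indicator (centered_box R) x * f x \<partial>lborel)"
  unfolding box_measure_def ennreal_indicator[symmetric] by (subst integral_density) auto

lemma nn_integral_box_measure: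
  fixes f :: "'a::euclidean_space \<Rightarrow> ennreal"
  assumes [measurable]: "f \<in> borel_measurable borel"
  shows "(\<integral>\<^sup>+x. f x \<partial>box_measure R) = (\<integral>\<^sup>+x. f x * indicator (centered_box R) x \<partial>lborel)"
  unfolding box_measure_def by (subst nn_integral_density) (auto simp: mult.commute)

lemma centered_box_real: "centered_box R = {- R..R::real}"
  unfolding centered_box_def by auto

lemma emeasure_box_measure:
  "emeasure (box_measure R :: 'a::euclidean_space measure) UNIV = emeasure lborel (centered_box R :: 'a set)"
  by (simp add: box_measure_def emeasure_density)

lemma finite_measure_box_measure: "finite_measure (box_measure R)"
proof (rule finite_measureI)
  show "emeasure (box_measure R :: 'a measure) (space (box_measure R)) \<noteq> \<infinity>"
    unfolding space_box_measure emeasure_box_measure unfolding centered_box_eq_cbox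
    by (simp add: emeasure_lborel_cbox_eq)
qed

lemma emeasure_box_measure_pos:
  assumes "0 < R"
  shows "emeasure (box_measure R :: 'a::euclidean_space measure) UNIV \<noteq> 0"
proof -
  have "(0::real) < (\<Prod>b\<in>(Basis::'a set). (R *\<^sub>R One - - (R *\<^sub>R One)) \<bullet> b)"
    using assms by (intro prod_pos) (auto simp: inner_diff_left inner_add_left)
  then show ?thesis using assms
    unfolding emeasure_box_measure centered_box_eq_cbox by (simp add: emeasure_lborel_cbox_eq inner_add_left)
qed

text \<open>The indicator of the cube is the product of the indicators of the coordinate intervals,
  so weighting by it respects the product structure of \<open>lborel\<close>. Both measures are
  compared on product sets.\<close>

lemma box_measure_eq_distr:
  "(box_measure R :: 'a::euclidean_space measure) =
     distr (PiM Basis (\<lambda>_. box_measure R)) borel (\<lambda>f. \<Sum>b\<in>Basis. f b *\<^sub>R b)"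
proof -
  let ?D = "box_measure R :: real measure"
  interpret L: product_sigma_finite "\<lambda>_::'a. lborel :: real measure"
    by (simp add: product_sigma_finite_def sigma_finite_lborel)
  interpret D: product_sigma_finite "\<lambda>_::'a. ?D"
    using finite_measure_box_measure[of R, where 'a=real] by (simp add: product_sigma_finite_def finite_measure_def)
  let ?P = "PiM (Basis::'a set) (\<lambda>_. lborel :: real measure)"
  let ?w = "\<lambda>x. \<Prod>b\<in>(Basis::'a set). indicator (centered_box R) (x b) :: ennreal"
  have sets_eq: "sets (PiM (Basis::'a set) (\<lambda>_. ?D)) = sets ?P"
    by (rule sets_PiM_cong) auto
  have "density ?P ?w = PiM Basis (\<lambda>_. ?D)"
  proof (rule D.PiM_eqI)
    show "finite (Basis::'a set)" by simp
    show "sets (density ?P ?w) = sets (PiM Basis (\<lambda>_. ?D))" using sets_eq by simp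
    fix A :: "'a \<Rightarrow> real set" assume "\<And>i. i \<in> Basis \<Longrightarrow> A i \<in> sets ?D"
    then have A[measurable]: "\<And>i. i \<in> Basis \<Longrightarrow> A i \<in> sets borel" by simp
    have "emeasure (density ?P ?w) (Pi\<^sub>E Basis A) = (\<integral>\<^sup>+x. ?w x * indicator (Pi\<^sub>E Basis A) x \<partial>?P)"
      using A by (intro emeasure_density sets_PiM_I_finite) auto
    also have "\<dots> = (\<integral>\<^sup>+x. (\<Prod>b\<in>Basis. indicator (centered_box R) (x b) * indicator (A b) (x b)) \<partial>?P)"
    proof (rule nn_integral_cong)
      fix x assume "x \<in> space ?P"
      then have "indicator (Pi\<^sub>E Basis A) x = (\<Prod>b\<in>Basis. indicator (A b) (x b) :: ennreal)"
        by (auto simp: space_PiM PiE_iff indicator_def prod_zero_iff)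
      then show "?w x * indicator (Pi\<^sub>E Basis A) x = (\<Prod>b\<in>Basis. indicator (centered_box R) (x b) * indicator (A b) (x b))"
        by (simp add: prod.distrib)
    qed
    also have "\<dots> = (\<Prod>b\<in>Basis. \<integral>\<^sup>+x. indicator (centered_box R) x * indicator (A b) x \<partial>lborel)"
      using A by (intro L.product_nn_integral_prod) auto
    also have "\<dots> = (\<Prod>b\<in>Basis. emeasure ?D (A b))"
      using A by (intro prod.cong refl) (simp add: box_measure_def emeasure_density)
    finally show "emeasure (density ?P ?w) (Pi\<^sub>E Basis A) = (\<Prod>b\<in>Basis. emeasure ?D (A b))" .
  qed
  then have "distr (PiM Basis (\<lambda>_. ?D)) borel (\<lambda>f. \<Sum>b\<in>Basis. f b *\<^sub>R b)
      = distr (density ?P ?w) borel (\<lambda>f. \<Sum>b\<in>Basis. f b *\<^sub>R b)" by simp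
  also have "?w = (\<lambda>f. indicator (centered_box R) (\<Sum>b\<in>Basis. f b *\<^sub>R b))"
    by (auto simp: fun_eq_iff centered_box_def indicator_def inner_sum_left_Basis prod_zero_iff)
  also have "distr (density ?P (\<lambda>f. indicator (centered_box R) (\<Sum>b\<in>Basis. f b *\<^sub>R b))) borel (\<lambda>f. \<Sum>b\<in>Basis. f b *\<^sub>R b)
     = density (distr ?P borel (\<lambda>f. \<Sum>b\<in>Basis. f b *\<^sub>R b)) (indicator (centered_box R))"
    by (subst density_distr) auto
  also have "\<dots> = box_measure R" unfolding box_measure_def by (subst (2) lborel_eq) simp
  finally show ?thesis by simp
qed

text \<open>Subtraction of vectors acts coordinatewise, so the inequality in dimension one
  tensorizes and the constant is multiplied by the dimension.\<close>

lemma gibbs_epi_box_measure: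
  assumes "gibbs_epi (box_measure R :: real measure) (box_measure S) (-) k"
  shows "gibbs_epi (box_measure R :: 'a::euclidean_space measure) (box_measure S) (-) (real DIM('a) * k)"
proof -
  let ?h = "\<lambda>f. \<Sum>b\<in>(Basis::'a set). f b *\<^sub>R b"
  have "gibbs_epi (distr (PiM Basis (\<lambda>_. box_measure R)) borel ?h) (distr (PiM Basis (\<lambda>_. box_measure S)) borel ?h) (-) (real DIM('a) * k)"
  proof (rule gibbs_epi_distr[OF gibbs_epi_PiM[OF assms]])
    show "(\<Sum>b\<in>(Basis::'a set). x b *\<^sub>R b) - (\<Sum>b\<in>Basis. y b *\<^sub>R b) = (\<Sum>b\<in>Basis. (\<lambda>i\<in>Basis. x i - y i) b *\<^sub>R b)"
      for x y :: "'a \<Rightarrow> real"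
      by (simp add: sum_subtractf[symmetric] algebra_simps)
  qed (auto simp: split_beta' intro!: borel_measurable_sum borel_measurable_scaleR)
  then show ?thesis by (simp add: box_measure_eq_distr[symmetric])
qed

section \<open>Transport from the Gaussian in dimension one\<close>

text \<open>Substitution on the compact intervals from \<open>- k\<close> to \<open>k\<close>,
  followed by monotone convergence on both sides.\<close>

lemma nn_integral_substitution_UNIV:
  fixes T T' h :: "real \<Rightarrow> real"
  assumes [measurable]: "h \<in> borel_measurable borel" and h: "\<And>x. 0 \<le> h x"
    and T: "\<And>x. (T has_real_derivative T' x) (at x)" and T': "\<And>x. 0 \<le> T' x" "continuous_on UNIV T'"
    and b: "(T \<longlongrightarrow> b) at_top" and a: "(T \<longlongrightarrow> a) at_bot"
  shows "(\<integral>\<^sup>+x. h (T x) * T' x \<partial>lborel) = (\<integral>\<^sup>+x. h x * indicator {a..b} x \<partial>lborel)"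
proof -
  have cT: "continuous_on UNIV T"
    using T by (meson DERIV_isCont continuous_at_imp_continuous_on)
  have [measurable]: "T \<in> borel_measurable borel" "T' \<in> borel_measurable borel"
    using cT T'(2) by (auto intro: borel_measurable_continuous_onI)
  have mono: "mono T"
    using T T'(1) by (intro monoI) (meson DERIV_nonneg_imp_nondecreasing)
  have bk: "(\<lambda>k. T (real k)) \<longlonglongrightarrow> b"
    by (rule filterlim_compose[OF b filterlim_real_sequentially])
  have ak: "(\<lambda>k. T (- real k)) \<longlonglongrightarrow> a"
    by (rule filterlim_compose[OF a]) (simp add: filterlim_uminus_at_bot filterlim_real_sequentially)
  \<comment> \<open>\<open>U\<close> is the range of the nondecreasing map \<open>T\<close>. It
    contains the open and lies in the closed interval from \<open>a\<close> to \<open>b\<close>;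
    whether an endpoint is attained does not matter, as single points are null.\<close>
  define U where "U = (\<Union>k. {T (- real k)..T (real k)})"
  have [measurable]: "U \<in> sets borel" unfolding U_def by measurable
  have inc: "incseq (\<lambda>k. {T (- real k)..T (real k)})"
    using mono by (auto simp: incseq_def mono_def intro: order_trans)
  have inc': "incseq (\<lambda>k. {- real k..real k})"
    by (auto simp: incseq_def)
  have ind: "incseq (\<lambda>k x. f x * indicator (A k) x)" if "incseq A" for f :: "real \<Rightarrow> ennreal" and A
    using that by (auto simp: incseq_def le_fun_def indicator_def subset_eq intro!: mult_left_mono)
  have 1: "(\<lambda>k. \<integral>\<^sup>+x. ennreal (h x) * indicator {T (- real k)..T (real k)} x \<partial>lborel) \<longlonglongrightarrow> (\<integral>\<^sup>+x. ennreal (h x) * indicator U x \<partial>lborel)"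
  proof (rule nn_integral_LIMSEQ)
    show "(\<lambda>k. ennreal (h x) * indicator {T (- real k)..T (real k)} x) \<longlonglongrightarrow> ennreal (h x) * indicator U x" for x
    proof -
      have "(\<lambda>k. indicator {T (- real k)..T (real k)} x) \<longlonglongrightarrow> (indicator U x :: ennreal)"
        unfolding U_def by (rule LIMSEQ_indicator_incseq[OF inc])
      then show ?thesis
        by (rule ennreal_tendsto_cmult[rotated]) simp
    qed
  qed (auto intro!: ind inc)
  have 2: "(\<lambda>k. \<integral>\<^sup>+x. ennreal (h (T x) * T' x) * indicator {- real k..real k} x \<partial>lborel) \<longlonglongrightarrow> (\<integral>\<^sup>+x. ennreal (h (T x) * T' x) \<partial>lborel)"
  proof (rule nn_integral_LIMSEQ)
    show "(\<lambda>k. ennreal (h (T x) * T' x) * indicator {- real k..real k} x) \<longlonglongrightarrow> ennreal (h (T x) * T' x)" for x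
    proof (rule tendsto_eventually)
      obtain n where n: "\<bar>x\<bar> \<le> real n" using real_arch_simple by blast
      then show "\<forall>\<^sub>F k in sequentially. ennreal (h (T x) * T' x) * indicator {- real k..real k} x = ennreal (h (T x) * T' x)"
        by (intro eventually_mono[OF eventually_ge_at_top[of n]]) (auto simp: indicator_def abs_le_iff)
    qed
  qed (auto intro!: ind inc')
  have "(\<integral>\<^sup>+x. ennreal (h x) * indicator {T (- real k)..T (real k)} x \<partial>lborel)
     = (\<integral>\<^sup>+x. ennreal (h (T x) * T' x) * indicator {- real k..real k} x \<partial>lborel)" for k
    using nn_integral_substitution[of "T" "- real k" "real k" h T'] T T'
    by (auto simp: set_borel_measurable_def ennreal_indicator[symmetric] ennreal_mult'[symmetric] h intro: continuous_on_subset)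
  with 1 2 have "(\<integral>\<^sup>+x. ennreal (h (T x) * T' x) \<partial>lborel) = (\<integral>\<^sup>+x. ennreal (h x) * indicator U x \<partial>lborel)"
    by (simp add: LIMSEQ_unique)
  also have "\<dots> = (\<integral>\<^sup>+x. ennreal (h x) * indicator {a..b} x \<partial>lborel)"
  proof (rule nn_integral_cong_AE)
    have "AE x in lborel. x \<noteq> a \<and> x \<noteq> b" by (simp add: AE_lborel_singleton)
    then show "AE x in lborel. ennreal (h x) * indicator U x = ennreal (h x) * indicator {a..b} x"
    proof eventually_elim
      case (elim x)
      have "x \<in> U \<longleftrightarrow> x \<in> {a..b}"
      proof
        assume "x \<in> U"
        then obtain k where "T (- real k) \<le> x" "x \<le> T (real k)" by (auto simp: U_def)
        moreover have "a \<le> T (- real k)"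
          using a by (rule tendsto_upperbound)
            (auto intro!: eventually_mono[OF eventually_le_at_bot[of "- real k"]] monoD[OF mono])
        moreover have "T (real k) \<le> b"
          using b by (rule tendsto_lowerbound)
            (auto intro!: eventually_mono[OF eventually_ge_at_top[of "real k"]] monoD[OF mono])
        ultimately show "x \<in> {a..b}" by auto
      next
        assume "x \<in> {a..b}"
        with elim have "a < x" "x < b" by auto
        with ak bk have "\<forall>\<^sub>F k in sequentially. T (- real k) < x \<and> x < T (real k)"
          by (auto simp: order_tendsto_iff intro: eventually_conj)
        then obtain k where "T (- real k) < x \<and> x < T (real k)"
          by (auto dest: eventually_happens)
        then show "x \<in> U" unfolding U_def by (auto intro!: exI[of _ k])
      qed
      then show ?case by (simp add: indicator_def)
    qed
  qed
  finally show ?thesis by (simp add: ennreal_indicator[symmetric] ennreal_mult' h)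
qed

text \<open>The Gaussian distribution function itself is the witness: since points have no mass, it
  differs by a constant from an antiderivative of the density, and is therefore differentiable,
  while its limits are those of any distribution function.\<close>

lemma std_normal_cdf_exists:
  "\<exists>P::real \<Rightarrow> real. (\<forall>x. (P has_real_derivative std_normal_density x) (at x)) \<and> (P \<longlongrightarrow> 1) at_top \<and> (P \<longlongrightarrow> 0) at_bot"
proof -
  let ?N = "density lborel std_normal_density"
  interpret N: prob_space ?N by (rule prob_space_normal_density) simp
  interpret N: real_distribution ?N by standard simp
  have cont: "continuous_on UNIV std_normal_density"
    unfolding std_normal_density_def by (intro continuous_intros) auto
  obtain P where P: "\<And>x. (P has_vector_derivative std_normal_density x) (at x)"
    using einterval_antiderivative[of "-\<infinity>" "\<infinity>" std_normal_density] cont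
    by (auto simp: continuous_on_eq_continuous_at)
  have eq: "cdf ?N y - cdf ?N x = P y - P x" if "x < y" for x y
  proof -
    have "cdf ?N y - cdf ?N x = measure ?N {x<..y}" using N.cdf_diff_eq[OF that] .
    also have "\<dots> = measure ?N {x..y}"
    proof -
      have "measure ?N {x} = 0"
        by (auto simp: measure_def emeasure_density nn_integral_indicator_singleton)
      moreover have "{x..y} = {x} \<union> {x<..y}" using that by auto
      ultimately show ?thesis
        using N.finite_measure_Union[of "{x}" "{x<..y}"] by auto
    qed
    also have "\<dots> = (\<integral>z. std_normal_density z * indicator {x..y} z \<partial>lborel)"
      by (simp add: measure_def emeasure_density integral_eq_nn_integral ennreal_mult' ennreal_indicator)
    also have "\<dots> = P y - P x"
      using that P cont integral_FTC_Icc[of x y P std_normal_density]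
      by (auto simp: has_vector_derivative_at_within mult.commute intro: continuous_on_subset)
    finally show ?thesis .
  qed
  define c where "c = cdf ?N 0 - P 0"
  have "cdf ?N x = P x + c" for x
    using eq[of 0 x] eq[of x 0] unfolding c_def by (cases x "0::real" rule: linorder_cases) auto
  then have "cdf ?N = (\<lambda>x. P x + c)" by auto
  then have "(cdf ?N has_real_derivative std_normal_density x) (at x)" for x
    using P[of x] by (auto simp: has_real_derivative_iff_has_vector_derivative intro!: derivative_eq_intros)
  then show ?thesis using N.cdf_lim_at_top_prob N.cdf_lim_at_bot by blast
qed

text \<open>
  The monotone rearrangement \<open>T\<close>, which solves \<open>F (T x) = \<Phi> x\<close> for the distribution function
  \<open>F\<close> of \<open>f\<close> and the Gaussian distribution function \<open>\<Phi>\<close>.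
\<close>

lemma gaussian_transport:
  fixes f :: "real \<Rightarrow> real"
  assumes cf: "continuous_on UNIV f" and c: "0 < c" "\<And>x. c \<le> f x" and R: "0 < R"
    and i1: "(\<integral>x. f x \<partial>box_measure R) = 1"
  obtains T T' where "\<And>x. (T has_real_derivative T' x) (at x)" "continuous_on UNIV T'"
    "\<And>x. T' x * f (T x) = std_normal_density x"
    "(T \<longlongrightarrow> R) at_top" "(T \<longlongrightarrow> - R) at_bot"
proof -
  obtain P where P: "\<And>x. (P has_real_derivative std_normal_density x) (at x)" "(P \<longlongrightarrow> 1) at_top" "(P \<longlongrightarrow> 0) at_bot"
    using std_normal_cdf_exists by blast
  obtain F0 where F0: "\<And>x. (F0 has_vector_derivative f x) (at x)"
    using einterval_antiderivative[of "-\<infinity>" "\<infinity>" f] cf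
    by (auto simp: continuous_on_eq_continuous_at)
  \<comment> \<open>\<open>F\<close> is taken on the whole line and not stopped at
    \<open>- R\<close> and \<open>R\<close>, where it has the values \<open>0\<close> and
    \<open>1\<close>. As \<open>f\<close> is at least \<open>c\<close> everywhere, \<open>F\<close>
    is then an increasing bijection of the reals with an everywhere differentiable inverse, and the
    limits of \<open>T\<close> follow from continuity of that inverse at \<open>0\<close> and
    \<open>1\<close>.\<close>
  define F where "F x = F0 x - F0 (- R)" for x
  have F: "(F has_real_derivative f x) (at x)" for x
    using F0[of x] unfolding F_def[abs_def] has_real_derivative_iff_has_vector_derivative[symmetric]
    by (auto intro!: derivative_eq_intros)
  have FR: "F (- R) = 0" by (simp add: F_def)
  have F1: "F R = 1"
  proof -
    have "1 = (\<integral>x. f x * indicator {-R..R} x \<partial>lborel)"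
      using i1 cf by (simp add: integral_box_measure borel_measurable_continuous_onI centered_box_real mult.commute)
    also have "\<dots> = F0 R - F0 (- R)"
      using R F0 cf integral_FTC_Icc[of "-R" R F0 f]
      by (auto simp: has_vector_derivative_at_within mult.commute intro: continuous_on_subset)
    finally show ?thesis by (simp add: F_def)
  qed
  have grow: "c * (y - x) \<le> F y - F x" if "x \<le> y" for x y
  proof (cases "x = y")
    case False
    with that have "x < y" by simp
    from MVT2[OF this, of F f] F obtain z where "F y - F x = (y - x) * f z" by blast
    then show ?thesis using c(2)[of z] that by (simp add: mult.commute mult_right_mono)
  qed simp
  have sm: "strict_mono F"
  proof (rule strict_monoI)
    fix x y :: real assume "x < y"
    then show "F x < F y" using grow[of x y] c(1) by (smt (verit) mult_pos_pos)
  qed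
  have contF: "continuous_on UNIV F" using F by (meson DERIV_isCont continuous_at_imp_continuous_on)
  \<comment> \<open>\<open>F\<close> grows at least with slope \<open>c\<close>, so it has reached
    the level \<open>y\<close> at distance \<open>\<bar>y - F 0\<bar> / c\<close> from the origin on
    the appropriate side.\<close>
  have surjF: "\<exists>x. F x = y" for y
  proof -
    obtain l u where "l \<le> u" "F l \<le> y" "y \<le> F u"
    proof
      show "- (\<bar>y - F 0\<bar> / c) \<le> \<bar>y - F 0\<bar> / c" using c(1) by simp
      show "F (- (\<bar>y - F 0\<bar> / c)) \<le> y" using grow[of "- (\<bar>y - F 0\<bar> / c)" 0] c(1) by simp
      show "y \<le> F (\<bar>y - F 0\<bar> / c)" using grow[of 0 "\<bar>y - F 0\<bar> / c"] c(1) by simp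
    qed
    then show ?thesis using IVT'[of F l y u] contF continuous_on_subset by blast
  qed
  define G where "G = inv F"
  have FG: "F (G y) = y" for y unfolding G_def using surjF by (metis surj_def surj_f_inv_f)
  have GF: "G (F x) = x" for x unfolding G_def using sm by (simp add: strict_mono_imp_inj_on)
  have contG: "isCont G y" for y
  proof -
    have "isCont G (F (G y))"
      by (rule isCont_inverse_function[of 1 "G y" G F]) (auto simp: GF intro: DERIV_isCont[OF F])
    then show ?thesis by (simp add: FG)
  qed
  have G: "(G has_real_derivative inverse (f (G y))) (at y)" for y
  proof (rule DERIV_inverse_function[where f=F and g=G and x=y and D="f (G y)" and a="y - 1" and b="y + 1"])
    show "f (G y) \<noteq> 0" using c(1) c(2)[of "G y"] by auto
  qed (auto simp: F FG contG)
  define T where "T x = G (P x)" for x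
  define T' where "T' x = inverse (f (T x)) * std_normal_density x" for x
  have T: "(T has_real_derivative T' x) (at x)" for x
    unfolding T_def[abs_def] T'_def using DERIV_chain2[OF G P(1)] by (simp add: T_def)
  have fne: "f x \<noteq> 0" for x using c(1) c(2)[of x] by auto
  show thesis
  proof
    show "(T has_real_derivative T' x) (at x)" for x by (rule T)
    have "continuous_on UNIV T" using T by (meson DERIV_isCont continuous_at_imp_continuous_on)
    then have "continuous_on UNIV (\<lambda>x. f (T x))" by (rule continuous_on_compose2[OF cf]) auto
    then show "continuous_on UNIV T'"
      unfolding T'_def std_normal_density_def using fne by (intro continuous_intros) auto
    show "T' x * f (T x) = std_normal_density x" for x using fne by (simp add: T'_def)
    show "(T \<longlongrightarrow> R) at_top" unfolding T_def
      using isCont_tendsto_compose[OF contG P(2)] GF[of R] F1 by simp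
    show "(T \<longlongrightarrow> - R) at_bot" unfolding T_def
      using isCont_tendsto_compose[OF contG P(3)] GF[of "- R"] FR by simp
  qed
qed

abbreviation std_gaussian :: "real measure" where
  "std_gaussian \<equiv> density lborel (\<lambda>x. ennreal (std_normal_density x))"

text \<open>The equation \<open>fT\<close> is the change of variables formula for the density of the
  image measure, and the limits of \<open>T\<close> confine the image to the interval from
  \<open>- R\<close> to \<open>R\<close>.\<close>

lemma gaussian_transport_distr:
  fixes f :: "real \<Rightarrow> real"
  assumes [measurable]: "f \<in> borel_measurable borel" and f: "\<And>x. 0 \<le> f x"
    and T: "\<And>x. (T has_real_derivative T' x) (at x)" and T': "continuous_on UNIV T'" "\<And>x. 0 \<le> T' x"
    and fT: "\<And>x. T' x * f (T x) = std_normal_density x"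
    and lim: "(T \<longlongrightarrow> R) at_top" "(T \<longlongrightarrow> - R) at_bot"
  shows "distr std_gaussian borel T = density (box_measure R) (\<lambda>x. ennreal (f x))"
proof (rule measure_eqI)
  have "continuous_on UNIV T" using T by (meson DERIV_isCont continuous_at_imp_continuous_on)
  then have [measurable]: "T \<in> borel_measurable borel" "T' \<in> borel_measurable borel"
    using T'(1) by (auto intro: borel_measurable_continuous_onI)
  fix A assume "A \<in> sets (distr std_gaussian borel T)"
  then have [measurable]: "A \<in> sets borel" by simp
  have "emeasure (distr std_gaussian borel T) A = (\<integral>\<^sup>+x. indicator A (T x) \<partial>std_gaussian)"
    by (subst nn_integral_distr[symmetric, where T=T and M'=borel]) auto
  also have "\<dots> = (\<integral>\<^sup>+x. ennreal ((indicator A (T x) * f (T x)) * T' x) \<partial>lborel)"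
    by (subst nn_integral_density)
      (auto simp: fT[symmetric] ennreal_mult'[symmetric] ennreal_indicator[symmetric] f T'(2) ac_simps simp del: ennreal_indicator)
  also have "\<dots> = (\<integral>\<^sup>+x. ennreal ((indicator A x * f x) * indicator {-R..R} x) \<partial>lborel)"
    using f T T' lim by (subst nn_integral_substitution_UNIV[of "\<lambda>x. indicator A x * f x" T T' R "-R"])
      (auto simp: ennreal_mult' ennreal_indicator)
  also have "\<dots> = emeasure (density (box_measure R) (\<lambda>x. ennreal (f x))) A"
    by (subst emeasure_density) (auto simp: nn_integral_box_measure centered_box_real ennreal_mult' ennreal_indicator f ac_simps)
  finally show "emeasure (distr std_gaussian borel T) A = emeasure (density (box_measure R) (\<lambda>x. ennreal (f x))) A" .
qed simp

lemma ln_std_normal_density: "ln (std_normal_density x) = - ln (sqrt (2 * pi)) - x\<^sup>2 / 2"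
  unfolding std_normal_density_def by (subst ln_mult) (auto simp: ln_div ln_inverse)

text \<open>Continuity of the densities makes the transport maps continuously differentiable, as the
  substitution along a rotated coordinate requires; the positive lower bound on the whole line makes
  these maps available.\<close>

lemma gibbs_epi_interval_continuous:
  fixes f1 f2 g :: "real \<Rightarrow> real"
  assumes R: "0 < R" and c: "0 < c" "\<And>x. c \<le> f1 x" "\<And>x. f1 x \<le> C" "\<And>x. c \<le> f2 x" "\<And>x. f2 x \<le> C"
    and cont: "continuous_on UNIV f1" "continuous_on UNIV f2"
    and i: "(\<integral>x. f1 x \<partial>box_measure R) = 1" "(\<integral>x. f2 x \<partial>box_measure R) = 1"
    and g: "pinched (box_measure (2 * R)) g"
  shows "(\<integral>x. \<integral>y. f1 x * f2 y * ln (g (x - y)) \<partial>box_measure R \<partial>box_measure R) \<le>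
    ln (\<integral>z. g z \<partial>box_measure (2 * R)) + (\<integral>x. f1 x * ln (f1 x) \<partial>box_measure R) / 2
      + (\<integral>x. f2 x * ln (f2 x) \<partial>box_measure R) / 2 - ln 2 / 2"
proof -
  obtain T1 T1' where T1: "\<And>x. (T1 has_real_derivative T1' x) (at x)" "continuous_on UNIV T1'"
    "\<And>x. T1' x * f1 (T1 x) = std_normal_density x" "(T1 \<longlongrightarrow> R) at_top" "(T1 \<longlongrightarrow> - R) at_bot"
    using gaussian_transport[OF cont(1) c(1,2) R i(1)] by metis
  obtain T2 T2' where T2: "\<And>x. (T2 has_real_derivative T2' x) (at x)" "continuous_on UNIV T2'"
    "\<And>x. T2' x * f2 (T2 x) = std_normal_density x" "(T2 \<longlongrightarrow> R) at_top" "(T2 \<longlongrightarrow> - R) at_bot"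
    using gaussian_transport[OF cont(2) c(1,4) R i(2)] by metis
  have fpos: "0 < f1 x" "0 < f2 x" for x using c(1) c(2)[of x] c(4)[of x] by auto
  have T1'pos: "0 < T1' x" for x
    using T1(3)[of x] fpos(1)[of "T1 x"] normal_density_pos[of 1 0 x] by (smt (verit) mult_nonpos_nonneg)
  have T2'pos: "0 < T2' x" for x
    using T2(3)[of x] fpos(2)[of "T2 x"] normal_density_pos[of 1 0 x] by (smt (verit) mult_nonpos_nonneg)
  have contT: "continuous_on UNIV T1" "continuous_on UNIV T2"
    using T1(1) T2(1) by (meson DERIV_isCont continuous_at_imp_continuous_on)+
  have [measurable]: "T1 \<in> borel_measurable borel" "T2 \<in> borel_measurable borel" "T1' \<in> borel_measurable borel" "T2' \<in> borel_measurable borel"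
    "f1 \<in> borel_measurable borel" "f2 \<in> borel_measurable borel"
    using contT T1(2) T2(2) cont by (auto intro: borel_measurable_continuous_onI)
  have [measurable]: "g \<in> borel_measurable borel" using g by (auto simp: pinched_def cong: measurable_cong_sets)
  have gpos: "0 < g x" for x using pinched_pos[OF g] by simp
  let ?N = std_gaussian
  interpret N: prob_space ?N by (rule prob_space_normal_density) simp
  have N1: "measure ?N UNIV = 1" using N.prob_space by simp
  interpret NN: pair_prob_space ?N ?N ..
  have finNN: "finite_measure (?N \<Otimes>\<^sub>M ?N)" by unfold_locales
  have tr1: "(\<integral>x. f1 x * u x \<partial>box_measure R) = (\<integral>x. u (T1 x) \<partial>?N)"
    if [measurable]: "u \<in> borel_measurable borel" for u
  proof -
    have "(\<integral>x. u (T1 x) \<partial>?N) = (\<integral>x. u x \<partial>distr ?N borel T1)" by (subst integral_distr) auto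
    also have "distr ?N borel T1 = density (box_measure R) (\<lambda>x. ennreal (f1 x))"
      using T1 T1'pos fpos by (intro gaussian_transport_distr[of f1 T1 T1' R]) (auto intro: less_imp_le)
    also have "(\<integral>x. u x \<partial>\<dots>) = (\<integral>x. f1 x * u x \<partial>box_measure R)"
      using fpos by (subst integral_density) (auto intro!: AE_I2 less_imp_le)
    finally show ?thesis by simp
  qed
  have tr2: "(\<integral>x. f2 x * u x \<partial>box_measure R) = (\<integral>x. u (T2 x) \<partial>?N)"
    if [measurable]: "u \<in> borel_measurable borel" for u
  proof -
    have "(\<integral>x. u (T2 x) \<partial>?N) = (\<integral>x. u x \<partial>distr ?N borel T2)" by (subst integral_distr) auto
    also have "distr ?N borel T2 = density (box_measure R) (\<lambda>x. ennreal (f2 x))"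
      using T2 T2'pos fpos by (intro gaussian_transport_distr[of f2 T2 T2' R]) (auto intro: less_imp_le)
    also have "(\<integral>x. u x \<partial>\<dots>) = (\<integral>x. f2 x * u x \<partial>box_measure R)"
      using fpos by (subst integral_density) (auto intro!: AE_I2 less_imp_le)
    finally show ?thesis by simp
  qed
  interpret BR: finite_measure "box_measure R :: real measure" by (rule finite_measure_box_measure)
  define E1 where "E1 = (\<integral>x. f1 x * ln (f1 x) \<partial>box_measure R)"
  define E2 where "E2 = (\<integral>x. f2 x * ln (f2 x) \<partial>box_measure R)"
  define A where "A = (\<integral>z. g z \<partial>box_measure (2 * R))"
  define L where "L x y = ln (g (T1 x - T2 y))" for x y
  define LL where "LL = (\<integral>x. \<integral>y. L x y \<partial>?N \<partial>?N)"
  have lhs: "(\<integral>x. \<integral>y. f1 x * f2 y * ln (g (x - y)) \<partial>box_measure R \<partial>box_measure R) = LL"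
  proof -
    have "(\<integral>x. \<integral>y. f1 x * f2 y * ln (g (x - y)) \<partial>box_measure R \<partial>box_measure R)
       = (\<integral>x. f1 x * (\<integral>y. f2 y * ln (g (x - y)) \<partial>box_measure R) \<partial>box_measure R)"
      by (simp add: mult.assoc)
    also have "\<dots> = (\<integral>x. f1 x * (\<integral>y. ln (g (x - T2 y)) \<partial>?N) \<partial>box_measure R)"
      by (subst tr2) auto
    also have "\<dots> = (\<integral>x. \<integral>y. ln (g (T1 x - T2 y)) \<partial>?N \<partial>?N)"
      by (subst tr1) auto
    finally show ?thesis by (simp add: LL_def L_def)
  qed
  have e1: "E1 = (\<integral>x. ln (f1 (T1 x)) \<partial>?N)" unfolding E1_def by (rule tr1) measurable
  have e2: "E2 = (\<integral>x. ln (f2 (T2 x)) \<partial>?N)" unfolding E2_def by (rule tr2) measurable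
  have p1: "pinched borel f1" "pinched borel f2"
    unfolding pinched_def using c by (simp, blast)+
  have pg: "pinched borel g" using g unfolding pinched_def by (auto cong: measurable_cong_sets)
  have b1: "bounded_measurable ?N (\<lambda>x. ln (f1 (T1 x)))"
    and b2: "bounded_measurable ?N (\<lambda>x. ln (f2 (T2 x)))"
    by (intro pinched_ln_bounded pinched_compose[OF p1(1)] pinched_compose[OF p1(2)]; measurable)+
  have bL: "bounded_measurable (?N \<Otimes>\<^sub>M ?N) (\<lambda>(x, y). L x y)"
    unfolding L_def split_beta' by (intro pinched_ln_bounded pinched_compose[OF pg]) measurable
  \<comment> \<open>With \<open>v = (x + y) / sqrt 2\<close>, AM-GM for \<open>T1' x\<close> and \<open>T2' y\<close> bounds the Gaussian weight times
    \<open>exp (V x y)\<close> by \<open>\<phi> v\<close> times the derivative along fixed \<open>v\<close> of an antiderivative of \<open>g\<close> at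
    \<open>T1 x - T2 y\<close>; hence the mean of \<open>exp V\<close> is at most \<open>A\<close>, and Jensen's inequality applies.\<close>
  define V where "V x y = L x y - ln (f1 (T1 x)) / 2 - ln (f2 (T2 y)) / 2 + ln 2 / 2 - x * y / 2" for x y
  \<comment> \<open>In \<open>V\<close> the term \<open>x * y / 2\<close> completes the square: half
    of the exponents of both Gaussian weights together with it give the exponent of the weight at
    \<open>(x + y) / sqrt 2\<close>. The coordinates are independent and centred, so this term has
    mean zero and leaves the expectation of \<open>V\<close> unchanged.\<close>
  have mx: "(\<integral>x. x \<partial>?N) = 0" and ix: "integrable ?N (\<lambda>x. x)"
    using std_normal_moment_odd[of 0] by (auto simp: integral_density integrable_density has_bochner_integral_iff)
  have iV: "integrable (?N \<Otimes>\<^sub>M ?N) (\<lambda>(x, y). V x y)"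
  proof -
    have "integrable (?N \<Otimes>\<^sub>M ?N) (\<lambda>z. fst z * snd z)"
    proof (rule NN.Fubini_integrable)
      show "integrable ?N (\<lambda>x. \<integral>y. norm (fst (x, y) * snd (x, y)) \<partial>?N)"
        using ix by (simp add: abs_mult)
      show "AE x in ?N. integrable ?N (\<lambda>y. fst (x, y) * snd (x, y))"
        using ix by simp
    qed measurable
    moreover have "bounded_measurable (?N \<Otimes>\<^sub>M ?N) (\<lambda>z. L (fst z) (snd z) - ln (f1 (T1 (fst z))) / 2 - ln (f2 (T2 (snd z))) / 2 + ln 2 / 2)"
      unfolding divide_inverse
      using bL by (intro bounded_measurable_add bounded_measurable_diff bounded_measurable_mult bounded_measurable_const
          bounded_measurable_compose[OF b1] bounded_measurable_compose[OF b2]) (auto simp: split_beta')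
    ultimately show ?thesis
      unfolding V_def split_beta'
      by (intro Bochner_Integration.integrable_diff) (auto dest: finite_measure.integrable_bounded_measurable[OF finNN])
  qed
  have EV: "(\<integral>z. V (fst z) (snd z) \<partial>(?N \<Otimes>\<^sub>M ?N)) = LL - E1 / 2 - E2 / 2 + ln 2 / 2"
  proof -
    have "(\<integral>z. V (fst z) (snd z) \<partial>(?N \<Otimes>\<^sub>M ?N)) = (\<integral>x. \<integral>y. V x y \<partial>?N \<partial>?N)"
      using NN.integral_fst'[OF iV] by (simp add: split_beta')
    also have "\<dots> = (\<integral>x. (\<integral>y. L x y \<partial>?N) - ln (f1 (T1 x)) / 2 - E2 / 2 + ln 2 / 2 \<partial>?N)"
    proof (intro Bochner_Integration.integral_cong refl)
      fix x
      have "bounded_measurable ?N (\<lambda>y. L x y)"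
        using bounded_measurable_compose[OF bL measurable_Pair1'[of x ?N ?N]] by simp
      then have "integrable ?N (\<lambda>y. L x y)" by (rule N.integrable_bounded_measurable)
      then show "(\<integral>y. V x y \<partial>?N) = (\<integral>y. L x y \<partial>?N) - ln (f1 (T1 x)) / 2 - E2 / 2 + ln 2 / 2"
        unfolding V_def using N.integrable_bounded_measurable[OF b2] ix
        by (simp add: e2 mx N1)
    qed
    also have "\<dots> = LL - E1 / 2 - E2 / 2 + ln 2 / 2"
    proof -
      have "integrable ?N (\<lambda>x. \<integral>y. L x y \<partial>?N)"
        by (intro N.integrable_bounded_measurable bounded_measurable_integral N.finite_measure_axioms bL)
      then show ?thesis using N.integrable_bounded_measurable[OF b1] by (simp add: e1 LL_def N1)
    qed
    finally show ?thesis .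
  qed
  let ?phi = std_normal_density
  have bound: "?phi x * (?phi y * exp (V x y)) \<le> g (T1 x - T2 y) * ((T1' x + T2' y) / sqrt 2) * ?phi ((x + y) / sqrt 2)" for x y
  proof -
    have ph: "0 < ?phi t" for t by (rule normal_density_pos) simp
    have f1e: "f1 (T1 x) = ?phi x / T1' x" and f2e: "f2 (T2 y) = ?phi y / T2' y"
      using T1(3)[of x] T2(3)[of y] T1'pos[of x] T2'pos[of y] by (auto simp: field_simps)
    have sq: "((x + y) / sqrt 2)\<^sup>2 = (x\<^sup>2 + 2 * x * y + y\<^sup>2) / 2"
      by (simp add: power_divide power2_eq_square algebra_simps)
    have "ln (?phi x) + ln (?phi y) + V x y = ln (g (T1 x - T2 y)) + ln (sqrt (T1' x * T2' y)) + ln (sqrt 2) + ln (?phi ((x + y) / sqrt 2))"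
      using ph[of x] ph[of y] T1'pos[of x] T2'pos[of y] unfolding V_def L_def f1e f2e
      by (simp add: ln_div ln_mult ln_sqrt ln_std_normal_density sq field_simps power2_sum)
    then have "exp (ln (?phi x) + ln (?phi y) + V x y) = exp (ln (g (T1 x - T2 y)) + ln (sqrt (T1' x * T2' y)) + ln (sqrt 2) + ln (?phi ((x + y) / sqrt 2)))"
      by simp
    then have "?phi x * (?phi y * exp (V x y)) = g (T1 x - T2 y) * (sqrt (T1' x * T2' y) * sqrt 2) * ?phi ((x + y) / sqrt 2)"
      using ph T1'pos[of x] T2'pos[of y] gpos by (simp add: exp_add mult.assoc)
    \<comment> \<open>Here the constant is determined: the mean inequality gains a factor
      \<open>2\<close>, the change from \<open>y\<close> to \<open>v\<close> costs
      \<open>sqrt 2\<close>, and the factor \<open>sqrt 2\<close>, which is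
      \<open>exp (ln 2 / 2)\<close>, uses up the rest.\<close>
    also have "sqrt (T1' x * T2' y) * sqrt 2 \<le> (T1' x + T2' y) / sqrt 2"
    proof -
      have "sqrt (T1' x * T2' y) \<le> (T1' x + T2' y) / 2"
        using T1'pos[of x] T2'pos[of y] by (intro arith_geo_mean_sqrt) auto
      then have "sqrt (T1' x * T2' y) * sqrt 2 \<le> (T1' x + T2' y) / 2 * sqrt 2"
        by (rule mult_right_mono) simp
      also have "\<dots> = (T1' x + T2' y) / sqrt 2"
        by (simp add: field_simps)
      finally show ?thesis .
    qed
    finally show ?thesis using gpos[of "T1 x - T2 y"] ph[of "(x+y)/sqrt 2"] by (simp add: mult_left_mono mult_right_mono)
  qed
  have [measurable]: "(\<lambda>w. V (a w) (b w)) \<in> borel_measurable W"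
    if [measurable]: "a \<in> borel_measurable W" "b \<in> borel_measurable W" for a b and W :: "'w measure"
    unfolding V_def L_def by measurable
  have Apos: "0 < A"
    unfolding A_def using R g emeasure_box_measure_pos[of "2 * R", where 'a=real]
    by (intro pinched_integral_pos finite_measure_box_measure) auto
  have expV: "(\<integral>\<^sup>+z. ennreal (exp (V (fst z) (snd z))) \<partial>(?N \<Otimes>\<^sub>M ?N)) \<le> ennreal A"
  proof -
    have "(\<integral>\<^sup>+z. ennreal (exp (V (fst z) (snd z))) \<partial>(?N \<Otimes>\<^sub>M ?N)) = (\<integral>\<^sup>+x. \<integral>\<^sup>+y. ennreal (exp (V x y)) \<partial>?N \<partial>?N)"
      by (subst N.nn_integral_fst[symmetric]) auto
    also have "\<dots> = (\<integral>\<^sup>+x. \<integral>\<^sup>+y. ennreal (?phi x * (?phi y * exp (V x y))) \<partial>lborel \<partial>lborel)"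
      by (simp add: nn_integral_density ennreal_mult' nn_integral_cmult)
    also have "\<dots> \<le> (\<integral>\<^sup>+x. \<integral>\<^sup>+y. ennreal (g (T1 x - T2 y) * ((T1' x + T2' y) / sqrt 2) * ?phi ((x + y) / sqrt 2)) \<partial>lborel \<partial>lborel)"
      by (intro nn_integral_mono ennreal_leI bound)
    \<comment> \<open>For fixed \<open>x\<close> the variable \<open>y\<close> is replaced by
      \<open>sqrt 2 * v - x\<close>; the Jacobian cancels the division by \<open>sqrt 2\<close>.
      What remains besides the weight of \<open>v\<close> has the form \<open>g (S x) * S' x\<close>
      in the variable \<open>x\<close>, for each fixed \<open>v\<close>.\<close>
    also have "\<dots> = (\<integral>\<^sup>+x. \<integral>\<^sup>+v. ennreal (?phi v) * ennreal (g (T1 x - T2 (sqrt 2 * v - x)) * (T1' x + T2' (sqrt 2 * v - x))) \<partial>lborel \<partial>lborel)"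
    proof (rule nn_integral_cong)
      fix x :: real
      have "(\<integral>\<^sup>+y. ennreal (g (T1 x - T2 y) * ((T1' x + T2' y) / sqrt 2) * ?phi ((x + y) / sqrt 2)) \<partial>lborel)
        = ennreal (sqrt 2) * (\<integral>\<^sup>+v. ennreal (g (T1 x - T2 (- x + sqrt 2 * v)) * ((T1' x + T2' (- x + sqrt 2 * v)) / sqrt 2) * ?phi ((x + (- x + sqrt 2 * v)) / sqrt 2)) \<partial>lborel)"
        by (subst nn_integral_real_affine[of _ "sqrt 2" "- x"]) auto
      also have "\<dots> = (\<integral>\<^sup>+v. ennreal (sqrt 2) * ennreal (g (T1 x - T2 (- x + sqrt 2 * v)) * ((T1' x + T2' (- x + sqrt 2 * v)) / sqrt 2) * ?phi ((x + (- x + sqrt 2 * v)) / sqrt 2)) \<partial>lborel)"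
        by (rule nn_integral_cmult[symmetric]) measurable
      also have "\<dots> = (\<integral>\<^sup>+v. ennreal (?phi v) * ennreal (g (T1 x - T2 (sqrt 2 * v - x)) * (T1' x + T2' (sqrt 2 * v - x))) \<partial>lborel)"
      proof (intro nn_integral_cong)
        fix v
        have "0 \<le> T1' x + T2' (sqrt 2 * v - x)" using T1'pos[of x] T2'pos[of "sqrt 2 * v - x"] by simp
        then show "ennreal (sqrt 2) * ennreal (g (T1 x - T2 (- x + sqrt 2 * v)) * ((T1' x + T2' (- x + sqrt 2 * v)) / sqrt 2) * ?phi ((x + (- x + sqrt 2 * v)) / sqrt 2))
          = ennreal (?phi v) * ennreal (g (T1 x - T2 (sqrt 2 * v - x)) * (T1' x + T2' (sqrt 2 * v - x)))"
          using gpos less_imp_le by (subst (1 2) ennreal_mult'[symmetric]) (auto simp: mult_ac)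
      qed
      finally show "(\<integral>\<^sup>+y. ennreal (g (T1 x - T2 y) * ((T1' x + T2' y) / sqrt 2) * ?phi ((x + y) / sqrt 2)) \<partial>lborel)
        = (\<integral>\<^sup>+v. ennreal (?phi v) * ennreal (g (T1 x - T2 (sqrt 2 * v - x)) * (T1' x + T2' (sqrt 2 * v - x))) \<partial>lborel)" .
    qed
    also have "\<dots> = (\<integral>\<^sup>+v. \<integral>\<^sup>+x. ennreal (?phi v) * ennreal (g (T1 x - T2 (sqrt 2 * v - x)) * (T1' x + T2' (sqrt 2 * v - x))) \<partial>lborel \<partial>lborel)"
      by (rule lborel_pair.Fubini') measurable
    also have "\<dots> = (\<integral>\<^sup>+v. ennreal (?phi v) * ennreal A \<partial>lborel)"
    proof (intro nn_integral_cong)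
      fix v :: real
      have "(\<integral>\<^sup>+x. ennreal (?phi v) * ennreal (g (T1 x - T2 (sqrt 2 * v - x)) * (T1' x + T2' (sqrt 2 * v - x))) \<partial>lborel)
        = ennreal (?phi v) * (\<integral>\<^sup>+x. ennreal (g (T1 x - T2 (sqrt 2 * v - x)) * (T1' x + T2' (sqrt 2 * v - x))) \<partial>lborel)"
        by (rule nn_integral_cmult) measurable
      also have "(\<integral>\<^sup>+x. ennreal (g (T1 x - T2 (sqrt 2 * v - x)) * (T1' x + T2' (sqrt 2 * v - x))) \<partial>lborel)
        = (\<integral>\<^sup>+x. ennreal (g x * indicator {-2*R..2*R} x) \<partial>lborel)"
      proof (rule nn_integral_substitution_UNIV)
        show "((\<lambda>x. T1 x - T2 (sqrt 2 * v - x)) has_real_derivative T1' x + T2' (sqrt 2 * v - x)) (at x)" for x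
          by (auto intro!: derivative_eq_intros T1(1) DERIV_chain2[OF T2(1)])
        show "0 \<le> T1' x + T2' (sqrt 2 * v - x)" for x using T1'pos[of x] T2'pos[of "sqrt 2 * v - x"] by auto
        show "continuous_on UNIV (\<lambda>x. T1' x + T2' (sqrt 2 * v - x))"
          by (intro continuous_intros T1(2) continuous_on_compose2[OF T2(2)]) auto
        \<comment> \<open>As \<open>x\<close> tends to infinity, \<open>T2\<close> is evaluated near
          minus infinity, so the limits \<open>R\<close> and \<open>- R\<close> enter with opposite
          signs and combine to \<open>2 * R\<close>. The integral over \<open>x\<close> therefore
          covers exactly the interval on which \<open>A\<close> is defined.\<close>
        have "filterlim (\<lambda>x. sqrt 2 * v - x) at_bot at_top" "filterlim (\<lambda>x. sqrt 2 * v - x) at_top at_bot" by real_asymp+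
        then show "((\<lambda>x. T1 x - T2 (sqrt 2 * v - x)) \<longlongrightarrow> 2 * R) at_top" "((\<lambda>x. T1 x - T2 (sqrt 2 * v - x)) \<longlongrightarrow> - 2 * R) at_bot"
          using tendsto_diff[OF T1(4) filterlim_compose[OF T2(5)]] tendsto_diff[OF T1(5) filterlim_compose[OF T2(4)]] by force+
      qed (use gpos less_imp_le in auto)
      also have "\<dots> = ennreal A"
        unfolding A_def using gpos finite_measure.integrable_bounded_measurable[OF finite_measure_box_measure pinched_imp_bounded[OF g]]
        by (subst nn_integral_eq_integral[symmetric])
           (auto simp: nn_integral_box_measure centered_box_real ennreal_mult' ennreal_indicator less_imp_le)
      finally show "(\<integral>\<^sup>+x. ennreal (?phi v) * ennreal (g (T1 x - T2 (sqrt 2 * v - x)) * (T1' x + T2' (sqrt 2 * v - x))) \<partial>lborel) = ennreal (?phi v) * ennreal A" .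
    qed
    also have "\<dots> = (\<integral>\<^sup>+v. ennreal (?phi v) \<partial>lborel) * ennreal A"
      by (rule nn_integral_multc) measurable
    also have "(\<integral>\<^sup>+v. ennreal (?phi v) \<partial>lborel) = 1"
      using N.emeasure_space_1 by (simp add: emeasure_density)
    finally show ?thesis by simp
  qed
  have iexp: "integrable (?N \<Otimes>\<^sub>M ?N) (\<lambda>z. exp (V (fst z) (snd z)))"
    using expV by (intro integrableI_nonneg) (auto simp: le_less_trans)
  have "(\<integral>z. exp (V (fst z) (snd z)) \<partial>(?N \<Otimes>\<^sub>M ?N)) \<le> A"
    using expV Apos by (subst (asm) nn_integral_eq_integral[OF iexp]) auto
  \<comment> \<open>Jensen's inequality in tangent form: \<open>ln t \<le> t - 1\<close> at
    \<open>t = exp V / A\<close>. After integration \<open>exp V / A\<close> contributes at most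
    one, so only \<open>ln A\<close> is left.\<close>
  moreover have "(\<integral>z. V (fst z) (snd z) \<partial>(?N \<Otimes>\<^sub>M ?N)) \<le> (\<integral>z. exp (V (fst z) (snd z)) / A - 1 + ln A \<partial>(?N \<Otimes>\<^sub>M ?N))"
  proof (rule integral_mono)
    show "integrable (?N \<Otimes>\<^sub>M ?N) (\<lambda>z. V (fst z) (snd z))" using iV by (simp add: split_beta')
    show "V (fst z) (snd z) \<le> exp (V (fst z) (snd z)) / A - 1 + ln A" for z
      using ln_le_minus_one[of "exp (V (fst z) (snd z)) / A"] Apos by (simp add: ln_div)
  qed (use iexp finNN in \<open>auto intro!: finite_measure.integrable_const\<close>)
  ultimately have "(\<integral>z. V (fst z) (snd z) \<partial>(?N \<Otimes>\<^sub>M ?N)) \<le> ln A"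
  proof -
    assume a: "(\<integral>z. exp (V (fst z) (snd z)) \<partial>(?N \<Otimes>\<^sub>M ?N)) \<le> A"
    assume "(\<integral>z. V (fst z) (snd z) \<partial>(?N \<Otimes>\<^sub>M ?N)) \<le> (\<integral>z. exp (V (fst z) (snd z)) / A - 1 + ln A \<partial>(?N \<Otimes>\<^sub>M ?N))"
    also have "\<dots> = (\<integral>z. exp (V (fst z) (snd z)) \<partial>(?N \<Otimes>\<^sub>M ?N)) / A - 1 + ln A"
      using iexp finNN by (simp add: NN.prob_space finite_measure.integrable_const)
    also have "\<dots> \<le> ln A" using a Apos by simp
    finally show ?thesis .
  qed
  then show ?thesis unfolding lhs EV A_def[symmetric] E1_def[symmetric] E2_def[symmetric] by simp
qed

section \<open>From continuous densities on an interval to arbitrary densities\<close>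

lemma (in finite_measure) bounded_convergence:
  fixes f :: "nat \<Rightarrow> 'a \<Rightarrow> real"
  assumes [measurable]: "\<And>n. f n \<in> borel_measurable M" "h \<in> borel_measurable M"
    and lim: "AE x in M. (\<lambda>n. f n x) \<longlonglongrightarrow> h x" and bd: "\<And>n x. x \<in> space M \<Longrightarrow> \<bar>f n x\<bar> \<le> C"
  shows "(\<lambda>n. \<integral>x. f n x \<partial>M) \<longlonglongrightarrow> (\<integral>x. h x \<partial>M)"
  by (rule integral_dominated_convergence[where w="\<lambda>_. C"]) (auto intro!: lim bd)

lemma pinched_box_measureI:
  "f \<in> borel_measurable borel \<Longrightarrow> 0 < c \<Longrightarrow> (\<And>x. c \<le> f x) \<Longrightarrow> (\<And>x. f x \<le> C) \<Longrightarrow> pinched (box_measure R) f"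
  unfolding pinched_def by (auto cong: measurable_cong_sets)

text \<open>A measurable function is the limit of continuous ones off a negligible set. Clamping
  them between the bounds \<open>c\<close> and \<open>C\<close> of \<open>f\<close> keeps continuity
  and limit; the masses then lie between \<open>c * V\<close> and \<open>C * V\<close> and tend to
  one by bounded convergence, so dividing by them restores total mass one with bounds uniform in
  \<open>n\<close>.\<close>

lemma continuous_density_approximation:
  fixes f :: "real \<Rightarrow> real"
  assumes R: "0 < R" and f: "pinched (box_measure R) f" and i: "(\<integral>x. f x \<partial>box_measure R) = 1"
  obtains h :: "nat \<Rightarrow> real \<Rightarrow> real" and c C where "0 < c" "\<And>n x. c \<le> h n x" "\<And>n x. h n x \<le> C"
    "\<And>n. continuous_on UNIV (h n)" "\<And>n. (\<integral>x. h n x \<partial>box_measure R) = 1"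
    "AE x in box_measure R. (\<lambda>n. h n x) \<longlonglongrightarrow> f x"
proof -
  interpret finite_measure "box_measure R :: real measure" by (rule finite_measure_box_measure)
  have ne: "emeasure (box_measure R :: real measure) (space (box_measure R)) \<noteq> 0"
    using emeasure_box_measure_pos[OF R, where 'a=real] by simp
  have fm[measurable]: "f \<in> borel_measurable borel" using f by (auto simp: pinched_def cong: measurable_cong_sets)
  obtain c C where c: "0 < c" "\<And>x. c \<le> f x" "\<And>x. f x \<le> C" using f unfolding pinched_def by auto
  have cC: "c \<le> C" using c(2)[of 0] c(3)[of 0] by simp
  have "f measurable_on UNIV"
    by (rule lebesgue_measurable_imp_measurable_on_real) (auto intro: measurable_completion)
  then obtain N g where N: "negligible N" and g: "\<And>n. continuous_on UNIV (g n)"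
    and lim: "\<And>x. x \<notin> N \<Longrightarrow> (\<lambda>n. g n x) \<longlonglongrightarrow> f x"
    unfolding measurable_on_def by auto
  have AEl: "AE x in box_measure R. (\<lambda>n. g n x) \<longlonglongrightarrow> f x"
  proof -
    have "AE x in lebesgue. x \<notin> N" using N
      by (simp add: negligible_iff_null_sets AE_not_in)
    then have "AE x in lborel. x \<notin> N" by (simp add: AE_completion_iff)
    then have "AE x in lborel. x \<in> centered_box R \<longrightarrow> (\<lambda>n. g n x) \<longlonglongrightarrow> f x" by eventually_elim (use lim in auto)
    then show ?thesis unfolding box_measure_def by (subst AE_density) (auto simp: indicator_def elim: eventually_mono)
  qed
  define k where "k n x = max c (min C (g n x))" for n x
  have kc: "continuous_on UNIV (k n)" for n unfolding k_def using g[of n] by (intro continuous_intros)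
  then have [measurable]: "k n \<in> borel_measurable borel" for n by (rule borel_measurable_continuous_onI)
  have kb: "c \<le> k n x" "k n x \<le> C" for n x using cC by (auto simp: k_def)
  have kl: "AE x in box_measure R. (\<lambda>n. k n x) \<longlonglongrightarrow> f x"
    using AEl
  proof eventually_elim
    case (elim x)
    have "(\<lambda>n. k n x) \<longlonglongrightarrow> max c (min C (f x))" unfolding k_def by (intro tendsto_intros elim)
    then show ?case using c(2)[of x] c(3)[of x] by (simp add: max_absorb2 min_absorb2)
  qed
  define m where "m n = (\<integral>x. k n x \<partial>box_measure R)" for n
  have kp: "pinched (box_measure R) (k n)" for n
    using kb c(1) by (intro pinched_box_measureI) auto
  have mm: "m \<longlonglongrightarrow> 1" unfolding m_def i[symmetric]
  proof (rule bounded_convergence[OF _ _ kl])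
    show "\<bar>k n x\<bar> \<le> C" for n x using kb[of n x] c(1) by auto
  qed (simp_all cong: measurable_cong_sets)
  define V where "V = measure (box_measure R :: real measure) UNIV"
  have V: "0 < V" using ne by (simp add: V_def emeasure_eq_measure zero_less_measure_iff measure_le_0_iff)
  have ml: "c * V \<le> m n" for n
  proof -
    have "(\<integral>x. c \<partial>(box_measure R :: real measure)) \<le> m n" unfolding m_def
      using kb integrable_bounded_measurable[OF pinched_imp_bounded[OF kp]] by (intro integral_mono) auto
    then show ?thesis by (simp add: V_def mult.commute)
  qed
  have mu: "m n \<le> C * V" for n
  proof -
    have "m n \<le> (\<integral>x. C \<partial>(box_measure R :: real measure))" unfolding m_def
      using kb integrable_bounded_measurable[OF pinched_imp_bounded[OF kp]] by (intro integral_mono) auto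
    then show ?thesis by (simp add: V_def mult.commute)
  qed
  have cV: "0 < c * V" using c(1) V by simp
  have mpos: "0 < m n" for n using ml[of n] cV by linarith
  show thesis
  proof
    show "0 < c / (C * V)" using c(1) cC V by simp
    show "c / (C * V) \<le> k n x / m n" for n x using kb[of n x] mu[of n] mpos[of n] c(1) by (intro frac_le) auto
    show "k n x / m n \<le> C / (c * V)" for n x using kb[of n x] ml[of n] cV c(1) cC by (intro frac_le) auto
    show "continuous_on UNIV (\<lambda>x. k n x / m n)" for n using mpos[of n] by (intro continuous_intros kc) auto
    show "(\<integral>x. k n x / m n \<partial>box_measure R) = 1" for n using mpos[of n] by (simp add: m_def)
    show "AE x in box_measure R. (\<lambda>n. k n x / m n) \<longlonglongrightarrow> f x"
      using kl
    proof eventually_elim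
      case (elim x)
      from tendsto_divide[OF elim mm] show ?case by simp
    qed
  qed
qed

text \<open>The approximating densities have two-sided bounds uniform in \<open>n\<close> and
  \<open>g\<close> is fixed, so every integrand in the continuous case is uniformly bounded and both
  sides converge.\<close>

lemma gibbs_epi_interval:
  assumes R: "0 < R"
  shows "gibbs_epi (box_measure R :: real measure) (box_measure (2 * R)) (-) (ln 2 / 2)"
proof -
  let ?D = "box_measure R :: real measure"
  interpret finite_measure ?D by (rule finite_measure_box_measure)
  have main: "(\<integral>x. \<integral>y. f1 x * f2 y * ln (g (x - y)) \<partial>?D \<partial>?D) \<le>
    ln (\<integral>z. g z \<partial>box_measure (2 * R)) + (\<integral>x. f1 x * ln (f1 x) \<partial>?D) / 2
      + (\<integral>x. f2 x * ln (f2 x) \<partial>?D) / 2 - ln 2 / 2"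
    if f1: "pinched ?D f1" and f2: "pinched ?D f2" and g: "pinched (box_measure (2 * R)) g"
      and i1: "(\<integral>x. f1 x \<partial>?D) = 1" and i2: "(\<integral>x. f2 x \<partial>?D) = 1" for f1 f2 g
  proof -
    have [measurable]: "f1 \<in> borel_measurable borel" "f2 \<in> borel_measurable borel" "g \<in> borel_measurable borel"
      using f1 f2 g by (auto simp: pinched_def cong: measurable_cong_sets)
    obtain h1 c1 C1 where h1: "0 < c1" "\<And>n x. c1 \<le> h1 n x" "\<And>n x. h1 n x \<le> C1"
      "\<And>n. continuous_on UNIV (h1 n)" "\<And>n. (\<integral>x. h1 n x \<partial>?D) = 1" "AE x in ?D. (\<lambda>n. h1 n x) \<longlonglongrightarrow> f1 x"
      by (rule continuous_density_approximation[OF R f1 i1]) (rule that)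
    obtain h2 c2 C2 where h2: "0 < c2" "\<And>n x. c2 \<le> h2 n x" "\<And>n x. h2 n x \<le> C2"
      "\<And>n. continuous_on UNIV (h2 n)" "\<And>n. (\<integral>x. h2 n x \<partial>?D) = 1" "AE x in ?D. (\<lambda>n. h2 n x) \<longlonglongrightarrow> f2 x"
      by (rule continuous_density_approximation[OF R f2 i2]) (rule that)
    have [measurable]: "h1 n \<in> borel_measurable borel" "h2 n \<in> borel_measurable borel" for n
      using h1(4) h2(4) by (auto intro: borel_measurable_continuous_onI)
    obtain K where K: "\<And>x. \<bar>ln (g x)\<bar> \<le> K"
      using pinched_ln_bounded[OF g] unfolding bounded_measurable_def by auto
    have K0: "0 \<le> K" using K[of 0] by linarith
    have ent: "(\<lambda>n. \<integral>x. h n x * ln (h n x) \<partial>?D) \<longlonglongrightarrow> (\<integral>x. f x * ln (f x) \<partial>?D)"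
      if "0 < c" and hb: "\<And>n x. c \<le> h n x" "\<And>n x. h n x \<le> C" and lim: "AE x in ?D. (\<lambda>n. h n x) \<longlonglongrightarrow> f x"
        and f: "pinched ?D f" and [measurable]: "\<And>n. h n \<in> borel_measurable borel" "f \<in> borel_measurable borel" for h f c C
    proof (rule bounded_convergence)
      show "AE x in ?D. (\<lambda>n. h n x * ln (h n x)) \<longlonglongrightarrow> f x * ln (f x)"
        using lim
      proof eventually_elim
        case (elim x)
        have "0 < f x" using pinched_pos[OF f] by simp
        then show ?case by (intro tendsto_intros elim) auto
      qed
      show "\<bar>h n x * ln (h n x)\<bar> \<le> C * (\<bar>ln c\<bar> + \<bar>ln C\<bar>)" for n x
      proof -
        have hp: "0 < h n x" using hb(1)[of n x] \<open>0 < c\<close> by linarith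
        have "ln c \<le> ln (h n x)" "ln (h n x) \<le> ln C" using hb[where n=n and x=x] \<open>0 < c\<close> hp by (auto intro!: ln_mono)
        then have "\<bar>ln (h n x)\<bar> \<le> \<bar>ln c\<bar> + \<bar>ln C\<bar>" by linarith
        then show ?thesis unfolding abs_mult using hp hb(2)[of n x] by (intro mult_mono) auto
      qed
    qed (simp_all cong: measurable_cong_sets)
    have inner: "(\<lambda>n. \<integral>y. h2 n y * ln (g (x - y)) \<partial>?D) \<longlonglongrightarrow> (\<integral>y. f2 y * ln (g (x - y)) \<partial>?D)" for x
    proof (rule bounded_convergence)
      show "AE y in ?D. (\<lambda>n. h2 n y * ln (g (x - y))) \<longlonglongrightarrow> f2 y * ln (g (x - y))"
        using h2(6) by eventually_elim (intro tendsto_intros)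
      show "\<bar>h2 n y * ln (g (x - y))\<bar> \<le> C2 * K" for n y
        unfolding abs_mult using h2(1) h2(2)[of n y] h2(3)[of n y] K by (intro mult_mono) auto
    qed measurable
    have outer: "(\<lambda>n. \<integral>x. h1 n x * (\<integral>y. h2 n y * ln (g (x - y)) \<partial>?D) \<partial>?D) \<longlonglongrightarrow> (\<integral>x. f1 x * (\<integral>y. f2 y * ln (g (x - y)) \<partial>?D) \<partial>?D)"
    proof (rule bounded_convergence)
      show "AE x in ?D. (\<lambda>n. h1 n x * (\<integral>y. h2 n y * ln (g (x - y)) \<partial>?D)) \<longlonglongrightarrow> f1 x * (\<integral>y. f2 y * ln (g (x - y)) \<partial>?D)"
        using h1(6) by eventually_elim (intro tendsto_intros inner)
      show "\<bar>h1 n x * (\<integral>y. h2 n y * ln (g (x - y)) \<partial>?D)\<bar> \<le> C1 * (C2 * K * measure ?D UNIV)" for n x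
      proof -
        have "\<bar>\<integral>y. h2 n y * ln (g (x - y)) \<partial>?D\<bar> \<le> (\<integral>y. C2 * K \<partial>?D)"
        proof (rule order_trans[OF integral_abs_bound integral_mono])
          have bd: "\<bar>h2 n y * ln (g (x - y))\<bar> \<le> C2 * K" for y
            unfolding abs_mult using h2(1) h2(2)[of n y] h2(3)[of n y] K by (intro mult_mono) auto
          then show "integrable ?D (\<lambda>y. \<bar>h2 n y * ln (g (x - y))\<bar>)"
            by (intro integrable_bounded_measurable) (auto simp: bounded_measurable_def)
          show "\<bar>h2 n y * ln (g (x - y))\<bar> \<le> C2 * K" for y by (rule bd)
        qed simp
        then have "\<bar>\<integral>y. h2 n y * ln (g (x - y)) \<partial>?D\<bar> \<le> C2 * K * measure ?D UNIV" by (simp add: mult_ac)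
        then show ?thesis
          unfolding abs_mult using h1(1) h1(2)[of n x] h1(3)[of n x] by (intro mult_mono) auto
      qed
    qed measurable
    have "(\<integral>x. f1 x * (\<integral>y. f2 y * ln (g (x - y)) \<partial>?D) \<partial>?D) \<le>
      ln (\<integral>z. g z \<partial>box_measure (2 * R)) + (\<integral>x. f1 x * ln (f1 x) \<partial>?D) / 2
      + (\<integral>x. f2 x * ln (f2 x) \<partial>?D) / 2 - ln 2 / 2"
    proof (rule LIMSEQ_le[OF outer])
      show "(\<lambda>n. ln (\<integral>z. g z \<partial>box_measure (2 * R)) + (\<integral>x. h1 n x * ln (h1 n x) \<partial>?D) / 2
      + (\<integral>x. h2 n x * ln (h2 n x) \<partial>?D) / 2 - ln 2 / 2) \<longlonglongrightarrow> ln (\<integral>z. g z \<partial>box_measure (2 * R)) + (\<integral>x. f1 x * ln (f1 x) \<partial>?D) / 2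
      + (\<integral>x. f2 x * ln (f2 x) \<partial>?D) / 2 - ln 2 / 2"
        by (intro tendsto_intros ent[OF h1(1,2,3,6) f1] ent[OF h2(1,2,3,6) f2]) auto
      have "(\<integral>x. h1 n x * (\<integral>y. h2 n y * ln (g (x - y)) \<partial>?D) \<partial>?D) \<le> ln (\<integral>z. g z \<partial>box_measure (2 * R)) + (\<integral>x. h1 n x * ln (h1 n x) \<partial>?D) / 2
      + (\<integral>x. h2 n x * ln (h2 n x) \<partial>?D) / 2 - ln 2 / 2" for n
        using gibbs_epi_interval_continuous[of R "min c1 c2" "h1 n" "max C1 C2" "h2 n" g] R h1(1) h2(1)
          h1(2,3)[of _ n] h1(2,3)[of n] h2(2,3)[of n] h1(4,5) h2(4,5) g
        by (simp add: min_le_iff_disj le_max_iff_disj mult.assoc)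
      then show "\<exists>N. \<forall>n\<ge>N. (\<integral>x. h1 n x * (\<integral>y. h2 n y * ln (g (x - y)) \<partial>?D) \<partial>?D) \<le> ln (\<integral>z. g z \<partial>box_measure (2 * R)) + (\<integral>x. h1 n x * ln (h1 n x) \<partial>?D) / 2
      + (\<integral>x. h2 n x * ln (h2 n x) \<partial>?D) / 2 - ln 2 / 2" by blast
    qed
    then show ?thesis by (simp add: mult.assoc)
  qed
  have "(\<lambda>(x, y). x - y) \<in> ?D \<Otimes>\<^sub>M ?D \<rightarrow>\<^sub>M box_measure (2 * R)"
    unfolding split_beta' by measurable
  then show ?thesis unfolding gibbs_epi_def
    using main emeasure_box_measure_pos[OF R, where 'a=real] emeasure_box_measure_pos[of "2 * R", where 'a=real] R
    by (auto simp: finite_measure_box_measure)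
qed

section \<open>Bounded densities with zeros and with arbitrary mass\<close>

text \<open>Both directions follow from \<open>ln u \<le> u - 1\<close>, at \<open>u = t\<close>
  from above and at \<open>u = 1 / t\<close> from below. The bound is crude; it serves as a
  dominating constant where a density approaches zero.\<close>

lemma abs_mult_ln_bound:
  fixes t :: real assumes "0 \<le> t" "t \<le> K" shows "\<bar>t * ln t\<bar> \<le> 1 + K * K"
proof (cases "t = 0")
  case False
  with assms have t: "0 < t" by simp
  have "t * ln t \<le> t * (t - 1)" using t ln_le_minus_one[of t] by (intro mult_left_mono) auto
  also have "\<dots> \<le> K * K" using assms t by (simp add: algebra_simps mult_mono add_increasing)
  finally have 1: "t * ln t \<le> 1 + K * K" by simp
  have "- ln t \<le> 1 / t - 1" using ln_le_minus_one[of "1 / t"] t by (simp add: ln_div)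
  then have "t * (- ln t) \<le> t * (1 / t - 1)" using t by (intro mult_left_mono) auto
  also have "\<dots> = 1 - t" using t by (simp add: field_simps)
  also have "\<dots> \<le> 1 + K * K" using t by (smt (verit) zero_le_square)
  finally show ?thesis using 1 by (simp add: abs_le_iff)
qed (auto intro: add_nonneg_nonneg)

text \<open>The inequality for the normalized density \<open>f x / m\<close> in both places,
  multiplied by \<open>m\<^sup>2\<close>; the term with \<open>ln m\<close> comes from the logarithm
  of the quotient. This form suits truncation, which changes the mass.\<close>

lemma gibbs_epi_homogeneous:
  assumes e: "gibbs_epi A B s k" and f: "pinched A f" and g: "pinched B g"
  defines "m \<equiv> (\<integral>x. f x \<partial>A)"
  shows "(\<integral>x. \<integral>y. f x * f y * ln (g (s x y)) \<partial>A \<partial>A) \<le>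
     m\<^sup>2 * ln (\<integral>z. g z \<partial>B) + m * (\<integral>x. f x * ln (f x) \<partial>A) - m\<^sup>2 * ln m - m\<^sup>2 * k"
proof -
  have fin: "finite_measure A" and ne: "emeasure A (space A) \<noteq> 0" using e unfolding gibbs_epi_def by auto
  interpret finite_measure A by fact
  have m: "0 < m" unfolding m_def by (rule pinched_integral_pos[OF fin ne f])
  have pc: "pinched A (\<lambda>x. m)" using m unfolding pinched_def by auto
  have pf: "pinched A (\<lambda>x. f x / m)" by (rule pinched_divide[OF f pc])
  have "(\<integral>x. \<integral>y. (f x / m) * (f y / m) * ln (g (s x y)) \<partial>A \<partial>A) \<le>
    ln (\<integral>z. g z \<partial>B) + (\<integral>x. f x / m * ln (f x / m) \<partial>A) / 2 + (\<integral>x. f x / m * ln (f x / m) \<partial>A) / 2 - k"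
    using m by (intro gibbs_epiD[OF e pf pf g]) (auto simp: m_def)
  also have "(\<integral>x. f x / m * ln (f x / m) \<partial>A) = (\<integral>x. (f x * ln (f x)) / m - f x * (ln m / m) \<partial>A)"
    using m pinched_pos[OF f] by (intro Bochner_Integration.integral_cong) (auto simp: ln_div field_simps)
  also have "\<dots> = (\<integral>x. f x * ln (f x) \<partial>A) / m - m * (ln m / m)"
    using pinched_imp_bounded[OF f] bounded_measurable_mult[OF pinched_imp_bounded[OF f] pinched_ln_bounded[OF f]]
    by (subst Bochner_Integration.integral_diff)
      (auto dest: integrable_bounded_measurable simp: m_def)
  also have "(\<integral>x. \<integral>y. (f x / m) * (f y / m) * ln (g (s x y)) \<partial>A \<partial>A) = (\<integral>x. \<integral>y. f x * f y * ln (g (s x y)) \<partial>A \<partial>A) / m\<^sup>2"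
  proof -
    have "(\<integral>x. \<integral>y. (f x / m) * (f y / m) * ln (g (s x y)) \<partial>A \<partial>A) = (\<integral>x. \<integral>y. f x * f y * ln (g (s x y)) / m\<^sup>2 \<partial>A \<partial>A)"
      by (intro Bochner_Integration.integral_cong refl) (simp add: power2_eq_square)
    then show ?thesis by simp
  qed
  finally have *: "(\<integral>x. \<integral>y. f x * f y * ln (g (s x y)) \<partial>A \<partial>A) / m\<^sup>2 \<le>
     ln (\<integral>z. g z \<partial>B) + ((\<integral>x. f x * ln (f x) \<partial>A) / m - m * (ln m / m)) - k"
    by simp
  have "0 < m\<^sup>2" using m by simp
  from *[unfolded pos_divide_le_eq[OF this]] have "(\<integral>x. \<integral>y. f x * f y * ln (g (s x y)) \<partial>A \<partial>A) \<le>
     (ln (\<integral>z. g z \<partial>B) + ((\<integral>x. f x * ln (f x) \<partial>A) / m - m * (ln m / m)) - k) * m\<^sup>2" .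
  also have "\<dots> = m\<^sup>2 * ln (\<integral>z. g z \<partial>B) + m * (\<integral>x. f x * ln (f x) \<partial>A) - m\<^sup>2 * ln m - m\<^sup>2 * k"
    using m by (simp add: field_simps power2_eq_square)
  finally show ?thesis .
qed

text \<open>The density is lifted to \<open>max (f x) (1 / real (Suc n))\<close>, which is pinched,
  and the lift is removed by bounded convergence. At zeros of \<open>f\<close> this works because
  \<open>t * ln t\<close> tends to \<open>0\<close>, the value of the integrand there; positive mass
  makes \<open>ln\<close> continuous at \<open>m\<close>.\<close>

lemma epi_box_bounded:
  fixes f g :: "'a::euclidean_space \<Rightarrow> real"
  assumes R: "0 < R" and [measurable]: "f \<in> borel_measurable borel" and f: "\<And>x. 0 \<le> f x" "\<And>x. f x \<le> K"
    and g: "pinched (box_measure (2 * R)) g"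
  defines "m \<equiv> (\<integral>x. f x \<partial>box_measure R)"
  assumes m: "0 < m"
  shows "(\<integral>x. \<integral>y. f x * f y * ln (g (x - y)) \<partial>box_measure R \<partial>box_measure R) \<le>
     m\<^sup>2 * ln (\<integral>z. g z \<partial>box_measure (2 * R)) + m * (\<integral>x. f x * ln (f x) \<partial>box_measure R) - m\<^sup>2 * ln m
       - m\<^sup>2 * (real DIM('a) * (ln 2 / 2))"
proof -
  let ?D = "box_measure R :: 'a measure"
  interpret finite_measure ?D by (rule finite_measure_box_measure)
  have [measurable]: "g \<in> borel_measurable borel"
    using g by (auto simp: pinched_def cong: measurable_cong_sets)
  obtain L where L: "\<And>x. \<bar>ln (g x)\<bar> \<le> L"
    using pinched_ln_bounded[OF g] unfolding bounded_measurable_def by auto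
  have L0: "0 \<le> L" using L[of 0] by linarith
  have K0: "0 \<le> K" using f(1)[of 0] f(2)[of 0] by linarith
  note e = gibbs_epi_box_measure[OF gibbs_epi_interval[OF R], where 'a='a]
  define h where "h n x = max (f x) (1 / real (Suc n))" for n x
  have [measurable]: "h n \<in> borel_measurable borel" for n unfolding h_def by measurable
  have h: "1 / real (Suc n) \<le> h n x" "h n x \<le> K + 1" for n x
  proof -
    have "1 / real (Suc n) \<le> 1" by simp
    then show "h n x \<le> K + 1" "1 / real (Suc n) \<le> h n x" using f(2)[of x] K0 unfolding h_def by linarith+
  qed
  have h0: "0 < h n x" for n x using h(1)[of n x] by (smt (verit) of_nat_0_less_iff zero_less_Suc zero_less_divide_1_iff)
  have hl: "(\<lambda>n. h n x) \<longlonglongrightarrow> f x" for x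
  proof -
    have "(\<lambda>n. h n x) \<longlonglongrightarrow> max (f x) 0" unfolding h_def
      by (intro tendsto_intros LIMSEQ_Suc[OF lim_1_over_n])
    then show ?thesis using f(1)[of x] by (simp add: max_absorb1)
  qed
  have hh: "(\<lambda>n. h n x * ln (h n x)) \<longlonglongrightarrow> f x * ln (f x)" for x
  proof (cases "f x = 0")
    case True
    have "(\<lambda>n. 1 / real (Suc n) * ln (1 / real (Suc n))) \<longlonglongrightarrow> 0" by real_asymp
    then show ?thesis using True by (simp add: h_def)
  next
    case False then show ?thesis by (intro tendsto_intros hl) auto
  qed
  have b1: "\<bar>h n x\<bar> \<le> K + 1" for n x using h0[of n x] h[of n x] by auto
  have b2: "\<bar>h n x * ln (h n x)\<bar> \<le> 1 + (K + 1) * (K + 1)" for n x using h0[of n x] h[of n x] by (intro abs_mult_ln_bound) auto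
  have bd: "\<bar>h n y * ln (g (x - y))\<bar> \<le> (K + 1) * L" for n x y
    unfolding abs_mult using b1[of n y] L[of "x - y"] K0 by (intro mult_mono) auto
  have l1: "(\<lambda>n. \<integral>x. h n x \<partial>?D) \<longlonglongrightarrow> m" unfolding m_def
    by (rule bounded_convergence) (auto intro!: hl b1)
  have l2: "(\<lambda>n. \<integral>x. h n x * ln (h n x) \<partial>?D) \<longlonglongrightarrow> (\<integral>x. f x * ln (f x) \<partial>?D)"
    by (rule bounded_convergence) (auto intro!: hh b2)
  have inner: "(\<lambda>n. \<integral>y. h n y * ln (g (x - y)) \<partial>?D) \<longlonglongrightarrow> (\<integral>y. f y * ln (g (x - y)) \<partial>?D)" for x
    by (rule bounded_convergence) (auto intro!: bd AE_I2 tendsto_intros hl)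
  have outer: "(\<lambda>n. \<integral>x. h n x * (\<integral>y. h n y * ln (g (x - y)) \<partial>?D) \<partial>?D) \<longlonglongrightarrow> (\<integral>x. f x * (\<integral>y. f y * ln (g (x - y)) \<partial>?D) \<partial>?D)"
  proof (rule bounded_convergence)
    show "AE x in ?D. (\<lambda>n. h n x * (\<integral>y. h n y * ln (g (x - y)) \<partial>?D)) \<longlonglongrightarrow> f x * (\<integral>y. f y * ln (g (x - y)) \<partial>?D)"
      by (intro AE_I2 tendsto_intros inner hl)
    show "\<bar>h n x * (\<integral>y. h n y * ln (g (x - y)) \<partial>?D)\<bar> \<le> (K + 1) * ((K + 1) * L * measure ?D UNIV)" for n x
    proof -
      have "\<bar>\<integral>y. h n y * ln (g (x - y)) \<partial>?D\<bar> \<le> (\<integral>y. (K + 1) * L \<partial>?D)"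
      proof (rule order_trans[OF integral_abs_bound integral_mono])
        show "integrable ?D (\<lambda>y. \<bar>h n y * ln (g (x - y))\<bar>)"
          using bd by (intro integrable_bounded_measurable) (auto simp: bounded_measurable_def)
      qed (auto intro: bd)
      then have "\<bar>\<integral>y. h n y * ln (g (x - y)) \<partial>?D\<bar> \<le> (K + 1) * L * measure ?D UNIV" by (simp add: mult_ac)
      then show ?thesis
        unfolding abs_mult using b1[of n x] K0 by (intro mult_mono) auto
    qed
  qed measurable
  have "(\<integral>x. f x * (\<integral>y. f y * ln (g (x - y)) \<partial>?D) \<partial>?D) \<le>
     m\<^sup>2 * ln (\<integral>z. g z \<partial>box_measure (2 * R)) + m * (\<integral>x. f x * ln (f x) \<partial>?D) - m\<^sup>2 * ln m - m\<^sup>2 * (real DIM('a) * (ln 2 / 2))"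
  proof (rule LIMSEQ_le[OF outer])
    let ?m = "\<lambda>n. \<integral>x. h n x \<partial>?D"
    show "(\<lambda>n. (?m n)\<^sup>2 * ln (\<integral>z. g z \<partial>box_measure (2 * R)) + ?m n * (\<integral>x. h n x * ln (h n x) \<partial>?D) - (?m n)\<^sup>2 * ln (?m n) - (?m n)\<^sup>2 * (real DIM('a) * (ln 2 / 2)))
      \<longlonglongrightarrow> m\<^sup>2 * ln (\<integral>z. g z \<partial>box_measure (2 * R)) + m * (\<integral>x. f x * ln (f x) \<partial>?D) - m\<^sup>2 * ln m - m\<^sup>2 * (real DIM('a) * (ln 2 / 2))"
      using m by (intro tendsto_intros l1 l2) auto
    have "pinched ?D (h n)" for n
      using h by (intro pinched_box_measureI[where c="1 / real (Suc n)" and C="K + 1"]) auto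
    from gibbs_epi_homogeneous[OF e this g]
    show "\<exists>N. \<forall>n\<ge>N. (\<integral>x. h n x * (\<integral>y. h n y * ln (g (x - y)) \<partial>?D) \<partial>?D) \<le> (?m n)\<^sup>2 * ln (\<integral>z. g z \<partial>box_measure (2 * R)) + ?m n * (\<integral>x. h n x * ln (h n x) \<partial>?D) - (?m n)\<^sup>2 * ln (?m n) - (?m n)\<^sup>2 * (real DIM('a) * (ln 2 / 2))"
      by (simp add: mult.assoc)
  qed
  then show ?thesis by (simp add: mult.assoc)
qed

section \<open>Passage from cubes to the whole space\<close>

text \<open>The positive part of \<open>t * ln t\<close> vanishes up to one and increases
  afterwards, so truncating a density from above can only lower it.\<close>

lemma mult_ln_mono_pos:
  fixes s t :: real assumes "0 \<le> s" "s \<le> t" shows "ennreal (s * ln s) \<le> ennreal (t * ln t)"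
proof (cases "s \<le> 1")
  case True
  then have "s * ln s \<le> 0" using assms by (cases "s = 0") (auto intro: mult_nonneg_nonpos)
  then show ?thesis by (simp add: ennreal_neg)
next
  case False
  then show ?thesis using assms by (intro ennreal_leI mult_mono) auto
qed

lemma nn_integral_box_measure_pair:
  fixes F :: "'a::euclidean_space \<Rightarrow> 'a \<Rightarrow> ennreal"
  assumes "(\<lambda>z. F (fst z) (snd z)) \<in> borel_measurable (borel \<Otimes>\<^sub>M borel)"
  shows "(\<integral>\<^sup>+z. F (fst z) (snd z) \<partial>(box_measure R \<Otimes>\<^sub>M box_measure R)) =
    (\<integral>\<^sup>+z. F (fst z) (snd z) * (indicator (centered_box R) (fst z) * indicator (centered_box R) (snd z)) \<partial>(lborel \<Otimes>\<^sub>M lborel))"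
proof -
  interpret finite_measure "box_measure R :: 'a measure" by (rule finite_measure_box_measure)
  have m[measurable]: "(\<lambda>w. F (a w) (b w)) \<in> borel_measurable W"
    if [measurable]: "a \<in> measurable W borel" "b \<in> measurable W borel" for a b and W :: "'w measure"
    using measurable_compose[of "\<lambda>w. (a w, b w)" W _ _ borel, OF _ assms] by simp
  have "(\<integral>\<^sup>+z. F (fst z) (snd z) \<partial>(box_measure R \<Otimes>\<^sub>M box_measure R)) = (\<integral>\<^sup>+x. \<integral>\<^sup>+y. F x y \<partial>box_measure R \<partial>box_measure R)"
    by (subst nn_integral_fst[symmetric]) auto
  also have "\<dots> = (\<integral>\<^sup>+x. (\<integral>\<^sup>+y. F x y * indicator (centered_box R) y \<partial>lborel) * indicator (centered_box R) x \<partial>lborel)"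
    by (simp add: nn_integral_box_measure)
  also have "\<dots> = (\<integral>\<^sup>+x. \<integral>\<^sup>+y. F x y * (indicator (centered_box R) x * indicator (centered_box R) y) \<partial>lborel \<partial>lborel)"
    by (intro nn_integral_cong, subst nn_integral_multc[symmetric]) (auto intro!: nn_integral_cong simp: ac_simps)
  also have "\<dots> = (\<integral>\<^sup>+z. F (fst z) (snd z) * (indicator (centered_box R) (fst z) * indicator (centered_box R) (snd z)) \<partial>(lborel \<Otimes>\<^sub>M lborel))"
    by (subst lborel.nn_integral_fst[symmetric]) auto
  finally show ?thesis .
qed

lemma centered_box_mono: "R \<le> S \<Longrightarrow> centered_box R \<subseteq> centered_box S"
  unfolding centered_box_def by force

lemma eventually_in_centered_box: "\<forall>\<^sub>F n in sequentially. x \<in> centered_box (real (Suc n))"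
proof -
  obtain n where n: "norm x \<le> real n" using real_arch_simple by blast
  show ?thesis
  proof (rule eventually_mono[OF eventually_ge_at_top[of n]])
    fix k assume "n \<le> k"
    then have "norm x \<le> real (Suc k)" using n by simp
    then show "x \<in> centered_box (real (Suc k))"
      unfolding centered_box_def using Basis_le_norm[of _ x] by fastforce
  qed
qed

text \<open>
  Splitting into positive and negative parts makes both sides meaningful without any integrability
  assumption; \<^term>\<open>ennreal\<close> sends negative reals to \<open>0\<close>.
\<close>

lemma gibbs_epi_density:
  fixes f g :: "'a::euclidean_space \<Rightarrow> real"
  assumes [measurable]: "f \<in> borel_measurable borel" "g \<in> borel_measurable borel"
    and f: "\<And>x. 0 \<le> f x" "(\<integral>\<^sup>+x. f x \<partial>lborel) = 1"
    and g: "\<And>x. 0 \<le> g x" "(\<integral>\<^sup>+x. g x \<partial>lborel) \<le> 1"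
    and pos: "AE z in lborel \<Otimes>\<^sub>M lborel. f (fst z) * f (snd z) \<noteq> 0 \<longrightarrow> 0 < g (fst z - snd z)"
  shows "(\<integral>\<^sup>+z. ennreal (f (fst z) * f (snd z)) * ennreal (ln (g (fst z - snd z))) \<partial>(lborel \<Otimes>\<^sub>M lborel))
      + ennreal (real DIM('a) * (ln 2 / 2)) + (\<integral>\<^sup>+x. ennreal (- (f x * ln (f x))) \<partial>lborel)
    \<le> (\<integral>\<^sup>+z. ennreal (f (fst z) * f (snd z)) * ennreal (- ln (g (fst z - snd z))) \<partial>(lborel \<Otimes>\<^sub>M lborel))
      + (\<integral>\<^sup>+x. ennreal (f x * ln (f x)) \<partial>lborel)"
proof -
  let ?k = "real DIM('a) * (ln 2 / 2)"
  let ?r = "\<lambda>n. real (Suc n)"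
  let ?B = "\<lambda>n. centered_box (?r n) :: 'a set"
  let ?D = "\<lambda>n. box_measure (?r n) :: 'a measure"
  let ?LL = "lborel \<Otimes>\<^sub>M lborel :: ('a \<times> 'a) measure"
  define fn where "fn n x = min (f x) (?r n)" for n x
  define V where "V n = measure (box_measure (2 * ?r n) :: 'a measure) UNIV" for n
  \<comment> \<open>A floor that makes \<open>g\<close> pinched. On the cube of radius
    \<open>2 * real (Suc n)\<close> it adds at most \<open>1 / real (Suc n)\<close> to the mass of
    \<open>g\<close>. It is also at most one, so it cannot affect the positive part of
    \<open>ln g\<close>.\<close>
  define e where "e n = 1 / (?r n * (1 + V n))" for n
  define gn where "gn n x = max (e n) (min (?r n) (g x))" for n x
  define m where "m n = (\<integral>x. fn n x \<partial>?D n)" for n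
  have V0: "0 \<le> V n" for n by (simp add: V_def)
  have e: "0 < e n" "e n \<le> 1" "e n * V n \<le> 1 / ?r n" for n
  proof -
    have "1 * 1 \<le> ?r n * (1 + V n)" using V0[of n] by (intro mult_mono) auto
    then show "0 < e n" "e n \<le> 1" by (auto simp: e_def)
    have "V n / (1 + V n) \<le> 1" using V0[of n] by simp
    then have "1 / ?r n * (V n / (1 + V n)) \<le> 1 / ?r n * 1" by (intro mult_left_mono) auto
    then show "e n * V n \<le> 1 / ?r n" by (simp add: e_def)
  qed
  have [measurable]: "fn n \<in> borel_measurable borel" "gn n \<in> borel_measurable borel" for n
    unfolding fn_def gn_def by measurable
  have fn: "0 \<le> fn n x" "fn n x \<le> ?r n" "fn n x \<le> f x" for n x using f(1)[of x] by (auto simp: fn_def)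
  have gn: "e n \<le> gn n x" "gn n x \<le> ?r n" for n x
    using e(2)[of n] unfolding gn_def by auto
  have gp: "pinched (box_measure (2 * ?r n)) (gn n)" for n
    using gn e(1) by (intro pinched_box_measureI[where c="e n" and C="?r n"]) auto
  interpret D: finite_measure "?D n" for n by (rule finite_measure_box_measure)
  interpret D2: finite_measure "box_measure (2 * ?r n) :: 'a measure" for n by (rule finite_measure_box_measure)
  have bfn: "bounded_measurable (?D n) (fn n)" for n
    using fn(1,2) unfolding bounded_measurable_def
    by (intro conjI exI[of _ "?r n"]) (auto cong: measurable_cong_sets)
  have ifn: "integrable (?D n) (fn n)" for n using D.integrable_bounded_measurable[OF bfn] .

  define Ip where "Ip = (\<integral>\<^sup>+z. ennreal (f (fst z) * f (snd z)) * ennreal (ln (g (fst z - snd z))) \<partial>?LL)"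
  define In where "In = (\<integral>\<^sup>+z. ennreal (f (fst z) * f (snd z)) * ennreal (- ln (g (fst z - snd z))) \<partial>?LL)"
  define Pp where "Pp = (\<integral>\<^sup>+x. ennreal (f x * ln (f x)) \<partial>lborel)"
  define Pn where "Pn = (\<integral>\<^sup>+x. ennreal (- (f x * ln (f x))) \<partial>lborel)"
  \<comment> \<open>Truncated versions are needed only for the left side, where they must increase
    to their limits; on the right side the truncated integrals are simply bounded by the full
    ones.\<close>
  define Ipn where "Ipn n = (\<integral>\<^sup>+z. ennreal (fn n (fst z) * fn n (snd z)) * ennreal (ln (min (?r n) (g (fst z - snd z))))
       * (indicator (?B n) (fst z) * indicator (?B n) (snd z)) \<partial>?LL)" for n
  define Pnn where "Pnn n = (\<integral>\<^sup>+x. ennreal (- (f x * ln (f x))) * indicator (?B n) x \<partial>lborel)" for n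

  have mn: "ennreal (m n) = (\<integral>\<^sup>+x. ennreal (fn n x) * indicator (?B n) x \<partial>lborel)" for n
    unfolding m_def using ifn fn(1)
    by (subst nn_integral_eq_integral[symmetric]) (auto simp: nn_integral_box_measure)
  have m0: "0 \<le> m n" for n unfolding m_def using fn(1) by (intro integral_nonneg_AE) auto
  have m1: "m n \<le> 1" for n
  proof -
    have "ennreal (m n) \<le> (\<integral>\<^sup>+x. f x \<partial>lborel)"
      unfolding mn using fn(3) by (intro nn_integral_mono) (auto simp: indicator_def ennreal_leI)
    then show ?thesis using f(2) by simp
  qed
  have Bmono: "n \<le> k \<Longrightarrow> indicator (?B n) x \<le> (indicator (?B k) x :: ennreal)" for n k x
    using centered_box_mono[of "?r n" "?r k"] by (auto simp: indicator_def)
  have fnmono: "n \<le> k \<Longrightarrow> fn n x \<le> fn k x" for n k x by (auto simp: fn_def)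
  have ev_r: "\<forall>\<^sub>F n in sequentially. t \<le> ?r n" for t
  proof -
    obtain n where "t \<le> real n" using real_arch_simple by blast
    then show ?thesis by (intro eventually_mono[OF eventually_ge_at_top[of n]]) auto
  qed
  have ev_fn: "\<forall>\<^sub>F n in sequentially. fn n x = f x" for x
    using ev_r[of "f x"] by eventually_elim (simp add: fn_def)
  have m_lim: "m \<longlonglongrightarrow> 1"
  proof -
    have "(\<lambda>n. \<integral>\<^sup>+x. ennreal (fn n x) * indicator (?B n) x \<partial>lborel) \<longlonglongrightarrow> (\<integral>\<^sup>+x. f x \<partial>lborel)"
    proof (rule nn_integral_LIMSEQ)
      show "incseq (\<lambda>n x. ennreal (fn n x) * indicator (?B n) x)"
        unfolding incseq_def le_fun_def by (intro allI impI mult_mono ennreal_leI fnmono Bmono) auto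
      show "(\<lambda>n. ennreal (fn n x) * indicator (?B n) x) \<longlonglongrightarrow> ennreal (f x)" for x
        by (rule tendsto_eventually) (use ev_fn[of x] eventually_in_centered_box[of x] in \<open>eventually_elim, simp\<close>)
    qed simp
    then have "(\<lambda>n. ennreal (m n)) \<longlonglongrightarrow> ennreal 1" using f(2) by (simp add: mn)
    then show ?thesis using m0 by (subst (asm) tendsto_ennreal_iff) auto
  qed
  have Ip_lim: "Ipn \<longlonglongrightarrow> Ip" unfolding Ipn_def Ip_def
  proof (rule nn_integral_LIMSEQ)
    have lnm: "ennreal (ln (min (?r n) t)) \<le> ennreal (ln (min (?r k) t))" if "n \<le> k" "0 \<le> t" for n k t
      using that by (cases "t = 0") (auto intro!: ennreal_leI ln_mono)
    show "incseq (\<lambda>n z. ennreal (fn n (fst z) * fn n (snd z)) * ennreal (ln (min (?r n) (g (fst z - snd z))))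
       * (indicator (?B n) (fst z) * indicator (?B n) (snd z)))"
      using fn(1) g(1)
      unfolding incseq_def le_fun_def by (intro allI impI mult_mono ennreal_leI fnmono Bmono lnm) auto
    show "(\<lambda>n. ennreal (fn n (fst z) * fn n (snd z)) * ennreal (ln (min (?r n) (g (fst z - snd z))))
       * (indicator (?B n) (fst z) * indicator (?B n) (snd z))) \<longlonglongrightarrow> ennreal (f (fst z) * f (snd z)) * ennreal (ln (g (fst z - snd z)))" for z
      by (rule tendsto_eventually) (use ev_fn[of "fst z"] ev_fn[of "snd z"] ev_r[of "g (fst z - snd z)"]
        eventually_in_centered_box[of "fst z"] eventually_in_centered_box[of "snd z"] in \<open>eventually_elim, simp add: min_absorb2\<close>)
  qed measurable
  have Pn_lim: "Pnn \<longlonglongrightarrow> Pn" unfolding Pnn_def Pn_def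
  proof (rule nn_integral_LIMSEQ)
    show "incseq (\<lambda>n x. ennreal (- (f x * ln (f x))) * indicator (?B n) x)"
      unfolding incseq_def le_fun_def by (intro allI impI mult_left_mono Bmono) auto
    show "(\<lambda>n. ennreal (- (f x * ln (f x))) * indicator (?B n) x) \<longlonglongrightarrow> ennreal (- (f x * ln (f x)))" for x
      by (rule tendsto_eventually) (use eventually_in_centered_box[of x] in \<open>eventually_elim, simp\<close>)
  qed measurable
  \<comment> \<open>The real inequality on the cube, with every term moved to the side where its
    sign is nonnegative. The error term collects the excess mass of the floored \<open>g\<close> and
    the mass defect of the truncated \<open>f\<close>; it vanishes as \<open>m n\<close> tends to
    one.\<close>
  have step: "Ipn n + ennreal ((m n)\<^sup>2 * ?k) + ennreal (m n) * Pnn n \<le> In + Pp + ennreal (1 / ?r n - (m n)\<^sup>2 * ln (m n))"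
    if mpos: "0 < m n" for n
  proof -
    let ?DD = "?D n \<Otimes>\<^sub>M ?D n"
    interpret DD: pair_sigma_finite "?D n" "?D n" ..
    have finDD: "finite_measure ?DD" by (intro finite_measure_pair_measure finite_measure_box_measure)
    have real_ineq: "(\<integral>x. \<integral>y. fn n x * fn n y * ln (gn n (x - y)) \<partial>?D n \<partial>?D n) \<le>
       (m n)\<^sup>2 * ln (\<integral>z. gn n z \<partial>box_measure (2 * ?r n)) + m n * (\<integral>x. fn n x * ln (fn n x) \<partial>?D n) - (m n)\<^sup>2 * ln (m n)
       - (m n)\<^sup>2 * ?k"
      unfolding m_def using mpos fn(1,2) gp by (intro epi_box_bounded[where K="?r n"]) (auto simp: m_def)
    let ?F = "\<lambda>z. fn n (fst z) * fn n (snd z) * ln (gn n (fst z - snd z))"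
    have bF: "bounded_measurable ?DD ?F"
    proof (intro bounded_measurable_mult pinched_ln_bounded)
      show "bounded_measurable ?DD (\<lambda>z. fn n (fst z))" "bounded_measurable ?DD (\<lambda>z. fn n (snd z))"
        by (rule bounded_measurable_compose[OF bfn]; measurable)+
      show "pinched ?DD (\<lambda>z. gn n (fst z - snd z))"
        by (rule pinched_compose[OF gp[of n]]) measurable
    qed
    note iF = finite_measure.integrable_bounded_measurable[OF finDD bF]
    have "(\<integral>x. \<integral>y. fn n x * fn n y * ln (gn n (x - y)) \<partial>?D n \<partial>?D n) = (\<integral>z. ?F z \<partial>?DD)"
      using DD.integral_fst'[OF iF] by simp
    then have 1: "(\<integral>z. ?F z \<partial>?DD) \<le>
       (m n)\<^sup>2 * ln (\<integral>z. gn n z \<partial>box_measure (2 * ?r n)) + m n * (\<integral>x. fn n x * ln (fn n x) \<partial>?D n) - (m n)\<^sup>2 * ln (m n)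
       - (m n)\<^sup>2 * ?k" using real_ineq by simp
    obtain r1 q1 where r1: "(\<integral>\<^sup>+z. ennreal (?F z) \<partial>?DD) = ennreal r1" "(\<integral>\<^sup>+z. ennreal (- ?F z) \<partial>?DD) = ennreal q1"
      "(\<integral>z. ?F z \<partial>?DD) = r1 - q1" "0 \<le> r1" "0 \<le> q1"
      by (rule integrableE[OF iF]) (rule that)
    have bE: "bounded_measurable (?D n) (\<lambda>x. fn n x * ln (fn n x))"
      using abs_mult_ln_bound[OF fn(1,2)] unfolding bounded_measurable_def
      by (intro conjI exI[of _ "1 + ?r n * ?r n"]) (auto cong: measurable_cong_sets)
    obtain r2 q2 where r2: "(\<integral>\<^sup>+x. ennreal (fn n x * ln (fn n x)) \<partial>?D n) = ennreal r2"
      "(\<integral>\<^sup>+x. ennreal (- (fn n x * ln (fn n x))) \<partial>?D n) = ennreal q2"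
      "(\<integral>x. fn n x * ln (fn n x) \<partial>?D n) = r2 - q2" "0 \<le> r2" "0 \<le> q2"
      by (rule integrableE[OF D.integrable_bounded_measurable[OF bE]]) (rule that)
    have G: "ln (\<integral>z. gn n z \<partial>box_measure (2 * ?r n)) \<le> 1 / ?r n"
    proof -
      have Gpos: "0 < (\<integral>z. gn n z \<partial>box_measure (2 * ?r n))"
        using emeasure_box_measure_pos[of "2 * ?r n", where 'a='a]
        by (intro pinched_integral_pos finite_measure_box_measure gp) auto
      have "ennreal (\<integral>z. gn n z \<partial>box_measure (2 * ?r n)) = (\<integral>\<^sup>+z. ennreal (gn n z) \<partial>box_measure (2 * ?r n))"
        using D2.integrable_bounded_measurable[OF pinched_imp_bounded[OF gp]] pinched_pos[OF gp[of n]]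
        by (subst nn_integral_eq_integral) (auto intro: less_imp_le)
      also have "\<dots> \<le> (\<integral>\<^sup>+z. ennreal (e n) + ennreal (g z) \<partial>box_measure (2 * ?r n))"
        using e(1)[of n] g(1) by (intro nn_integral_mono) (auto simp: gn_def ennreal_plus[symmetric] simp del: ennreal_plus intro!: ennreal_leI)
      also have "\<dots> = ennreal (e n) * emeasure (box_measure (2 * ?r n) :: 'a measure) UNIV + (\<integral>\<^sup>+z. ennreal (g z) \<partial>box_measure (2 * ?r n))"
        by (subst nn_integral_add) auto
      also have "\<dots> \<le> ennreal (e n * V n) + (\<integral>\<^sup>+z. ennreal (g z) \<partial>lborel)"
      proof (intro add_mono)
        show "ennreal (e n) * emeasure (box_measure (2 * ?r n) :: 'a measure) UNIV \<le> ennreal (e n * V n)"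
          using e(1)[of n] by (simp add: V_def D2.emeasure_eq_measure ennreal_mult' del: of_nat_Suc)
        show "(\<integral>\<^sup>+z. ennreal (g z) \<partial>box_measure (2 * ?r n)) \<le> (\<integral>\<^sup>+z. ennreal (g z) \<partial>lborel)"
          by (subst nn_integral_box_measure) (auto intro!: nn_integral_mono simp: indicator_def)
      qed
      also have "\<dots> \<le> ennreal (1 / ?r n) + ennreal 1"
        using e(3)[of n] g(2) by (intro add_mono ennreal_leI) auto
      also have "\<dots> = ennreal (1 / ?r n + 1)" by (subst ennreal_plus[symmetric]) auto
      finally have "(\<integral>z. gn n z \<partial>box_measure (2 * ?r n)) \<le> 1 / ?r n + 1" by (subst (asm) ennreal_le_iff) auto
      with Gpos have "ln (\<integral>z. gn n z \<partial>box_measure (2 * ?r n)) \<le> ln (1 / ?r n + 1)" by (intro ln_mono) auto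
      also have "\<dots> \<le> 1 / ?r n" using ln_le_minus_one[of "1 / ?r n + 1"] by (simp add: add_pos_pos)
      finally show ?thesis .
    qed
    have "(m n)\<^sup>2 * ln (\<integral>z. gn n z \<partial>box_measure (2 * ?r n)) \<le> (m n)\<^sup>2 * (1 / ?r n)"
      using G by (intro mult_left_mono) auto
    also have "\<dots> \<le> 1 * (1 / ?r n)" using m0[of n] m1[of n] by (intro mult_right_mono) (auto simp: power_le_one)
    finally have 2: "(m n)\<^sup>2 * ln (\<integral>z. gn n z \<partial>box_measure (2 * ?r n)) \<le> 1 / ?r n" by simp
    have lnm: "0 \<le> - ((m n)\<^sup>2 * ln (m n))" using mpos m1[of n] by (simp add: mult_nonneg_nonpos)
    have "r1 + (m n)\<^sup>2 * ?k + m n * q2 \<le> q1 + m n * r2 + (1 / ?r n - (m n)\<^sup>2 * ln (m n))"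
      using 1 2 unfolding r1(3) r2(3) by (simp add: algebra_simps)
    then have "ennreal (r1 + (m n)\<^sup>2 * ?k + m n * q2) \<le> ennreal (q1 + m n * r2 + (1 / ?r n - (m n)\<^sup>2 * ln (m n)))"
      by (rule ennreal_leI)
    moreover have "ennreal (r1 + (m n)\<^sup>2 * ?k + m n * q2) = ennreal r1 + ennreal ((m n)\<^sup>2 * ?k) + ennreal (m n) * ennreal q2"
      using r1 r2 m0[of n] by (simp add: ennreal_mult)
    moreover have "ennreal (q1 + m n * r2 + (1 / ?r n - (m n)\<^sup>2 * ln (m n))) = ennreal q1 + ennreal (m n) * ennreal r2 + ennreal (1 / ?r n - (m n)\<^sup>2 * ln (m n))"
    proof -
      have "0 \<le> 1 / ?r n" by simp
      with lnm have "0 \<le> 1 / ?r n - (m n)\<^sup>2 * ln (m n)" by linarith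
      then show ?thesis using r1 r2 m0[of n] by (simp add: ennreal_mult ennreal_plus)
    qed
    ultimately have 3: "ennreal r1 + ennreal ((m n)\<^sup>2 * ?k) + ennreal (m n) * ennreal q2
       \<le> ennreal q1 + ennreal (m n) * ennreal r2 + ennreal (1 / ?r n - (m n)\<^sup>2 * ln (m n))" by simp
    \<comment> \<open>Raising \<open>g\<close> to a floor not exceeding one changes its logarithm
      only where the positive part is zero before and after.\<close>
    have a1: "Ipn n = ennreal r1"
    proof -
      have "ennreal (ln (gn n x)) = ennreal (ln (min (?r n) (g x)))" for x
      proof (cases "g x < e n")
        case True
        then have "gn n x = e n" "min (?r n) (g x) = g x" using e(2)[of n] by (auto simp: gn_def)
        moreover have "ln (e n) \<le> 0" "ln (g x) \<le> 0" using e(1,2)[of n] True g(1)[of x] by (cases "g x = 0"; auto)+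
        ultimately show ?thesis by (simp add: ennreal_neg)
      next
        case False
        then show ?thesis using e(2)[of n] by (simp add: gn_def)
      qed
      then have "ennreal (?F z) = ennreal (fn n (fst z) * fn n (snd z)) * ennreal (ln (min (?r n) (g (fst z - snd z))))" for z
        using fn(1) by (simp add: ennreal_mult')
      then show ?thesis unfolding Ipn_def r1(1)[symmetric]
        by (subst nn_integral_box_measure_pair[where F="\<lambda>x y. ennreal (fn n x * fn n y) * ennreal (ln (min (?r n) (g (x - y))))", symmetric]) auto
    qed
    \<comment> \<open>The floor raises \<open>g\<close>, and the cap, being at least one, lowers it
      only where the negative part of the logarithm is zero. Since \<open>ln 0 = 0\<close>, the
      floor would increase the negative part at zeros of \<open>g\<close>; \<open>pos\<close> rules
      these out almost everywhere on the relevant set.\<close>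
    have a2: "ennreal q1 \<le> In"
    proof -
      have eq: "ennreal (- ?F z) = ennreal (fn n (fst z) * fn n (snd z)) * ennreal (- ln (gn n (fst z - snd z)))" for z
        using fn(1) by (simp add: ennreal_mult'[symmetric])
      have "ennreal q1 = (\<integral>\<^sup>+z. ennreal (fn n (fst z) * fn n (snd z)) * ennreal (- ln (gn n (fst z - snd z)))
         * (indicator (?B n) (fst z) * indicator (?B n) (snd z)) \<partial>?LL)"
        unfolding r1(2)[symmetric] eq
        by (subst nn_integral_box_measure_pair[where F="\<lambda>x y. ennreal (fn n x * fn n y) * ennreal (- ln (gn n (x - y)))", symmetric]) auto
      also have "\<dots> \<le> In" unfolding In_def
      proof (rule nn_integral_mono_AE)
        show "AE z in ?LL. ennreal (fn n (fst z) * fn n (snd z)) * ennreal (- ln (gn n (fst z - snd z)))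
         * (indicator (?B n) (fst z) * indicator (?B n) (snd z)) \<le> ennreal (f (fst z) * f (snd z)) * ennreal (- ln (g (fst z - snd z)))"
          using pos
        proof eventually_elim
          case (elim z)
          show ?case
          proof (cases "f (fst z) * f (snd z) = 0")
            case True
            then have "fn n (fst z) * fn n (snd z) = 0" using fn(1,3) by (metis mult_eq_0_iff order_antisym)
            then show ?thesis by (simp only: ennreal_0 mult_zero_left zero_le)
          next
            case False
            with elim have gp: "0 < g (fst z - snd z)" by simp
            have "ennreal (- ln (gn n (fst z - snd z))) \<le> ennreal (- ln (g (fst z - snd z)))"
            proof (cases "g (fst z - snd z) \<le> gn n (fst z - snd z)")
              case True then show ?thesis using gp by (intro ennreal_leI) (auto intro!: ln_mono)
            next
              case False
              then have "gn n (fst z - snd z) = ?r n" using e(2)[of n] unfolding gn_def by (auto simp: max_def min_def split: if_splits)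
              then show ?thesis by (simp add: ennreal_neg)
            qed
            moreover have "ennreal (fn n (fst z) * fn n (snd z)) \<le> ennreal (f (fst z) * f (snd z))"
              using fn f by (intro ennreal_leI mult_mono) auto
            ultimately have "ennreal (fn n (fst z) * fn n (snd z)) * ennreal (- ln (gn n (fst z - snd z))) * (indicator (?B n) (fst z) * indicator (?B n) (snd z))
               \<le> ennreal (f (fst z) * f (snd z)) * ennreal (- ln (g (fst z - snd z))) * (1 * 1)"
              by (intro mult_mono) (auto simp: indicator_def)
            then show ?thesis by simp
          qed
        qed
      qed
      finally show ?thesis .
    qed
    \<comment> \<open>The truncation height is at least one, and \<open>t * ln t\<close> is
      nonnegative from there on, so its negative part is unchanged.\<close>
    have a3: "Pnn n = ennreal q2"
    proof -
      have "ennreal (- (f x * ln (f x))) = ennreal (- (fn n x * ln (fn n x)))" for x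
      proof (cases "f x \<le> ?r n")
        case False
        then have "fn n x = ?r n" "1 \<le> f x" by (auto simp: fn_def)
        then show ?thesis by (simp add: ennreal_neg)
      qed (simp add: fn_def)
      then show ?thesis unfolding Pnn_def r2(2)[symmetric] by (subst nn_integral_box_measure) auto
    qed
    have a4: "ennreal (m n) * ennreal r2 \<le> Pp"
    proof -
      have "ennreal r2 \<le> Pp" unfolding r2(1)[symmetric] Pp_def
        using mult_ln_mono_pos[OF fn(1,3)]
        by (subst nn_integral_box_measure) (auto intro!: nn_integral_mono simp: indicator_def)
      then have "ennreal (m n) * ennreal r2 \<le> 1 * Pp" using m1[of n] by (intro mult_mono) auto
      then show ?thesis by simp
    qed
    have "Ipn n + ennreal ((m n)\<^sup>2 * ?k) + ennreal (m n) * Pnn n \<le> ennreal q1 + ennreal (m n) * ennreal r2 + ennreal (1 / ?r n - (m n)\<^sup>2 * ln (m n))"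
      using 3 unfolding a1 a3 .
    also have "\<dots> \<le> In + Pp + ennreal (1 / ?r n - (m n)\<^sup>2 * ln (m n))"
      by (intro add_mono a2 a4 order_refl)
    finally show ?thesis .
  qed
  have "Ip + ennreal (1\<^sup>2 * ?k) + ennreal 1 * Pn \<le> In + Pp + ennreal (0 - 1\<^sup>2 * ln 1)"
  proof (rule tendsto_le[OF sequentially_bot])
    show "(\<lambda>n. Ipn n + ennreal ((m n)\<^sup>2 * ?k) + ennreal (m n) * Pnn n) \<longlonglongrightarrow> Ip + ennreal (1\<^sup>2 * ?k) + ennreal 1 * Pn"
      by (intro tendsto_add Ip_lim tendsto_mult_ennreal Pn_lim tendsto_ennrealI tendsto_intros m_lim) auto
    show "(\<lambda>n. In + Pp + ennreal (1 / ?r n - (m n)\<^sup>2 * ln (m n))) \<longlonglongrightarrow> In + Pp + ennreal (0 - 1\<^sup>2 * ln 1)"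
      by (intro tendsto_add tendsto_const tendsto_ennrealI tendsto_diff LIMSEQ_Suc[OF lim_1_over_n] tendsto_mult tendsto_power tendsto_ln m_lim) auto
    have "\<forall>\<^sub>F n in sequentially. 0 < m n" using order_tendstoD(1)[OF m_lim, of 0] by simp
    then show "\<forall>\<^sub>F n in sequentially. Ipn n + ennreal ((m n)\<^sup>2 * ?k) + ennreal (m n) * Pnn n \<le> In + Pp + ennreal (1 / ?r n - (m n)\<^sup>2 * ln (m n))"
      by eventually_elim (rule step)
  qed
  then show ?thesis by (simp add: Ip_def In_def Pp_def Pn_def)
qed

section \<open>Conditional densities and mixtures\<close>

lemma has_cond_densityD:
  assumes "has_cond_density M N T Y q"
  shows "T \<in> measurable M N" "Y \<in> borel_measurable M"
    and "(\<lambda>(t, y). q t y) \<in> borel_measurable (N \<Otimes>\<^sub>M borel)"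
    and "\<And>t y. t \<in> space N \<Longrightarrow> 0 \<le> q t y"
    and "\<And>t. t \<in> space N \<Longrightarrow> (\<integral>\<^sup>+y. ennreal (q t y) \<partial>lborel) = 1"
    and "\<And>t. t \<in> space N \<Longrightarrow> q t \<in> borel_measurable borel"
    and "\<And>A. A \<in> sets borel \<Longrightarrow> AE \<omega> in M.
        cond_exp_given M N T (\<lambda>\<omega>. indicator A (Y \<omega>)) \<omega> = (LINT y:A|lborel. q (T \<omega>) y)"
proof -
  have *: "(\<lambda>(t, y). q t y) \<in> borel_measurable (N \<Otimes>\<^sub>M borel)"
    using assms unfolding has_cond_density_def
    by (simp cong: measurable_cong_sets sets_pair_measure_cong)
  then show "(\<lambda>(t, y). q t y) \<in> borel_measurable (N \<Otimes>\<^sub>M borel)" .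
  show "q t \<in> borel_measurable borel" if "t \<in> space N" for t
    using measurable_compose[OF measurable_Pair1'[OF that] *] by simp
qed (use assms in \<open>auto simp: has_cond_density_def\<close>)

lemma set_lebesgue_integral_density:
  fixes f :: "'a::euclidean_space \<Rightarrow> real"
  assumes [measurable]: "f \<in> borel_measurable borel" "A \<in> sets borel"
    and f: "\<And>x. 0 \<le> f x" "(\<integral>\<^sup>+x. ennreal (f x) \<partial>lborel) = 1"
  shows "ennreal (LINT y:A|lborel. f y) = (\<integral>\<^sup>+y. ennreal (f y) * indicator A y \<partial>lborel)"
    and "0 \<le> (LINT y:A|lborel. f y)"
proof -
  have "integrable lborel f" using f by (intro integrableI_nonneg) auto
  then have i: "integrable lborel (\<lambda>x. indicator A x * f x)"
    using integrable_real_mult_indicator[of A lborel f] by (simp add: mult.commute)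
  show "ennreal (LINT y:A|lborel. f y) = (\<integral>\<^sup>+y. ennreal (f y) * indicator A y \<partial>lborel)"
    using f(1) unfolding set_lebesgue_integral_def
    by (subst nn_integral_eq_integral[symmetric]) (use i in \<open>auto simp: ennreal_mult' ennreal_indicator mult.commute\<close>)
  show "0 \<le> (LINT y:A|lborel. f y)"
    using f(1) unfolding set_lebesgue_integral_def by (intro integral_nonneg_AE) auto
qed

lemma (in prob_space) cond_exp_given_expectation:
  assumes T: "T \<in> measurable M N" and f: "integrable M f"
  shows "integrable M (cond_exp_given M N T f)" "(\<integral>\<omega>. cond_exp_given M N T f \<omega> \<partial>M) = (\<integral>\<omega>. f \<omega> \<partial>M)"
proof -
  have "subalgebra M (vimage_algebra (space M) T N)"
    unfolding subalgebra_def using T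
    by (auto simp: sets_vimage_algebra2 measurable_space measurable_sets)
  then interpret finite_measure_subalgebra M "vimage_algebra (space M) T N" by unfold_locales
  show "integrable M (cond_exp_given M N T f)" "(\<integral>\<omega>. cond_exp_given M N T f \<omega> \<partial>M) = (\<integral>\<omega>. f \<omega> \<partial>M)"
    unfolding cond_exp_given_def using real_cond_exp_int[OF f] by auto
qed

text \<open>The tower property, rewritten over the law of \<open>T\<close>. The function
  \<open>f\<close> is separate from \<open>indicator A\<close> since the conditional expectations in
  the hypotheses are those of expressions in \<open>Y\<close> and \<open>Y'\<close>, which agree
  with such an indicator only on the space.\<close>

lemma (in prob_space) emeasure_of_cond_exp_given:
  assumes T: "T \<in> measurable M N" and A: "A \<in> events"
    and f: "\<And>\<omega>. \<omega> \<in> space M \<Longrightarrow> f \<omega> = indicator A \<omega>"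
    and Q: "Q \<in> borel_measurable N" and eq: "AE \<omega> in M. 0 \<le> cond_exp_given M N T f \<omega> \<and> ennreal (cond_exp_given M N T f \<omega>) = Q (T \<omega>)"
  shows "emeasure M A = (\<integral>\<^sup>+t. Q t \<partial>distr M N T)"
proof -
  have fi: "integrable M f \<longleftrightarrow> integrable M (indicator A :: _ \<Rightarrow> real)"
    by (rule Bochner_Integration.integrable_cong) (auto simp: f)
  have i: "integrable M f" unfolding fi using A by (simp add: emeasure_eq_measure)
  have "emeasure M A = ennreal (\<integral>\<omega>. f \<omega> \<partial>M)"
    using A by (simp add: f emeasure_eq_measure cong: Bochner_Integration.integral_cong)
  also have "\<dots> = ennreal (\<integral>\<omega>. cond_exp_given M N T f \<omega> \<partial>M)"
    by (simp add: cond_exp_given_expectation(2)[OF T i])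
  also have "\<dots> = (\<integral>\<^sup>+\<omega>. ennreal (cond_exp_given M N T f \<omega>) \<partial>M)"
    using eq by (subst nn_integral_eq_integral[OF cond_exp_given_expectation(1)[OF T i]]) auto
  also have "\<dots> = (\<integral>\<^sup>+\<omega>. Q (T \<omega>) \<partial>M)"
    using eq by (intro nn_integral_cong_AE) auto
  also have "\<dots> = (\<integral>\<^sup>+t. Q t \<partial>distr M N T)"
    using T Q by (subst nn_integral_distr) auto
  finally show ?thesis .
qed

lemma (in prob_space) emeasure_cond_density:
  assumes c: "has_cond_density M N T Y q" and A[measurable]: "A \<in> sets borel"
  shows "emeasure (distr M borel Y) A = (\<integral>\<^sup>+t. (\<integral>\<^sup>+y. ennreal (q t y) * indicator A y \<partial>lborel) \<partial>distr M N T)"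
proof -
  note d = has_cond_densityD[OF c]
  note [measurable] = d(1,2,3)
  have "emeasure (distr M borel Y) A = emeasure M (Y -` A \<inter> space M)"
    by (rule emeasure_distr) auto
  also have "\<dots> = (\<integral>\<^sup>+t. (\<integral>\<^sup>+y. ennreal (q t y) * indicator A y \<partial>lborel) \<partial>distr M N T)"
  proof (rule emeasure_of_cond_exp_given[OF d(1)])
    show "AE \<omega> in M. 0 \<le> cond_exp_given M N T (\<lambda>\<omega>. indicator A (Y \<omega>)) \<omega> \<and>
        ennreal (cond_exp_given M N T (\<lambda>\<omega>. indicator A (Y \<omega>)) \<omega>) = (\<integral>\<^sup>+y. ennreal (q (T \<omega>) y) * indicator A y \<partial>lborel)"
      using d(7)[OF A] AE_space
    proof eventually_elim
      case (elim \<omega>)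
      then have t: "T \<omega> \<in> space N" using measurable_space[OF d(1)] by auto
      with elim show ?case using set_lebesgue_integral_density[OF d(6)[OF t] A d(4)[OF t] d(5)[OF t]] by simp
    qed
  qed (auto simp: indicator_def)
  finally show ?thesis .
qed

text \<open>Conditional independence factorizes the probability of a rectangle, and two measures,
  finite on the whole space, that agree on all rectangles are equal. The exceptional null set in the
  hypotheses may depend on the rectangle; this does no harm, because \<open>t\<close> is integrated
  out before the extension to all Borel sets.\<close>

lemma (in prob_space) distr_cond_indep_pair:
  fixes Y Y' :: "'a \<Rightarrow> 'b::euclidean_space"
  assumes c: "has_cond_density M N T Y q" and c': "has_cond_density M N T Y' q" and ind: "cond_indep_given M N T Y Y'"
    and [measurable]: "h \<in> borel_measurable (borel \<Otimes>\<^sub>M borel)"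
  shows "(\<integral>\<^sup>+\<omega>. h (Y \<omega>, Y' \<omega>) \<partial>M) =
    (\<integral>\<^sup>+t. (\<integral>\<^sup>+z. ennreal (q t (fst z) * q t (snd z)) * h z \<partial>(lborel \<Otimes>\<^sub>M lborel)) \<partial>distr M N T)"
proof -
  note d = has_cond_densityD[OF c] and d' = has_cond_densityD[OF c']
  note [measurable] = d(1,2,3) d'(2)
  have qm[measurable]: "(\<lambda>w. q (a w) (b w)) \<in> borel_measurable W"
    if [measurable]: "a \<in> measurable W N" "b \<in> measurable W borel" for a b and W :: "'w measure"
    using measurable_compose[of "\<lambda>w. (a w, b w)" W _ _ borel, OF _ d(3)] by simp
  let ?P = "distr M N T"
  let ?LL = "lborel \<Otimes>\<^sub>M lborel :: ('b \<times> 'b) measure"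
  interpret P: prob_space ?P by (rule prob_space_distr) measurable
  have LL: "sigma_finite_measure ?LL" by (simp add: lborel_prod sigma_finite_lborel)
  interpret PL: pair_sigma_finite ?P ?LL using LL by (simp add: pair_sigma_finite_def P.sigma_finite_measure_axioms)
  let ?w = "\<lambda>x. ennreal (q (fst x) (fst (snd x)) * q (fst x) (snd (snd x)))"
  have wm[measurable]: "?w \<in> borel_measurable (?P \<Otimes>\<^sub>M ?LL)" by measurable
  let ?mu = "distr M (borel \<Otimes>\<^sub>M borel) (\<lambda>\<omega>. (Y \<omega>, Y' \<omega>))"
  let ?nu = "distr (density (?P \<Otimes>\<^sub>M ?LL) ?w) (borel \<Otimes>\<^sub>M borel) snd"
  have nu: "(\<integral>\<^sup>+z. u z \<partial>?nu) = (\<integral>\<^sup>+t. (\<integral>\<^sup>+z. ennreal (q t (fst z) * q t (snd z)) * u z \<partial>?LL) \<partial>?P)"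
    if [measurable]: "u \<in> borel_measurable (borel \<Otimes>\<^sub>M borel)" for u
  proof -
    have "(\<integral>\<^sup>+z. u z \<partial>?nu) = (\<integral>\<^sup>+x. ?w x * u (snd x) \<partial>(?P \<Otimes>\<^sub>M ?LL))"
      by (simp add: nn_integral_distr nn_integral_density)
    also have "\<dots> = (\<integral>\<^sup>+t. (\<integral>\<^sup>+z. ennreal (q t (fst z) * q t (snd z)) * u z \<partial>?LL) \<partial>?P)"
      by (subst sigma_finite_measure.nn_integral_fst[OF LL, symmetric]) auto
    finally show ?thesis .
  qed
  have "?mu = ?nu"
  proof (rule measure_eqI_generator_eq[where E="{A \<times> B | A B. A \<in> sets borel \<and> B \<in> sets borel}" and \<Omega>=UNIV and A="\<lambda>_. UNIV"])
    show "Int_stable {A \<times> B | A B. A \<in> sets borel \<and> B \<in> sets borel}"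
      by (rule Int_stable_pair_measure_generator)
    show "sets ?mu = sigma_sets UNIV {A \<times> B | A B. A \<in> sets borel \<and> B \<in> sets borel}"
      using sets_pair_measure[of borel borel] by simp
    then show "sets ?nu = sigma_sets UNIV {A \<times> B | A B. A \<in> sets borel \<and> B \<in> sets borel}" by simp
    fix X :: "('b \<times> 'b) set" assume "X \<in> {A \<times> B | A B. A \<in> sets borel \<and> B \<in> sets borel}"
    then obtain A B where X: "X = A \<times> B" and A[measurable]: "A \<in> sets borel" and B[measurable]: "B \<in> sets borel" by auto
    have "emeasure ?mu X = emeasure M ((\<lambda>\<omega>. (Y \<omega>, Y' \<omega>)) -` X \<inter> space M)"
      unfolding X by (rule emeasure_distr) auto
    also have "\<dots> = (\<integral>\<^sup>+t. (\<integral>\<^sup>+y. ennreal (q t y) * indicator A y \<partial>lborel) * (\<integral>\<^sup>+y. ennreal (q t y) * indicator B y \<partial>lborel) \<partial>?P)"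
    proof (rule emeasure_of_cond_exp_given[OF d(1), where f="\<lambda>\<omega>. indicator A (Y \<omega>) * indicator B (Y' \<omega>)"])
      show "(\<lambda>\<omega>. (Y \<omega>, Y' \<omega>)) -` X \<inter> space M \<in> events" unfolding X by measurable
      have "AE \<omega> in M. cond_exp_given M N T (\<lambda>\<omega>. indicator A (Y \<omega>) * indicator B (Y' \<omega>)) \<omega> =
          cond_exp_given M N T (\<lambda>\<omega>. indicator A (Y \<omega>)) \<omega> * cond_exp_given M N T (\<lambda>\<omega>. indicator B (Y' \<omega>)) \<omega>"
        using ind A B unfolding cond_indep_given_def by blast
      then show "AE \<omega> in M. 0 \<le> cond_exp_given M N T (\<lambda>\<omega>. indicator A (Y \<omega>) * indicator B (Y' \<omega>)) \<omega> \<and>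
        ennreal (cond_exp_given M N T (\<lambda>\<omega>. indicator A (Y \<omega>) * indicator B (Y' \<omega>)) \<omega>) =
        (\<integral>\<^sup>+y. ennreal (q (T \<omega>) y) * indicator A y \<partial>lborel) * (\<integral>\<^sup>+y. ennreal (q (T \<omega>) y) * indicator B y \<partial>lborel)"
        using d(7)[OF A] d'(7)[OF B] AE_space
      proof eventually_elim
        case (elim \<omega>)
        then have t: "T \<omega> \<in> space N" using measurable_space[OF d(1)] by auto
        note a = set_lebesgue_integral_density[OF d(6)[OF t] A d(4)[OF t] d(5)[OF t]]
        note b = set_lebesgue_integral_density[OF d(6)[OF t] B d(4)[OF t] d(5)[OF t]]
        show ?case unfolding elim using a b by (simp add: ennreal_mult)
      qed
    qed (auto simp: X indicator_def)
    also have "\<dots> = (\<integral>\<^sup>+t. (\<integral>\<^sup>+z. ennreal (q t (fst z) * q t (snd z)) * indicator X z \<partial>?LL) \<partial>?P)"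
    proof (rule nn_integral_cong)
      fix t assume "t \<in> space ?P"
      then have t: "t \<in> space N" by simp
      note [measurable] = d(6)[OF t]
      have "(\<integral>\<^sup>+z. ennreal (q t (fst z) * q t (snd z)) * indicator X z \<partial>?LL)
        = (\<integral>\<^sup>+x. (\<integral>\<^sup>+y. (ennreal (q t x) * indicator A x) * (ennreal (q t y) * indicator B y) \<partial>lborel) \<partial>lborel)"
        unfolding X by (subst lborel.nn_integral_fst[symmetric])
          (auto simp: d(4)[OF t] ennreal_mult indicator_times ac_simps intro!: nn_integral_cong)
      also have "\<dots> = (\<integral>\<^sup>+y. ennreal (q t y) * indicator A y \<partial>lborel) * (\<integral>\<^sup>+y. ennreal (q t y) * indicator B y \<partial>lborel)"
        by (simp add: nn_integral_cmult nn_integral_multc)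
      finally show "(\<integral>\<^sup>+y. ennreal (q t y) * indicator A y \<partial>lborel) * (\<integral>\<^sup>+y. ennreal (q t y) * indicator B y \<partial>lborel)
        = (\<integral>\<^sup>+z. ennreal (q t (fst z) * q t (snd z)) * indicator X z \<partial>?LL)" by simp
    qed
    also have "\<dots> = emeasure ?nu X"
      using nu[of "indicator X"] by (simp add: X)
    finally show "emeasure ?mu X = emeasure ?nu X" .
  next
    interpret mu: prob_space ?mu by (rule prob_space_distr) measurable
    show "emeasure ?mu UNIV \<noteq> \<infinity>" for i :: nat by simp
    show "range (\<lambda>_::nat. UNIV) \<subseteq> {A \<times> B | A B. A \<in> sets borel \<and> B \<in> sets (borel :: 'b measure)}"
      by (auto intro!: exI[of _ UNIV])
  qed auto
  then have "(\<integral>\<^sup>+z. h z \<partial>?mu) = (\<integral>\<^sup>+z. h z \<partial>?nu)" by simp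
  moreover have "(\<integral>\<^sup>+z. h z \<partial>?mu) = (\<integral>\<^sup>+\<omega>. h (Y \<omega>, Y' \<omega>) \<partial>M)" by (rule nn_integral_distr) auto
  ultimately show ?thesis by (simp only: nu[OF \<open>h \<in> _\<close>])
qed

text \<open>Fubini applied to the conditional densities. The real integral that defines the mixture
  has the default value zero where \<open>r t z\<close> is not integrable in \<open>t\<close>; the
  total mass one confines this to a null set of \<open>z\<close>, so the identity with the
  nonnegative integral holds almost everywhere, as the density requires.\<close>

lemma (in prob_space) mixture_density_props:
  fixes Z :: "'a \<Rightarrow> 'b::euclidean_space"
  assumes p: "\<And>t. t \<in> space N \<Longrightarrow> 0 \<le> p t" and D: "distributed M N T (\<lambda>t. ennreal (p t))"
    and c: "has_cond_density M N T Z r"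
  shows "mixture_density N p r \<in> borel_measurable borel" "0 \<le> mixture_density N p r z"
    and "distr M borel Z = density lborel (\<lambda>z. ennreal (mixture_density N p r z))"
proof -
  note d = has_cond_densityD[OF c]
  note [measurable] = d(1,2,3)
  have rm[measurable]: "(\<lambda>w. r (a w) (b w)) \<in> borel_measurable W"
    if [measurable]: "a \<in> measurable W N" "b \<in> measurable W borel" for a b and W :: "'w measure"
    using measurable_compose[of "\<lambda>w. (a w, b w)" W _ _ borel, OF _ d(3)] by simp
  let ?P = "distr M N T"
  interpret P: prob_space ?P by (rule prob_space_distr) measurable
  interpret PL: pair_sigma_finite ?P "lborel :: 'b measure" ..
  have PN: "?P = density N (\<lambda>t. ennreal (p t))" using D by (simp add: distributed_def)
  have [measurable]: "(\<lambda>t. ennreal (p t)) \<in> borel_measurable N" using D by (simp add: distributed_def)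
  have pm[measurable]: "p \<in> borel_measurable N"
  proof -
    have "(\<lambda>t. enn2real (ennreal (p t))) \<in> borel_measurable N" by measurable
    then show ?thesis by (rule measurable_cong[THEN iffD1, rotated]) (simp add: p)
  qed
  have m: "mixture_density N p r z = (\<integral>t. r t z \<partial>?P)" for z
    unfolding mixture_density_def PN using p by (subst integral_density) auto
  have "(\<lambda>z. \<integral>t. r t z \<partial>?P) \<in> borel_measurable borel"
    by (rule P.borel_measurable_lebesgue_integral) (simp add: split_beta', measurable)
  then show mm[measurable]: "mixture_density N p r \<in> borel_measurable borel" by (simp add: m[abs_def])
  show m0: "0 \<le> mixture_density N p r z" for z
    unfolding m using d(4) by (intro integral_nonneg_AE) (auto intro!: AE_I2)
  have tot: "(\<integral>\<^sup>+z. (\<integral>\<^sup>+t. ennreal (r t z) \<partial>?P) \<partial>lborel) = 1"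
  proof -
    have "(\<integral>\<^sup>+z. (\<integral>\<^sup>+t. ennreal (r t z) \<partial>?P) \<partial>lborel) = (\<integral>\<^sup>+t. (\<integral>\<^sup>+z. ennreal (r t z) \<partial>lborel) \<partial>?P)"
      by (rule PL.Fubini') measurable
    also have "\<dots> = (\<integral>\<^sup>+t. 1 \<partial>?P)" by (intro nn_integral_cong) (simp add: d(5))
    finally show ?thesis using P.emeasure_space_1 by simp
  qed
  have "AE z in lborel. (\<integral>\<^sup>+t. ennreal (r t z) \<partial>?P) \<noteq> \<infinity>"
    by (rule nn_integral_PInf_AE) (use tot in auto)
  then have mAE: "AE z in lborel. (\<integral>\<^sup>+t. ennreal (r t z) \<partial>?P) = ennreal (mixture_density N p r z)"
  proof eventually_elim
    case (elim z)
    have "integrable ?P (\<lambda>t. r t z)"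
      using elim d(4) by (intro integrableI_nonneg) (auto simp: less_top)
    then show ?case unfolding m using d(4) by (subst nn_integral_eq_integral) auto
  qed
  show "distr M borel Z = density lborel (\<lambda>z. ennreal (mixture_density N p r z))"
  proof (rule measure_eqI)
    fix A assume "A \<in> sets (distr M borel Z)"
    then have A[measurable]: "A \<in> sets borel" by simp
    have "emeasure (distr M borel Z) A = (\<integral>\<^sup>+t. (\<integral>\<^sup>+z. ennreal (r t z) * indicator A z \<partial>lborel) \<partial>?P)"
      by (rule emeasure_cond_density[OF c A])
    also have "\<dots> = (\<integral>\<^sup>+z. (\<integral>\<^sup>+t. ennreal (r t z) * indicator A z \<partial>?P) \<partial>lborel)"
      by (rule PL.Fubini'[symmetric]) measurable
    also have "\<dots> = (\<integral>\<^sup>+z. (\<integral>\<^sup>+t. ennreal (r t z) \<partial>?P) * indicator A z \<partial>lborel)"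
      by (intro nn_integral_cong nn_integral_multc) measurable
    also have "\<dots> = (\<integral>\<^sup>+z. ennreal (mixture_density N p r z) * indicator A z \<partial>lborel)"
      by (rule nn_integral_cong_AE) (use mAE in eventually_elim, simp)
    also have "\<dots> = emeasure (density lborel (\<lambda>z. ennreal (mixture_density N p r z))) A"
      by (subst emeasure_density) auto
    finally show "emeasure (distr M borel Z) A = emeasure (density lborel (\<lambda>z. ennreal (mixture_density N p r z))) A" .
  qed simp
qed

section \<open>Averaging over the parameter\<close>

text \<open>Cancels the common part of \<open>a\<close> and \<open>b\<close>: of the two truncated
  differences at most one is nonzero. It passes from the positive and negative parts of the entropy
  integrand to those of the entropy, which is what gets averaged.\<close>

lemma ennreal_le_split_diff:
  fixes x y :: ennreal and a b :: real
  assumes "x + ennreal b \<le> y + ennreal a" "0 \<le> a" "0 \<le> b"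
  shows "x + ennreal (b - a) \<le> y + ennreal (a - b)"
proof (cases x; cases y)
  fix u v assume uv: "x = ennreal u" "0 \<le> u" "y = ennreal v" "0 \<le> v"
  then have "u + b \<le> v + a" using assms by (simp add: ennreal_plus[symmetric] del: ennreal_plus)
  then show ?thesis using uv assms
    by (cases "a \<le> b") (auto simp: ennreal_neg ennreal_plus[symmetric] simp del: ennreal_plus)
qed (use assms in \<open>auto simp: top_unique\<close>)

theorem theorem3p1:
  fixes M :: "'w measure" and N :: "'t measure"
    and T :: "'w \<Rightarrow> 't" and p :: "'t \<Rightarrow> real"
    and Y Y' Z :: "'w \<Rightarrow> 'a::euclidean_space"
    and q r :: "'t \<Rightarrow> 'a \<Rightarrow> real"
  assumes "prob_space M"
    and "\<And>t. t \<in> space N \<Longrightarrow> 0 \<le> p t"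
    and "distributed M N T (\<lambda>t. ennreal (p t))"
    and "has_cond_density M N T Y q"
    and "has_cond_density M N T Y' q"
    and "cond_indep_given M N T Y Y'"
    and "Z = (\<lambda>\<omega>. Y \<omega> - Y' \<omega>)"
    and "has_cond_density M N T Z r"
    and "AE t in density N (\<lambda>t. ennreal (p t)). diff_entropy_exists (q t)"
    and "ext_integrable N (\<lambda>t. ereal (p t) * diff_entropy (q t))"
    and "diff_entropy_exists (mixture_density N p r)"
  shows "ext_integral N (\<lambda>t. ereal (p t) * diff_entropy (q t))
    \<le> diff_entropy (mixture_density N p r) - ereal (real DIM('a) / 2 * ln 2)"
proof -
  interpret prob_space M by fact
  note d = has_cond_densityD[OF assms(4)] and d' = has_cond_densityD[OF assms(5)]
  note [measurable] = d(1,2,3) d'(2)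
  have qm[measurable]: "(\<lambda>w. q (a w) (b w)) \<in> borel_measurable W"
    if [measurable]: "a \<in> measurable W N" "b \<in> measurable W borel" for a b and W :: "'v measure"
    using measurable_compose[of "\<lambda>w. (a w, b w)" W _ _ borel, OF _ d(3)] by simp
  let ?P = "distr M N T"
  let ?LL = "lborel \<Otimes>\<^sub>M lborel :: ('a \<times> 'a) measure"
  interpret P: prob_space ?P by (rule prob_space_distr) measurable
  have LL: "sigma_finite_measure ?LL" by (simp add: lborel_prod sigma_finite_lborel)
  interpret PL: pair_sigma_finite ?P ?LL using LL by (simp add: pair_sigma_finite_def P.sigma_finite_measure_axioms)
  have PN: "?P = density N (\<lambda>t. ennreal (p t))" using assms(3) by (simp add: distributed_def)
  have [measurable]: "(\<lambda>t. ennreal (p t)) \<in> borel_measurable N" using assms(3) by (simp add: distributed_def)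
  define g where "g = mixture_density N p r"
  note mix = mixture_density_props[OF assms(2,3,8)]
  have [measurable]: "g \<in> borel_measurable borel" using mix(1) by (simp add: g_def)
  have g0: "0 \<le> g z" for z using mix(2) by (simp add: g_def)
  have Zm[measurable]: "Z \<in> borel_measurable M" by (rule has_cond_densityD(2)[OF assms(8)])
  have gZ: "distr M borel Z = density lborel (\<lambda>z. ennreal (g z))" using mix(3) by (simp add: g_def)
  have g1: "(\<integral>\<^sup>+z. ennreal (g z) \<partial>lborel) = 1"
  proof -
    have "emeasure (distr M borel Z) UNIV = 1" by (simp add: emeasure_distr emeasure_space_1)
    then show ?thesis unfolding gZ by (simp add: emeasure_density)
  qed
  \<comment> \<open>The law of \<open>Z\<close> expressed in two ways. With the positive and
    negative parts of \<open>ln g\<close> for \<open>u\<close> it turns averaged cross entropies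
    into parts of the entropy of the mixture; with the indicator of the zero set of \<open>g\<close>
    it yields \<open>posAE\<close>.\<close>
  have law: "(\<integral>\<^sup>+t. (\<integral>\<^sup>+z. ennreal (q t (fst z) * q t (snd z)) * u (fst z - snd z) \<partial>?LL) \<partial>?P) = (\<integral>\<^sup>+z. ennreal (g z) * u z \<partial>lborel)"
    if [measurable]: "u \<in> borel_measurable borel" for u
  proof -
    have "(\<integral>\<^sup>+t. (\<integral>\<^sup>+z. ennreal (q t (fst z) * q t (snd z)) * u (fst z - snd z) \<partial>?LL) \<partial>?P) = (\<integral>\<^sup>+\<omega>. u (Z \<omega>) \<partial>M)"
      using distr_cond_indep_pair[OF assms(4,5,6), of "\<lambda>z. u (fst z - snd z)"] by (simp add: assms(7))
    also have "\<dots> = (\<integral>\<^sup>+z. u z \<partial>distr M borel Z)" by (simp add: nn_integral_distr)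
    also have "\<dots> = (\<integral>\<^sup>+z. ennreal (g z) * u z \<partial>lborel)" unfolding gZ by (simp add: nn_integral_density)
    finally show ?thesis .
  qed
  define A where "A t = (\<integral>\<^sup>+y. ennreal (ln (q t y) * q t y) \<partial>lborel)" for t
  define B where "B t = (\<integral>\<^sup>+y. ennreal (- (ln (q t y) * q t y)) \<partial>lborel)" for t
  define Ip where "Ip t = (\<integral>\<^sup>+z. ennreal (q t (fst z) * q t (snd z)) * ennreal (ln (g (fst z - snd z))) \<partial>?LL)" for t
  define In where "In t = (\<integral>\<^sup>+z. ennreal (q t (fst z) * q t (snd z)) * ennreal (- ln (g (fst z - snd z))) \<partial>?LL)" for t
  define Mp where "Mp = (\<integral>\<^sup>+z. ennreal (ln (g z) * g z) \<partial>lborel)"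
  define Mn where "Mn = (\<integral>\<^sup>+z. ennreal (- (ln (g z) * g z)) \<partial>lborel)"
  define h where "h t = diff_entropy (q t)" for t
  define Hp where "Hp = (\<integral>\<^sup>+t. e2ennreal (h t) \<partial>?P)"
  define Hn where "Hn = (\<integral>\<^sup>+t. e2ennreal (- h t) \<partial>?P)"
  let ?k = "real DIM('a) * (ln 2 / 2)"
  have [measurable]: "A \<in> borel_measurable N" "B \<in> borel_measurable N" unfolding A_def B_def by measurable
  have [measurable]: "Ip \<in> borel_measurable N" "In \<in> borel_measurable N" unfolding Ip_def In_def by measurable
  have h: "h t = - (enn2ereal (A t) - enn2ereal (B t))" for t
    unfolding h_def diff_entropy_def ext_integral_def A_def B_def by simp
  have [measurable]: "h \<in> borel_measurable N" unfolding h[abs_def] by measurable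
  have hg: "diff_entropy g = - (enn2ereal Mp - enn2ereal Mn)"
    unfolding diff_entropy_def ext_integral_def Mp_def Mn_def by simp
  \<comment> \<open>Moves the weight \<open>p t\<close> out of the integrand, so that averages
    become integrals over the law of \<open>T\<close>. Where \<open>p t = 0\<close> both sides
    vanish even if the entropy is infinite, as \<open>0 * \<infinity> = 0\<close>.\<close>
  have scale: "e2ennreal (ereal (p t) * x) = ennreal (p t) * e2ennreal x" if "t \<in> space N" for t x
  proof (cases "p t = 0")
    case False
    then have "0 < p t" using assms(2)[OF that] by simp
    then show ?thesis by (cases x) (auto simp: ennreal_mult' ennreal_mult_top e2ennreal_neg)
  qed (simp add: zero_ereal_def[symmetric])
  have scale': "e2ennreal (- (ereal (p t) * x)) = ennreal (p t) * e2ennreal (- x)" if "t \<in> space N" for t x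
    using scale[OF that, of "- x"] by simp
  have Hp: "(\<integral>\<^sup>+t. e2ennreal (ereal (p t) * diff_entropy (q t)) \<partial>N) = Hp"
    unfolding Hp_def PN h_def[symmetric] by (subst nn_integral_density) (auto intro!: nn_integral_cong scale)
  have Hn: "(\<integral>\<^sup>+t. e2ennreal (- (ereal (p t) * diff_entropy (q t))) \<partial>N) = Hn"
    unfolding Hn_def PN h_def[symmetric] by (subst nn_integral_density) (auto intro!: nn_integral_cong scale')
  have Hfin: "Hp < \<infinity> \<or> Hn < \<infinity>"
    using assms(10) unfolding ext_integrable_def Hp Hn by simp
  have Mfin: "Mp < \<infinity> \<or> Mn < \<infinity>"
    using assms(11) unfolding diff_entropy_exists_def ext_integrable_def g_def[symmetric] Mp_def Mn_def by simp
  \<comment> \<open>If \<open>Mn\<close> is infinite the right side is \<open>\<infinity>\<close>,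
    and if \<open>Hn\<close> is infinite the left side is \<open>- \<infinity>\<close>; the
    existence assumptions prevent the opposite part from being infinite too. The real work is the
    case in which both are finite.\<close>
  have goal: "enn2ereal Hp - enn2ereal Hn \<le> - (enn2ereal Mp - enn2ereal Mn) - ereal ?k"
  proof (cases "Mn = \<infinity> \<or> Hn = \<infinity>")
    case True
    then show ?thesis
    proof
      assume "Mn = \<infinity>"
      with Mfin obtain c where "Mp = ennreal c" "0 \<le> c" by (cases Mp) auto
      with \<open>Mn = \<infinity>\<close> show ?thesis by (simp add: enn2ereal_ennreal)
    next
      assume "Hn = \<infinity>"
      with Hfin obtain c where "Hp = ennreal c" "0 \<le> c" by (cases Hp) auto
      with \<open>Hn = \<infinity>\<close> show ?thesis by (simp add: enn2ereal_ennreal)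
    qed
  next
    case False
    \<comment> \<open>The difference \<open>Z\<close> almost surely avoids the zero set of its own
      density, and integrating over \<open>t\<close> splits this statement into one for almost every
      \<open>t\<close>.\<close>
    have posAE: "AE t in ?P. AE z in ?LL. q t (fst z) * q t (snd z) \<noteq> 0 \<longrightarrow> 0 < g (fst z - snd z)"
    proof -
      let ?u = "\<lambda>z. indicator {z. g z = 0} z :: ennreal"
      have "(\<integral>\<^sup>+t. (\<integral>\<^sup>+z. ennreal (q t (fst z) * q t (snd z)) * ?u (fst z - snd z) \<partial>?LL) \<partial>?P) = (\<integral>\<^sup>+z. ennreal (g z) * ?u z \<partial>lborel)"
        by (rule law) measurable
      also have "\<dots> = (\<integral>\<^sup>+z. 0 \<partial>(lborel :: 'a measure))" by (intro nn_integral_cong) (auto simp: indicator_def)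
      also have "\<dots> = 0" by simp
      finally have "AE t in ?P. (\<integral>\<^sup>+z. ennreal (q t (fst z) * q t (snd z)) * ?u (fst z - snd z) \<partial>?LL) = 0"
        by (subst (asm) nn_integral_0_iff_AE) auto
      then show ?thesis using AE_space
      proof eventually_elim
        case (elim t)
        then have t: "t \<in> space N" by simp
        note [measurable] = d(6)[OF t]
        from elim(1) have "AE z in ?LL. ennreal (q t (fst z) * q t (snd z)) * ?u (fst z - snd z) = 0"
          by (subst (asm) nn_integral_0_iff_AE) auto
        then show ?case
        proof eventually_elim
          case (elim z)
          show ?case
          proof
            assume "q t (fst z) * q t (snd z) \<noteq> 0"
            then have "0 < q t (fst z) * q t (snd z)" using d(4)[OF t] by (simp add: less_le)
            with elim have "g (fst z - snd z) \<noteq> 0" by (auto simp: indicator_def)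
            then show "0 < g (fst z - snd z)" using g0[of "fst z - snd z"] by simp
          qed
        qed
      qed
    qed
    \<comment> \<open>Finite \<open>Hn\<close> excludes entropy \<open>- \<infinity>\<close> for
      almost every \<open>t\<close>. Hence \<open>A t\<close> is finite and can be cancelled in
      \<open>key\<close>.\<close>
    have hnAE: "AE t in ?P. e2ennreal (- h t) \<noteq> \<infinity>"
      by (rule nn_integral_PInf_AE) (use False in \<open>auto simp: Hn_def\<close>)
    have key: "AE t in ?P. Ip t + ennreal ?k + e2ennreal (h t) \<le> In t + e2ennreal (- h t)"
      using posAE hnAE assms(9)[folded PN] AE_space
    proof eventually_elim
      case (elim t)
      then have t: "t \<in> space N" by simp
      have "Ip t + ennreal ?k + B t \<le> In t + A t"
        using gibbs_epi_density[OF d(6)[OF t] \<open>g \<in> _\<close> d(4)[OF t] d(5)[OF t] g0 _ elim(1)] g1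
        by (simp add: Ip_def In_def A_def B_def mult.commute)
      moreover have ex: "A t < \<infinity> \<or> B t < \<infinity>"
        using elim(3) unfolding diff_entropy_exists_def ext_integrable_def A_def B_def by simp
      have "A t \<noteq> \<infinity>"
      proof
        assume "A t = \<infinity>"
        with ex obtain c where "B t = ennreal c" "0 \<le> c" by (cases "B t") auto
        with \<open>A t = \<infinity>\<close> have "h t = -\<infinity>" unfolding h by (simp add: enn2ereal_ennreal)
        with elim(2) show False by simp
      qed
      then obtain a where a: "A t = ennreal a" "0 \<le> a" by (cases "A t") auto
      show ?case
      proof (cases "B t")
        case (real b)
        have "h t = ereal (b - a)" unfolding h a(1) real(2) using a(2) real(1) by (simp add: enn2ereal_ennreal)
        then have "e2ennreal (h t) = ennreal (b - a)" "e2ennreal (- h t) = ennreal (a - b)" by auto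
        then show ?thesis using calculation a real by (auto intro!: ennreal_le_split_diff)
      next
        \<comment> \<open>An infinite entropy of \<open>q t\<close> forces the negative part of the
          cross entropy to be infinite, and the inequality is trivial.\<close>
        case top
        then have "In t = top" using calculation a by (auto simp: top_unique)
        then show ?thesis by simp
      qed
    qed
    have "(\<integral>\<^sup>+t. Ip t + ennreal ?k + e2ennreal (h t) \<partial>?P) \<le> (\<integral>\<^sup>+t. In t + e2ennreal (- h t) \<partial>?P)"
      by (rule nn_integral_mono_AE[OF key])
    moreover have "(\<integral>\<^sup>+t. Ip t + ennreal ?k + e2ennreal (h t) \<partial>?P) = (\<integral>\<^sup>+t. Ip t \<partial>?P) + ennreal ?k + Hp"
      using P.emeasure_space_1 by (simp add: nn_integral_add Hp_def)
    moreover have "(\<integral>\<^sup>+t. In t + e2ennreal (- h t) \<partial>?P) = (\<integral>\<^sup>+t. In t \<partial>?P) + Hn"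
      by (simp add: nn_integral_add Hn_def)
    moreover have "(\<integral>\<^sup>+t. Ip t \<partial>?P) = Mp"
      unfolding Ip_def Mp_def using law[of "\<lambda>z. ennreal (ln (g z))"] g0
      by (simp add: ennreal_mult'[symmetric] mult.commute)
    moreover have "(\<integral>\<^sup>+t. In t \<partial>?P) = Mn"
      unfolding In_def Mn_def using law[of "\<lambda>z. ennreal (- ln (g z))"] g0
      by (simp add: ennreal_mult'[symmetric] mult.commute)
    ultimately have fin: "Mp + ennreal ?k + Hp \<le> Mn + Hn" by simp
    obtain mn where mn: "Mn = ennreal mn" "0 \<le> mn" using False by (cases Mn) auto
    obtain hn where hn: "Hn = ennreal hn" "0 \<le> hn" using False by (cases Hn) auto
    \<comment> \<open>Finiteness of the right side of \<open>fin\<close> passes to \<open>Mp\<close>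
      and \<open>Hp\<close>, so all four quantities are real and the terms may be moved
      across.\<close>
    have le: "Mp \<le> Mp + ennreal ?k + Hp" "Hp \<le> Mp + ennreal ?k + Hp"
      by (simp_all add: add.assoc add_increasing)
    have "Mp \<noteq> \<infinity>" "Hp \<noteq> \<infinity>" using fin le mn hn by (auto simp: top_unique)
    then obtain mp hp where mp: "Mp = ennreal mp" "0 \<le> mp" and hp: "Hp = ennreal hp" "0 \<le> hp"
      by (cases Mp; cases Hp) auto
    have k0: "0 \<le> ?k" by simp
    have "ennreal (mp + ?k + hp) \<le> ennreal (mn + hn)"
      using fin mp(2) hp(2) mn(2) hn(2) k0 unfolding mp(1) hp(1) mn(1) hn(1) by (simp add: ennreal_plus)
    then have "mp + ?k + hp \<le> mn + hn" using mn(2) hn(2) by (subst (asm) ennreal_le_iff) auto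
    then show ?thesis unfolding mp(1) hp(1) mn(1) hn(1) using mp(2) hp(2) mn(2) hn(2)
      by (simp add: enn2ereal_ennreal)
  qed
  have "ext_integral N (\<lambda>t. ereal (p t) * diff_entropy (q t)) = enn2ereal Hp - enn2ereal Hn"
    unfolding ext_integral_def Hp Hn ..
  also note goal
  finally show ?thesis unfolding hg[symmetric] g_def[symmetric] by (simp add: mult.commute)
qed

end
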